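(* Let $\mathcal H$ be a separable Hilbert space and let $\mathcal H_1\subset\mathcal H_2\subset\cdots\subset\mathcal H$ be finite dimensional subspaces such that the orthogonal projections $P_n$ onto $\mathcal H_n$ converge strongly to $I$. For each $n\in\mathbb N$ let $\{e_1^{(n)},\dots,e_{k_n}^{(n)}\}$ be an orthonormal basis of $\mathcal H_n$. Let $\Omega_2$ be the set of all operators $H=T+V:\operatorname{dom}(T)\to\mathcal H$ such that - $T$ is selfadjoint and semibounded, and $\bigcup_{n\in\mathbb N}\mathcal H_n$ is a core for $T$; - $\sigma(T)=\sigma_{e5}(T)$ and $\widehat\sigma_e(T)$ is convex; - $V\in L(\mathcal H)$, and $V$ and $V^*$ are $T$-compact. For every $H\in\Omega_2$ choose a decomposition $H=T+V$ as in the definition of $\Omega_2$ and set $s_T(H):=T$, $s_V(H):=V$. Let $$\Lambda_2=\{f_{i,j,n}\circ s_T\mid 1\le i,j\le k_n,\ n\in\mathbb N\}\cup\{f_{i,j,n}\circ s_V\mid 1\le i,j\le k_n,\ n\in\mathbb N\},$$ where $f_{i,j,n}(A)=\langle Ae_i^{(n)},e_j^{(n)}\rangle$. Then $\operatorname{SCI}(\Omega_2,\Lambda_2,\sigma(\cdot))=1$.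
   Context: Notation: $L(\mathcal H)$ is the space of bounded operators on $\mathcal H$; $\sigma$, $\rho$ denote spectrum and resolvent set. Essential spectra: $\sigma_{e2}(T)=\{\lambda\in\mathbb C\mid \exists (x_k)\subset\operatorname{dom}(T):\ \|x_k\|=1\ \forall k,\ x_k\rightharpoonup 0,\ \|(T-\lambda)x_k\|\to0\}$. $\sigma_{e5}(T)=\mathbb C\setminus\Delta_5(T)$, where $\Delta_5(T)$ is the union of all connected components of $\{\lambda\in\mathbb C\mid T-\lambda\text{ is semi-Fredholm}\}$ which intersect $\rho(T)$. Extended essential spectrum of a selfadjoint $T$: $\widehat\sigma_e(T)\subset[-\infty,\infty]$ is $\sigma_{e2}(T)$ together with $+\infty$ if $T$ is unbounded above and $-\infty$ if $T$ is unbounded below; "convex" means convex as a subset of the extended real line $[-\infty,\infty]$. A computational problem is a quadruple $(\Omega,\Lambda,\Xi,\mathcal M)$ where $\Omega$ is a set (primary set), $\Lambda$ is a set of complex valued functions on $\Omega$ (evaluation set), $\mathcal M$ is a metric space and $\Xi:\Omega\to\mathcal M$ is a map (problem function). An (arithmetic) algorithm is a map $\Gamma:\Omega\to\mathcal M$ such that for each $T\in\Omega$ there exists a finite subset $\Lambda_\Gamma(T)\subset\Lambda$ such that (i) the action of $\Gamma$ on $T$ depends only on $\{f(T)\}_{f\in\Lambda_\Gamma(T)}$; (ii) for every $S\in\Omega$ with $f(T)=f(S)$ for all $f\in\Lambda_\Gamma(T)$ one has $\Lambda_\Gamma(S)=\Lambda_\Gamma(T)$; (iii) the action of $\Gamma$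 on $T$ consists of performing only finitely many arithmetic operations on $\{f(T)\}_{f\in\Lambda_\Gamma(T)}$. A tower of algorithms of height $k$ is a family $\Gamma_{n_1,\dots,n_k}:\Omega\to\mathcal M$ of arithmetic algorithms such that $\Xi(T)=\lim_{n_k\to\infty}\cdots\lim_{n_1\to\infty}\Gamma_{n_1,\dots,n_k}(T)$ in $\mathcal M$ for all $T\in\Omega$. The Solvability Complexity Index $\operatorname{SCI}(\Omega,\Lambda,\Xi,\mathcal M)$ is the smallest integer $k$ for which there exists a tower of algorithms of height $k$ that computes $\Xi$. $\operatorname{SCI}(\Omega,\Lambda,\sigma(\cdot))$ denotes the SCI for $\Xi(T)=\sigma(T)$ and $\mathcal M$ the set of closed subsets of $\mathbb C$ with the Attouch-Wets metric $d_{\mathrm{AW}}(A,B)=\sum_{i=1}^\infty2^{-i}\min\{1,\sup_{|x|<i}|\operatorname{dist}(x,A)-\operatorname{dist}(x,B)|\}$.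
   Formalization: The Hilbert space is additionally assumed infinite dimensional; in finite dimension Ω₂ is empty (or, for H = {0}, a singleton with empty spectrum), so the SCI is 0 and the claim SCI = 1 fails. *)

theory Defs
  imports "HOL-Analysis.Analysis" "HOL-Library.Extended_Nat"
begin

section \<open>Complex Hilbert spaces\<close>

text \<open>The real structure (norm, topology, real inner product) is the one of the class
  \<^class>\<open>real_inner\<close>; the axioms say that it is the one underlying the complex structure.
  The inner product is linear in its first argument.\<close>

class complex_hilbert = real_inner + complete_space +
  fixes scaleC :: "complex \<Rightarrow> 'a \<Rightarrow> 'a" (infixr "*\<^sub>C" 75)
    and cinner :: "'a \<Rightarrow> 'a \<Rightarrow> complex"
  assumes scaleC_add_right: "a *\<^sub>C (x + y) = a *\<^sub>C x + a *\<^sub>C y"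
    and scaleC_add_left: "(a + b) *\<^sub>C x = a *\<^sub>C x + b *\<^sub>C x"
    and scaleC_scaleC: "a *\<^sub>C b *\<^sub>C x = (a * b) *\<^sub>C x"
    and scaleC_one: "1 *\<^sub>C x = x"
    and scaleR_scaleC: "r *\<^sub>R x = complex_of_real r *\<^sub>C x"
    and cinner_commute: "cinner y x = cnj (cinner x y)"
    and cinner_add_left: "cinner (x + y) z = cinner x z + cinner y z"
    and cinner_scaleC_left: "cinner (a *\<^sub>C x) z = a * cinner x z"
    and inner_Re_cinner: "inner x y = Re (cinner x y)"

global_interpretation complex_vector: vector_space "scaleC :: complex \<Rightarrow> 'a \<Rightarrow> 'a::complex_hilbert"
  by unfold_locales (simp_all add: scaleC_add_right scaleC_add_left scaleC_scaleC scaleC_one)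

definition separable_type :: "'a::topological_space itself \<Rightarrow> bool" where
  "separable_type _ \<longleftrightarrow> (\<exists>D::'a set. countable D \<and> closure D = UNIV)"

definition finite_dim :: "'a::complex_hilbert set \<Rightarrow> bool" where
  "finite_dim S \<longleftrightarrow> (\<exists>B. finite B \<and> S \<subseteq> complex_vector.span B)"

definition finite_codim :: "'a::complex_hilbert set \<Rightarrow> bool" where
  "finite_codim S \<longleftrightarrow> (\<exists>B. finite B \<and> complex_vector.span (S \<union> B) = UNIV)"

text \<open>Meaningful when \<open>S\<close> is a closed subspace.\<close>

definition orth_proj :: "'a::complex_hilbert set \<Rightarrow> 'a \<Rightarrow> 'a" where
  "orth_proj S x = (THE p. p \<in> S \<and> (\<forall>y\<in>S. cinner (x - p) y = 0))"

definition orthonormal_basis :: "(nat \<Rightarrow> 'a::complex_hilbert) \<Rightarrow> nat \<Rightarrow> 'a set \<Rightarrow> bool" where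
  "orthonormal_basis e k S \<longleftrightarrow>
     (\<forall>i\<in>{1..k}. \<forall>j\<in>{1..k}. cinner (e i) (e j) = (if i = j then 1 else 0)) \<and>
     complex_vector.span (e ` {1..k}) = S"

definition weakly_null :: "(nat \<Rightarrow> 'a::complex_hilbert) \<Rightarrow> bool" where
  "weakly_null x \<longleftrightarrow> (\<forall>y. (\<lambda>k. cinner (x k) y) \<longlonglongrightarrow> 0)"


section \<open>Unbounded operators\<close>

text \<open>An operator is a partial function, so that its domain \<^term>\<open>dom T\<close> is part of the
  operator and equality of operators includes equality of domains.\<close>

type_synonym 'a unbounded_op = "'a \<rightharpoonup> 'a"

abbreviation op_app :: "'a unbounded_op \<Rightarrow> 'a \<Rightarrow> 'a" where
  "op_app T x \<equiv> the (T x)"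

definition linear_op :: "'a::complex_hilbert unbounded_op \<Rightarrow> bool" where
  "linear_op T \<longleftrightarrow> complex_vector.subspace (dom T) \<and>
     (\<forall>x\<in>dom T. \<forall>y\<in>dom T. op_app T (x + y) = op_app T x + op_app T y) \<and>
     (\<forall>c. \<forall>x\<in>dom T. op_app T (c *\<^sub>C x) = c *\<^sub>C op_app T x)"

definition bounded_op :: "'a::complex_hilbert unbounded_op \<Rightarrow> bool" where
  "bounded_op V \<longleftrightarrow> linear_op V \<and> dom V = UNIV \<and> (\<exists>K. \<forall>x. norm (op_app V x) \<le> K * norm x)"

definition op_add :: "'a::complex_hilbert unbounded_op \<Rightarrow> 'a unbounded_op \<Rightarrow> 'a unbounded_op" where
  "op_add T V = (\<lambda>x. if x \<in> dom T \<inter> dom V then Some (op_app T x + op_app V x) else None)"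

definition op_shift :: "'a::complex_hilbert unbounded_op \<Rightarrow> complex \<Rightarrow> 'a unbounded_op" where
  "op_shift T z = (\<lambda>x. map_option (\<lambda>y. y - z *\<^sub>C x) (T x))"

definition op_kernel :: "'a::complex_hilbert unbounded_op \<Rightarrow> 'a set" where
  "op_kernel T = {x. T x = Some 0}"

definition closed_op :: "'a::complex_hilbert unbounded_op \<Rightarrow> bool" where
  "closed_op T \<longleftrightarrow> closed (Map.graph T)"

text \<open>Meaningful when \<open>T\<close> is densely defined, in which case \<open>z\<close> is unique.\<close>

definition op_adjoint :: "'a::complex_hilbert unbounded_op \<Rightarrow> 'a unbounded_op" where
  "op_adjoint T = (\<lambda>y. if \<exists>z. \<forall>x\<in>dom T. cinner (op_app T x) y = cinner x z
     then Some (THE z. \<forall>x\<in>dom T. cinner (op_app T x) y = cinner x z) else None)"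

definition selfadjoint_op :: "'a::complex_hilbert unbounded_op \<Rightarrow> bool" where
  "selfadjoint_op T \<longleftrightarrow> linear_op T \<and> closure (dom T) = UNIV \<and> op_adjoint T = T"

text \<open>\<^term>\<open>cinner (op_app T x) x\<close> is real for selfadjoint \<open>T\<close>.\<close>

definition bounded_above_op :: "'a::complex_hilbert unbounded_op \<Rightarrow> bool" where
  "bounded_above_op T \<longleftrightarrow> (\<exists>c. \<forall>x\<in>dom T. Re (cinner (op_app T x) x) \<le> c * (norm x)\<^sup>2)"

definition bounded_below_op :: "'a::complex_hilbert unbounded_op \<Rightarrow> bool" where
  "bounded_below_op T \<longleftrightarrow> (\<exists>c. \<forall>x\<in>dom T. c * (norm x)\<^sup>2 \<le> Re (cinner (op_app T x) x))"

definition semibounded_op :: "'a::complex_hilbert unbounded_op \<Rightarrow> bool" where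
  "semibounded_op T \<longleftrightarrow> bounded_above_op T \<or> bounded_below_op T"

definition core_of :: "'a::complex_hilbert set \<Rightarrow> 'a unbounded_op \<Rightarrow> bool" where
  "core_of D T \<longleftrightarrow> complex_vector.subspace D \<and> D \<subseteq> dom T \<and>
     closure (Map.graph (T |` D)) = Map.graph T"

text \<open>\<open>V\<close> is \<open>T\<close>-compact.\<close>

definition relatively_compact :: "'a::complex_hilbert unbounded_op \<Rightarrow> 'a unbounded_op \<Rightarrow> bool" where
  "relatively_compact T V \<longleftrightarrow> dom T \<subseteq> dom V \<and>
     (\<forall>x :: nat \<Rightarrow> 'a. range x \<subseteq> dom T \<and> bounded (range x) \<and> bounded (range (\<lambda>k. op_app T (x k)))
        \<longrightarrow> (\<exists>r. strict_mono r \<and> convergent (\<lambda>k. op_app V (x (r k)))))"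


section \<open>Spectra\<close>

definition resolvent_set :: "'a::complex_hilbert unbounded_op \<Rightarrow> complex set" where
  "resolvent_set T = {z. bij_betw (op_app (op_shift T z)) (dom T) UNIV \<and>
     (\<exists>K. \<forall>x\<in>dom T. norm x \<le> K * norm (op_app (op_shift T z) x))}"

definition spectrum :: "'a::complex_hilbert unbounded_op \<Rightarrow> complex set" where
  "spectrum T = - resolvent_set T"

definition semi_fredholm :: "'a::complex_hilbert unbounded_op \<Rightarrow> bool" where
  "semi_fredholm S \<longleftrightarrow> closed_op S \<and> closed (ran S) \<and>
     (finite_dim (op_kernel S) \<or> finite_codim (ran S))"

definition ess_spectrum2 :: "'a::complex_hilbert unbounded_op \<Rightarrow> complex set" where
  "ess_spectrum2 T = {z. \<exists>x :: nat \<Rightarrow> 'a. range x \<subseteq> dom T \<and> (\<forall>k. norm (x k) = 1) \<and>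
     weakly_null x \<and> (\<lambda>k. norm (op_app (op_shift T z) (x k))) \<longlonglongrightarrow> 0}"

definition Delta5 :: "'a::complex_hilbert unbounded_op \<Rightarrow> complex set" where
  "Delta5 T = \<Union>{C \<in> components {z. semi_fredholm (op_shift T z)}. C \<inter> resolvent_set T \<noteq> {}}"

definition ess_spectrum5 :: "'a::complex_hilbert unbounded_op \<Rightarrow> complex set" where
  "ess_spectrum5 T = - Delta5 T"

definition ext_ess_spectrum :: "'a::complex_hilbert unbounded_op \<Rightarrow> ereal set" where
  "ext_ess_spectrum T = {ereal r | r. complex_of_real r \<in> ess_spectrum2 T} \<union>
     (if bounded_above_op T then {} else {\<infinity>}) \<union> (if bounded_below_op T then {} else {-\<infinity>})"

definition ereal_convex :: "ereal set \<Rightarrow> bool" where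
  "ereal_convex S \<longleftrightarrow> (\<forall>a\<in>S. \<forall>b\<in>S. \<forall>c. a \<le> c \<and> c \<le> b \<longrightarrow> c \<in> S)"


section \<open>The Attouch-Wets metric\<close>

text \<open>The empty set is closed and must be covered. The case distinction amounts to the
  convention that the distance to the empty set is infinite, whereas
  \<^term>\<open>infdist x {}\<close> is \<open>0\<close>.\<close>

definition attouch_wets_dist :: "complex set \<Rightarrow> complex set \<Rightarrow> real" where
  "attouch_wets_dist A B =
     (if A = {} \<and> B = {} then 0 else if A = {} \<or> B = {} then 1
      else (\<Sum>n. (1/2) ^ Suc n * min 1 (SUP x\<in>ball 0 (real (Suc n)). \<bar>infdist x A - infdist x B\<bar>)))"

definition closed_subsets_metric :: "complex set metric" where
  "closed_subsets_metric = metric ({A. closed A}, attouch_wets_dist)"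

lemma infdist_diff_bounded_on_ball:
  fixes A B :: "complex set"
  assumes "x \<in> ball 0 r"
  shows "\<bar>infdist x A - infdist x B\<bar> \<le> infdist 0 A + infdist 0 B + 2 * r"
proof -
  have "norm x < r" using assms by simp
  moreover have "infdist x A \<le> infdist 0 A + norm x" "infdist x B \<le> infdist 0 B + norm x"
    using infdist_triangle[of x _ 0] by simp_all
  moreover have "0 \<le> infdist x A" "0 \<le> infdist x B" "0 \<le> infdist 0 A" "0 \<le> infdist 0 B" "0 \<le> norm x"
    by (simp_all add: infdist_nonneg)
  ultimately show ?thesis by linarith
qed

lemma bdd_above_infdist_diff:
  fixes A B :: "complex set"
  shows "bdd_above ((\<lambda>x. \<bar>infdist x A - infdist x B\<bar>) ` ball 0 r)"
  using infdist_diff_bounded_on_ball by (intro bdd_aboveI2) blast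

lemma Metric_space_attouch_wets: "Metric_space {A. closed A} attouch_wets_dist"
proof -
  define s where "s A B n = (SUP x\<in>ball 0 (real (Suc n)). \<bar>infdist x A - infdist x B\<bar>)"
    for A B :: "complex set" and n
  define t where "t A B n = (1/2) ^ Suc n * min 1 (s A B n)" for A B n
  have upper: "\<bar>infdist x A - infdist x B\<bar> \<le> s A B n" if "x \<in> ball 0 (real (Suc n))" for A B n x
    unfolding s_def by (rule cSUP_upper[OF that bdd_above_infdist_diff])
  have s_nonneg: "0 \<le> s A B n" for A B n
    by (rule order_trans[OF abs_ge_zero upper[of 0]]) simp
  have s_sym: "s A B n = s B A n" for A B n
    unfolding s_def by (simp add: abs_minus_commute)
  have s_tri: "s A C n \<le> s A B n + s B C n" for A B C n
    unfolding s_def[of A C]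
  proof (rule cSUP_least)
    fix x :: complex assume x: "x \<in> ball 0 (real (Suc n))"
    show "\<bar>infdist x A - infdist x C\<bar> \<le> s A B n + s B C n"
      using upper[OF x, of A B] upper[OF x, of B C] by linarith
  qed simp
  have t_nonneg: "0 \<le> t A B n" for A B n
    by (simp add: t_def s_nonneg)
  have t_le: "t A B n \<le> (1/2) ^ Suc n" for A B n
    unfolding t_def by (rule mult_left_le) (use s_nonneg in auto)
  have geo: "summable (\<lambda>n. (1/2::real) ^ Suc n)"
    by (rule sums_summable[OF power_half_series])
  have t_summable: "summable (t A B)" for A B
    by (rule summable_comparison_test'[OF geo, of 0]) (use t_nonneg t_le in auto)
  have t_tri: "t A C n \<le> t A B n + t B C n" for A B C n
  proof -
    have "min 1 (s A C n) \<le> min 1 (s A B n) + min 1 (s B C n)"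
      using s_tri[of A C n B] s_nonneg[of A B n] s_nonneg[of B C n] by (simp add: min_def)
    then show ?thesis
      unfolding t_def by (simp add: distrib_left[symmetric])
  qed
  have d_eq: "attouch_wets_dist A B =
     (if A = {} \<and> B = {} then 0 else if A = {} \<or> B = {} then 1 else suminf (t A B))" for A B
    by (simp add: attouch_wets_dist_def t_def[abs_def] s_def)
  have sum_le: "suminf (t A B) \<le> 1" for A B
    using suminf_le[OF t_le t_summable geo] sums_unique[OF power_half_series] by simp
  have sum_nonneg: "0 \<le> suminf (t A B)" for A B
    by (rule suminf_nonneg[OF t_summable t_nonneg])
  have t_refl: "suminf (t A A) = 0" for A
    by (simp add: t_def[abs_def] s_def)
  have sum_zero: "A \<subseteq> B" if "closed B" "B \<noteq> {}" "suminf (t A B) = 0" for A B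
  proof
    fix x assume xA: "x \<in> A"
    obtain n :: nat where n: "norm x < real n" using reals_Archimedean2 by blast
    have "t A B n = 0"
      using that(3) suminf_eq_zero_iff[OF t_summable t_nonneg] by blast
    then have "s A B n = 0" using s_nonneg[of A B n] by (auto simp: t_def min_def split: if_splits)
    moreover have "x \<in> ball 0 (real (Suc n))" using n by simp
    ultimately have "infdist x A = infdist x B" using upper[of x n A B] by simp
    then have "infdist x B = 0" using xA by simp
    then show "x \<in> B" using in_closed_iff_infdist_zero[OF that(1,2)] by blast
  qed
  show ?thesis
  proof
    fix A B :: "complex set"
    show "0 \<le> attouch_wets_dist A B" using sum_nonneg by (simp add: d_eq)
    have "t A B = t B A" by (simp add: t_def[abs_def] s_sym[of A B])
    then show "attouch_wets_dist A B = attouch_wets_dist B A" by (simp add: d_eq)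
  next
    fix A B :: "complex set" assume "A \<in> {A. closed A}" "B \<in> {A. closed A}"
    then have cl: "closed A" "closed B" by simp_all
    have sym: "t B A = t A B" by (simp add: t_def[abs_def] s_sym[of A B])
    have "suminf (t A B) = 0 \<longleftrightarrow> A = B" if "A \<noteq> {}" "B \<noteq> {}"
      using sum_zero[of B A] sum_zero[of A B] cl that sym by (auto simp: t_refl)
    then show "attouch_wets_dist A B = 0 \<longleftrightarrow> A = B" by (auto simp: d_eq)
  next
    fix A B C :: "complex set"
    have "suminf (t A C) \<le> suminf (t A B) + suminf (t B C)"
      unfolding suminf_add[OF t_summable t_summable]
      by (intro suminf_le t_tri t_summable summable_add)
    then show "attouch_wets_dist A C \<le> attouch_wets_dist A B + attouch_wets_dist B C"
      using sum_le[of A C] sum_nonneg[of A B] sum_nonneg[of B C] by (auto simp: d_eq)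
  qed
qed


section \<open>Arithmetic algorithms and the solvability complexity index\<close>

text \<open>The inputs of an arithmetic expression are names of complex numbers to be read. Complex
  arithmetic is understood as arithmetic on real and imaginary parts, hence conjugation.
  No constants other than \<open>0\<close>, \<open>1\<close> and \<open>\<i>\<close> are built in.\<close>

datatype (inputs: 'f) arith_expr =
    Input 'f
  | Zero
  | One
  | Imag_Unit
  | Add "'f arith_expr" "'f arith_expr"
  | Sub "'f arith_expr" "'f arith_expr"
  | Mul "'f arith_expr" "'f arith_expr"
  | Div "'f arith_expr" "'f arith_expr"
  | Conj "'f arith_expr"

primrec expr_value :: "('f \<Rightarrow> complex) \<Rightarrow> 'f arith_expr \<Rightarrow> complex" where
  "expr_value v (Input f) = v f"
| "expr_value v Zero = 0"
| "expr_value v One = 1"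
| "expr_value v Imag_Unit = \<i>"
| "expr_value v (Add a b) = expr_value v a + expr_value v b"
| "expr_value v (Sub a b) = expr_value v a - expr_value v b"
| "expr_value v (Mul a b) = expr_value v a * expr_value v b"
| "expr_value v (Div a b) = expr_value v a / expr_value v b"
| "expr_value v (Conj a) = cnj (expr_value v a)"

text \<open>A computation branches on comparisons of real numbers and, when it stops, returns a finite
  list of complex numbers. The tree may be infinite, since the number of operations is required
  to be finite for each input but not to be bounded over all inputs; \<open>computes\<close> is inductive, so
  it only holds for runs that stop.\<close>

codatatype 'f computation =
    Return "'f arith_expr list"
  | If_Positive "'f arith_expr" "'f computation" "'f computation"

text \<open>\<open>computes v p F zs\<close>: on the data \<open>v\<close>, the computation \<open>p\<close> reads exactly the inputs in
  \<open>F\<close>, performs finitely many operations and returns \<open>zs\<close>.\<close>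

inductive computes :: "('f \<Rightarrow> complex) \<Rightarrow> 'f computation \<Rightarrow> 'f set \<Rightarrow> complex list \<Rightarrow> bool"
  for v :: "'f \<Rightarrow> complex" where
  "computes v (Return es) (\<Union>(inputs ` set es)) (map (expr_value v) es)"
| "Re (expr_value v a) > 0 \<Longrightarrow> computes v p F zs \<Longrightarrow>
     computes v (If_Positive a p q) (inputs a \<union> F) zs"
| "\<not> Re (expr_value v a) > 0 \<Longrightarrow> computes v q F zs \<Longrightarrow>
     computes v (If_Positive a p q) (inputs a \<union> F) zs"

text \<open>A computation returns finitely many numbers, so the way in which these represent a point of
  the metric space has to be specified: this is the function \<open>repr\<close>. For the
  metric space of closed subsets of \<open>\<complex>\<close>, a list represents the finite set of its entries.\<close>

definition arithmetic_algorithm ::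
  "(complex list \<Rightarrow> 'm) \<Rightarrow> 'o set \<Rightarrow> ('o \<Rightarrow> complex) set \<Rightarrow> 'm metric \<Rightarrow> ('o \<Rightarrow> 'm) \<Rightarrow> bool" where
  "arithmetic_algorithm repr \<Omega> \<Lambda> M \<Gamma> \<longleftrightarrow> \<Gamma> ` \<Omega> \<subseteq> mspace M \<and>
     (\<exists>\<Lambda>\<Gamma> :: 'o \<Rightarrow> ('o \<Rightarrow> complex) set.
        (\<forall>T\<in>\<Omega>. finite (\<Lambda>\<Gamma> T) \<and> \<Lambda>\<Gamma> T \<subseteq> \<Lambda> \<and>
           (\<forall>S\<in>\<Omega>. (\<forall>f\<in>\<Lambda>\<Gamma> T. f T = f S) \<longrightarrow> \<Gamma> S = \<Gamma> T \<and> \<Lambda>\<Gamma> S = \<Lambda>\<Gamma> T)) \<and>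
        (\<exists>p. \<forall>T\<in>\<Omega>. \<exists>F zs. computes (\<lambda>f. f T) p F zs \<and> F \<subseteq> \<Lambda>\<Gamma> T \<and> \<Gamma> T = repr zs))"

text \<open>The head of the list of indices is the index of the innermost limit.\<close>

primrec iterated_limit :: "'m metric \<Rightarrow> nat \<Rightarrow> (nat list \<Rightarrow> 'm) \<Rightarrow> 'm \<Rightarrow> bool" where
  "iterated_limit M 0 F x \<longleftrightarrow> F [] = x"
| "iterated_limit M (Suc k) F x \<longleftrightarrow>
     (\<exists>G. (\<forall>ns. length ns = k \<longrightarrow>
             limitin (mtopology_of M) (\<lambda>n. F (n # ns)) (G ns) sequentially) \<and>
          iterated_limit M k G x)"

definition tower_of_algorithms ::
  "(complex list \<Rightarrow> 'm) \<Rightarrow> 'o set \<Rightarrow> ('o \<Rightarrow> complex) set \<Rightarrow> ('o \<Rightarrow> 'm) \<Rightarrow> 'm metric \<Rightarrow>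
     nat \<Rightarrow> (nat list \<Rightarrow> 'o \<Rightarrow> 'm) \<Rightarrow> bool" where
  "tower_of_algorithms repr \<Omega> \<Lambda> \<Xi> M k \<Gamma> \<longleftrightarrow>
     (\<forall>ns. length ns = k \<longrightarrow> arithmetic_algorithm repr \<Omega> \<Lambda> M (\<Gamma> ns)) \<and>
     (\<forall>T\<in>\<Omega>. iterated_limit M k (\<lambda>ns. \<Gamma> ns T) (\<Xi> T))"

definition SCI ::
  "(complex list \<Rightarrow> 'm) \<Rightarrow> 'o set \<Rightarrow> ('o \<Rightarrow> complex) set \<Rightarrow> ('o \<Rightarrow> 'm) \<Rightarrow> 'm metric \<Rightarrow> enat" where
  "SCI repr \<Omega> \<Lambda> \<Xi> M = Inf {enat k | k. \<exists>\<Gamma>. tower_of_algorithms repr \<Omega> \<Lambda> \<Xi> M k \<Gamma>}"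

abbreviation SCI_spectrum ::
  "'a::complex_hilbert unbounded_op set \<Rightarrow> ('a unbounded_op \<Rightarrow> complex) set \<Rightarrow> enat" where
  "SCI_spectrum \<Omega> \<Lambda> \<equiv> SCI set \<Omega> \<Lambda> spectrum closed_subsets_metric"


section \<open>The class of operators and the evaluation set\<close>

definition admissible_decomposition ::
  "(nat \<Rightarrow> 'a::complex_hilbert set) \<Rightarrow> 'a unbounded_op \<Rightarrow> 'a unbounded_op \<Rightarrow> bool" where
  "admissible_decomposition Hs T V \<longleftrightarrow>
     selfadjoint_op T \<and> semibounded_op T \<and> core_of (\<Union>n. Hs n) T \<and>
     spectrum T = ess_spectrum5 T \<and> ereal_convex (ext_ess_spectrum T) \<and>
     bounded_op V \<and> relatively_compact T V \<and> relatively_compact T (op_adjoint V)"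

definition Omega2 :: "(nat \<Rightarrow> 'a::complex_hilbert set) \<Rightarrow> 'a unbounded_op set" where
  "Omega2 Hs = {H. \<exists>T V. admissible_decomposition Hs T V \<and> H = op_add T V}"

definition matrix_entry ::
  "(nat \<Rightarrow> nat \<Rightarrow> 'a::complex_hilbert) \<Rightarrow> nat \<Rightarrow> nat \<Rightarrow> nat \<Rightarrow> 'a unbounded_op \<Rightarrow> complex" where
  "matrix_entry e i j n A = cinner (op_app A (e n i)) (e n j)"

definition Lambda2 ::
  "(nat \<Rightarrow> nat) \<Rightarrow> (nat \<Rightarrow> nat \<Rightarrow> 'a::complex_hilbert) \<Rightarrow>
     ('a unbounded_op \<Rightarrow> 'a unbounded_op) \<Rightarrow> ('a unbounded_op \<Rightarrow> 'a unbounded_op) \<Rightarrow>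
     ('a unbounded_op \<Rightarrow> complex) set" where
  "Lambda2 k e s_T s_V =
     {matrix_entry e i j n \<circ> s_T | i j n. i \<in> {1..k n} \<and> j \<in> {1..k n}} \<union>
     {matrix_entry e i j n \<circ> s_V | i j n. i \<in> {1..k n} \<and> j \<in> {1..k n}}"

end

theory Submission
  imports Defs "HOL-Library.Diagonal_Subsequence" "HOL-Complex_Analysis.Complex_Analysis"
    "Jordan_Normal_Form.Char_Poly"
begin

text \<open>
  Because the extended essential spectrum is convex and \<open>\<sigma>(T) = \<sigma>\<^sub>e\<^sub>5(T)\<close>, the essential spectrum
  \<open>\<sigma>\<^sub>e\<^sub>2(T)\<close> is the closed numerical range of \<open>T\<close>, and \<open>\<sigma>(H)\<close> consists of it and of eigenvalues that
  are isolated in its complement. The first part is filled by the Rayleigh quotients of the compressions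
  of \<open>T\<close> at sample vectors. Away from it \<open>T - \<lambda>\<close> is coercive and \<open>V\<close> is compact relative to the form of
  \<open>T\<close>, so the Galerkin method for \<open>H - \<lambda>\<close> is stable unless \<open>\<lambda>\<close> is an eigenvalue: there is no spectral
  pollution, and the maximum principle for the Galerkin resolvents shows that no eigenvalue is missed.
  The Galerkin eigenvalues are located on a fine grid by testing the size of the characteristic
  polynomial. A single limit is necessary because an algorithm returns a finite set, whereas
  the compact operator \<open>0 + diag(2\<^sup>-\<^sup>n)\<close> has infinite spectrum.
\<close>

\<comment> \<open>One limit suffices because neither half of the output needs a second one to become
  reliable. Rayleigh quotients of \<open>T\<close> lie in the closed numerical range exactly, and
  Galerkin eigenvalues that fall near this range are harmless wherever they lie. The quotients are
  available because the entries of \<open>T\<close> and of \<open>V\<close> are read separately.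

  The obstacle is that \<open>T\<close> may be unbounded. \<open>T\<close>-compactness of
  \<open>V\<close> speaks of sequences along which both \<open>x\<close> and \<open>T x\<close> are
  bounded, whereas a Galerkin solution only controls the form \<open>cinner (T x) x\<close>.
  Semiboundedness of \<open>T\<close> bridges this gap, and both the stability of the method and the
  isolation of the eigenvalues depend on it.

  Eigenvalues and moduli are not arithmetic functions of the entries, so only inequalities between
  squared moduli are tested. How fine the grid must be depends on the size of the entries; the mesh
  is therefore found by a search whose length need not be bounded over all inputs. The evaluations
  read at stage \<open>n\<close> are nevertheless the same for all operators, which makes the
  consistency conditions on an algorithm immediate.\<close>
subclass (in complex_hilbert) banach ..

subsection \<open>Complex inner products\<close>

lemma cinner_add_right: "cinner x (y + z) = cinner x y + cinner x (z::'a::complex_hilbert)"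
proof -
  have "cnj (cinner (y + z) x) = cnj (cinner y x) + cnj (cinner z x)" by (simp add: cinner_add_left)
  then show ?thesis by (simp only: cinner_commute[symmetric])
qed

lemma cinner_scaleC_right: "cinner x (a *\<^sub>C y) = cnj a * cinner x (y::'a::complex_hilbert)"
proof -
  have "cnj (cinner (a *\<^sub>C y) x) = cnj a * cnj (cinner y x)" by (simp add: cinner_scaleC_left)
  then show ?thesis by (simp only: cinner_commute[symmetric])
qed

lemma cinner_eq_zero_commute: "cinner x y = 0 \<longleftrightarrow> cinner y (x::'a::complex_hilbert) = 0"
  using cinner_commute[of x y] by simp

lemma cinner_zero_left [simp]: "cinner 0 (y::'a::complex_hilbert) = 0"
  using cinner_add_left[of 0 0 y] by simp

lemma cinner_zero_right [simp]: "cinner (y::'a::complex_hilbert) 0 = 0"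
  using cinner_add_right[of y 0 0] by simp

lemma cinner_minus_left [simp]: "cinner (- x) (y::'a::complex_hilbert) = - cinner x y"
proof -
  have "cinner x y + cinner (- x) y = 0" by (simp flip: cinner_add_left)
  then show ?thesis by (rule minus_unique[symmetric])
qed

lemma cinner_minus_right [simp]: "cinner x (- y::'a::complex_hilbert) = - cinner x y"
proof -
  have "cinner x y + cinner x (- y) = 0" by (simp flip: cinner_add_right)
  then show ?thesis by (rule minus_unique[symmetric])
qed

lemma cinner_diff_left: "cinner (x - y) (z::'a::complex_hilbert) = cinner x z - cinner y z"
  using cinner_add_left[of x "- y" z] by simp

lemma cinner_diff_right: "cinner x (y - z::'a::complex_hilbert) = cinner x y - cinner x z"
  using cinner_add_right[of x y "- z"] by simp

lemma cinner_sum_left: "cinner (\<Sum>i\<in>I. f i) (y::'a::complex_hilbert) = (\<Sum>i\<in>I. cinner (f i) y)"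
  by (induction I rule: infinite_finite_induct) (auto simp: cinner_add_left)

lemma cinner_sum_right: "cinner y (\<Sum>i\<in>I. f i::'a::complex_hilbert) = (\<Sum>i\<in>I. cinner y (f i))"
  by (induction I rule: infinite_finite_induct) (auto simp: cinner_add_right)

lemma cinner_scaleR_left: "cinner (r *\<^sub>R x) (y::'a::complex_hilbert) = complex_of_real r * cinner x y"
  by (simp add: scaleR_scaleC cinner_scaleC_left)

lemma cinner_scaleR_right: "cinner x (r *\<^sub>R y::'a::complex_hilbert) = complex_of_real r * cinner x y"
  by (simp add: scaleR_scaleC cinner_scaleC_right)

lemma cinner_self: "cinner x (x::'a::complex_hilbert) = complex_of_real ((norm x)\<^sup>2)"
proof -
  have "Im (cinner x x) = 0"
    using arg_cong[OF cinner_commute[of x x], of Im] by simp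
  moreover have "Re (cinner x x) = (norm x)\<^sup>2"
    by (simp add: inner_Re_cinner[symmetric] power2_norm_eq_inner)
  ultimately show ?thesis by (simp add: complex_eq_iff)
qed

lemma norm_scaleC [simp]: "norm (c *\<^sub>C x) = cmod c * norm (x::'a::complex_hilbert)"
proof -
  have "complex_of_real ((norm (c *\<^sub>C x))\<^sup>2) = (c * cnj c) * cinner x x"
    unfolding cinner_self[symmetric] cinner_scaleC_left cinner_scaleC_right by (simp only: mult_ac)
  also have "\<dots> = complex_of_real ((cmod c * norm x)\<^sup>2)"
    unfolding cinner_self complex_norm_square[symmetric] power_mult_distrib by (simp only: of_real_mult)
  finally have "(norm (c *\<^sub>C x))\<^sup>2 = (cmod c * norm x)\<^sup>2" by (simp only: of_real_eq_iff)
  then show ?thesis by (rule power2_eq_imp_eq) auto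
qed

text \<open>A unimodular factor \<open>c\<close> makes the inner product real and nonnegative
  without changing norms, so the Cauchy-Schwarz inequality of the real structure applies.\<close>

lemma cinner_bound: "cmod (cinner x y) \<le> norm x * norm (y::'a::complex_hilbert)"
proof (cases "cinner x y = 0")
  case False
  define w where "w = cinner x y"
  define c where "c = cnj w / complex_of_real (cmod w)"
  have w0: "cmod w \<noteq> 0" using False by (simp add: w_def)
  have "cinner (c *\<^sub>C x) y = (w * cnj w) / complex_of_real (cmod w)"
    unfolding cinner_scaleC_left c_def w_def[symmetric] by simp
  also have "\<dots> = complex_of_real (cmod w)"
    using w0 unfolding complex_norm_square[symmetric] by (simp add: power2_eq_square)
  finally have "cmod w = inner (c *\<^sub>C x) y" by (simp add: inner_Re_cinner)
  also have "\<dots> \<le> norm (c *\<^sub>C x) * norm y" by (rule norm_cauchy_schwarz)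
  also have "norm (c *\<^sub>C x) = norm x" using w0 by (simp add: c_def norm_divide)
  finally show ?thesis by (simp add: w_def)
qed simp

lemma bounded_bilinear_cinner: "bounded_bilinear (cinner :: 'a::complex_hilbert \<Rightarrow> _)"
proof
  show "\<exists>K. \<forall>x y. norm (cinner x (y::'a)) \<le> norm x * norm y * K"
    by (intro exI[of _ 1]) (simp add: cinner_bound)
qed (simp_all add: cinner_add_left cinner_add_right cinner_scaleR_left cinner_scaleR_right scaleR_conv_of_real)

lemma bounded_bilinear_scaleC: "bounded_bilinear (scaleC :: complex \<Rightarrow> 'a::complex_hilbert \<Rightarrow> 'a)"
proof
  show "\<exists>K. \<forall>a x. norm (a *\<^sub>C (x::'a)) \<le> norm a * norm x * K" by (intro exI[of _ 1]) simp
qed (simp_all add: scaleC_add_left scaleC_add_right scaleR_scaleC scaleC_scaleC scaleR_conv_of_real mult.commute)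

lemmas tendsto_cinner [tendsto_intros] = bounded_bilinear.tendsto[OF bounded_bilinear_cinner]
lemmas tendsto_scaleC [tendsto_intros] = bounded_bilinear.tendsto[OF bounded_bilinear_scaleC]

lemma scaleC_diff_right: "a *\<^sub>C (x - y) = a *\<^sub>C x - a *\<^sub>C (y::'a::complex_hilbert)"
  by (rule complex_vector.scale_right_diff_distrib)

lemma scaleC_diff_left: "(a - b) *\<^sub>C x = a *\<^sub>C x - b *\<^sub>C (x::'a::complex_hilbert)"
  by (rule complex_vector.scale_left_diff_distrib)

lemma norm_add_orthogonal:
  assumes "cinner x y = 0"
  shows "(norm (x + y))\<^sup>2 = (norm x)\<^sup>2 + (norm (y::'a::complex_hilbert))\<^sup>2"
proof -
  have "cinner y x = 0" using assms by (simp add: cinner_eq_zero_commute)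
  then have "complex_of_real ((norm (x + y))\<^sup>2) = complex_of_real ((norm x)\<^sup>2 + (norm y)\<^sup>2)"
    unfolding cinner_self[symmetric] cinner_add_left cinner_add_right
    by (simp add: assms cinner_self)
  then show ?thesis using of_real_eq_iff by blast
qed

lemma eq_zero_if_orthogonal_dense:
  fixes h :: "'a::complex_hilbert"
  assumes "closure D = UNIV" "\<And>y. y \<in> D \<Longrightarrow> cinner h y = 0"
  shows "h = 0"
proof -
  have "h \<in> closure D" using assms by simp
  then obtain u where u: "\<And>n. u n \<in> D" "u \<longlonglongrightarrow> h"
    unfolding closure_sequential by auto
  have "(\<lambda>n. cinner h (u n)) \<longlonglongrightarrow> cinner h h" by (intro tendsto_intros u)
  moreover have "(\<lambda>n. cinner h (u n)) = (\<lambda>n. 0)" using assms(2) u(1) by auto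
  ultimately have "cinner h h = 0" by (simp add: LIMSEQ_const_iff)
  then show ?thesis by (simp add: cinner_self)
qed

subsection \<open>Orthonormal families\<close>

text \<open>The index set is arbitrary, since both finite bases of the Galerkin spaces and infinite
  sequences occur.\<close>

definition orthonormal_on :: "('i \<Rightarrow> 'a::complex_hilbert) \<Rightarrow> 'i set \<Rightarrow> bool" where
  "orthonormal_on f I \<longleftrightarrow> (\<forall>i\<in>I. \<forall>j\<in>I. cinner (f i) (f j) = (if i = j then 1 else 0))"

text \<open>For a finite orthonormal family this is the orthogonal projection onto its span, given
  by a formula instead of the description in \<open>orth_proj\<close>;
  \<open>orth_proj_eq_oproj\<close> links the two.\<close>

definition oproj :: "('i \<Rightarrow> 'a::complex_hilbert) \<Rightarrow> 'i set \<Rightarrow> 'a \<Rightarrow> 'a" where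
  "oproj f I x = (\<Sum>i\<in>I. cinner x (f i) *\<^sub>C f i)"

lemma orthonormal_on_subset: "orthonormal_on f I \<Longrightarrow> J \<subseteq> I \<Longrightarrow> orthonormal_on f J"
  unfolding orthonormal_on_def by blast

lemma orthonormal_on_norm: "orthonormal_on f I \<Longrightarrow> i \<in> I \<Longrightarrow> norm (f i) = 1"
proof -
  assume "orthonormal_on f I" "i \<in> I"
  then have "complex_of_real ((norm (f i))\<^sup>2) = of_real 1"
    unfolding cinner_self[symmetric] orthonormal_on_def by auto
  then have "(norm (f i))\<^sup>2 = 1" using of_real_eq_iff by blast
  then show ?thesis using power2_eq_iff_nonneg[of "norm (f i)" 1] by simp
qed

context
  fixes f :: "'i \<Rightarrow> 'a::complex_hilbert" and I :: "'i set"
  assumes fin: "finite I" and on: "orthonormal_on f I"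
begin

lemma cinner_orthonormal_sum: "j \<in> I \<Longrightarrow> cinner (\<Sum>i\<in>I. c i *\<^sub>C f i) (f j) = c j"
proof -
  assume j: "j \<in> I"
  have "cinner (\<Sum>i\<in>I. c i *\<^sub>C f i) (f j) = (\<Sum>i\<in>I. if i = j then c i else 0)"
    unfolding cinner_sum_left cinner_scaleC_left using on j
    by (intro sum.cong) (auto simp: orthonormal_on_def)
  then show ?thesis using j fin by simp
qed

lemma norm_orthonormal_sum: "(norm (\<Sum>i\<in>I. c i *\<^sub>C f i))\<^sup>2 = (\<Sum>i\<in>I. (cmod (c i))\<^sup>2)"
proof -
  have "complex_of_real ((norm (\<Sum>i\<in>I. c i *\<^sub>C f i))\<^sup>2) = complex_of_real (\<Sum>i\<in>I. (cmod (c i))\<^sup>2)"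
    unfolding cinner_self[symmetric]
    by (subst cinner_sum_right)
       (auto simp: cinner_scaleC_right cinner_orthonormal_sum complex_norm_square mult.commute
         simp del: of_real_power intro!: sum.cong)
  then show ?thesis using of_real_eq_iff by blast
qed

lemma oproj_in_span: "oproj f I x \<in> complex_vector.span (f ` I)"
  unfolding oproj_def
  by (intro complex_vector.span_sum complex_vector.span_scale complex_vector.span_base) auto

lemma cinner_oproj: "j \<in> I \<Longrightarrow> cinner (oproj f I x) (f j) = cinner x (f j)"
  unfolding oproj_def by (rule cinner_orthonormal_sum)

lemma cinner_diff_oproj:
  assumes "y \<in> complex_vector.span (f ` I)"
  shows "cinner (x - oproj f I x) y = 0"
  using assms
proof (induction rule: complex_vector.span_induct_alt)
  case (step c u y)
  then show ?case by (auto simp: cinner_add_right cinner_scaleC_right cinner_diff_left cinner_oproj)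
qed simp

lemma oproj_span:
  assumes "y \<in> complex_vector.span (f ` I)"
  shows "oproj f I y = y"
proof -
  have "y - oproj f I y \<in> complex_vector.span (f ` I)"
    using assms oproj_in_span by (rule complex_vector.span_diff)
  then have "cinner (y - oproj f I y) (y - oproj f I y) = 0" by (rule cinner_diff_oproj)
  then show ?thesis by (simp add: cinner_self)
qed

lemma norm_oproj_pythagoras: "(norm x)\<^sup>2 = (norm (x - oproj f I x))\<^sup>2 + (norm (oproj f I x))\<^sup>2"
  using norm_add_orthogonal[OF cinner_diff_oproj[OF oproj_in_span], of x x] by simp

lemma norm_oproj_le: "norm (oproj f I x) \<le> norm x"
  by (rule power2_le_imp_le) (simp_all add: norm_oproj_pythagoras[of x])

lemma bessel: "(\<Sum>i\<in>I. (cmod (cinner x (f i)))\<^sup>2) \<le> (norm x)\<^sup>2"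
proof -
  have "(\<Sum>i\<in>I. (cmod (cinner x (f i)))\<^sup>2) = (norm (oproj f I x))\<^sup>2"
    unfolding oproj_def by (rule norm_orthonormal_sum[symmetric])
  then show ?thesis using norm_oproj_pythagoras[of x] by simp
qed

text \<open>The vector \<open>r\<close> is the normalized residual of projecting \<open>x\<close>.
  The two span memberships together say that exchanging \<open>x\<close> for \<open>r\<close> does
  not change the span.\<close>

lemma gram_schmidt_step:
  assumes "x \<notin> complex_vector.span (f ` I)"
  obtains r where "norm r = 1" "\<And>y. y \<in> complex_vector.span (f ` I) \<Longrightarrow> cinner r y = 0"
    "r \<in> complex_vector.span (insert x (f ` I))" "x \<in> complex_vector.span (insert r (f ` I))"
proof
  define u where "u = x - oproj f I x"
  have "u \<noteq> 0" using assms oproj_in_span[of x] by (auto simp: u_def)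
  define r where "r = complex_of_real (1 / norm u) *\<^sub>C u"
  show "norm r = 1" using \<open>u \<noteq> 0\<close> by (simp add: r_def norm_divide)
  show "cinner r y = 0" if "y \<in> complex_vector.span (f ` I)" for y
    using cinner_diff_oproj[OF that, of x] by (simp add: r_def cinner_scaleC_left u_def)
  have P: "oproj f I x \<in> complex_vector.span (insert z (f ` I))" for z
    using oproj_in_span[of x] complex_vector.span_mono[of "f ` I" "insert z (f ` I)"] by blast
  show "r \<in> complex_vector.span (insert x (f ` I))"
    unfolding r_def u_def
    by (intro complex_vector.span_scale complex_vector.span_diff P complex_vector.span_base) simp
  have "x = complex_of_real (norm u) *\<^sub>C r + oproj f I x"
    using \<open>u \<noteq> 0\<close> by (simp add: r_def scaleC_scaleC scaleC_one) (simp add: u_def)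
  moreover have "complex_of_real (norm u) *\<^sub>C r + oproj f I x \<in> complex_vector.span (insert r (f ` I))"
    by (intro complex_vector.span_scale complex_vector.span_add P complex_vector.span_base) simp
  ultimately show "x \<in> complex_vector.span (insert r (f ` I))" by simp
qed

end

lemma oproj_scaleC: "oproj f I (c *\<^sub>C x) = c *\<^sub>C oproj f I x"
  by (simp add: oproj_def cinner_scaleC_left scaleC_scaleC complex_vector.scale_sum_right)

text \<open>By Bessel's inequality the squared coefficients of any \<open>y\<close> are summable,
  hence tend to zero. This is how weakly null sequences are produced below.\<close>

lemma orthonormal_weakly_null:
  fixes f :: "nat \<Rightarrow> 'a::complex_hilbert"
  assumes "orthonormal_on f UNIV"
  shows "weakly_null f"
  unfolding weakly_null_def
proof
  fix y
  have "summable (\<lambda>i. (cmod (cinner y (f i)))\<^sup>2)"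
  proof (rule summableI_nonneg_bounded)
    show "(\<Sum>i<n. (cmod (cinner y (f i)))\<^sup>2) \<le> (norm y)\<^sup>2" for n
      by (rule bessel) (use assms orthonormal_on_subset in auto)
  qed simp
  then have "(\<lambda>i. (cmod (cinner y (f i)))\<^sup>2) \<longlonglongrightarrow> 0" by (rule summable_LIMSEQ_zero)
  then have "(\<lambda>i. sqrt ((cmod (cinner y (f i)))\<^sup>2)) \<longlonglongrightarrow> sqrt 0" by (intro tendsto_intros)
  moreover have "sqrt ((cmod (cinner y (f i)))\<^sup>2) = norm (cinner (f i) y)" for i
    using arg_cong[OF cinner_commute[of y "f i"], of cmod] by (simp only: real_sqrt_abs abs_norm_cancel complex_mod_cnj)
  ultimately show "(\<lambda>i. cinner (f i) y) \<longlonglongrightarrow> 0" by (simp only: real_sqrt_zero tendsto_norm_zero_iff)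
qed

lemma orthonormal_on_insert:
  fixes f :: "nat \<Rightarrow> 'a::complex_hilbert"
  assumes "orthonormal_on f {..<n}" "norm r = 1" "\<And>j. j < n \<Longrightarrow> cinner r (f j) = 0"
  shows "orthonormal_on (f(n := r)) {..<Suc n}"
proof -
  have "cinner (f j) r = 0" if "j < n" for j
    using assms(3)[OF that] by (simp add: cinner_eq_zero_commute)
  then show ?thesis
    using assms orthonormal_on_norm[OF assms(1)]
    by (auto simp: orthonormal_on_def less_Suc_eq cinner_self)
qed

text \<open>The next vector has to be orthogonal to all earlier ones, so the choice needs the whole
  history; hence the recursion along \<open>less_than\<close> instead of a successor step.\<close>

lemma orthonormal_sequence_choice:
  fixes Q :: "nat \<Rightarrow> 'a::complex_hilbert \<Rightarrow> bool"
  assumes "\<And>f n. orthonormal_on f {..<n} \<Longrightarrow> (\<And>j. j < n \<Longrightarrow> Q j (f j)) \<Longrightarrow>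
    \<exists>r. Q n r \<and> norm r = 1 \<and> (\<forall>j<n. cinner r (f j) = 0)"
  obtains f where "orthonormal_on f UNIV" "\<And>n. Q n (f n)"
proof -
  let ?P = "\<lambda>f n r. Q n r \<and> norm r = 1 \<and> (\<forall>j<n. cinner r (f j) = 0)"
  have on: "orthonormal_on f {..<n}" if "\<And>m. m < n \<Longrightarrow> ?P f m (f m)" for f n
    using that
  proof (induction n)
    case (Suc n)
    have "orthonormal_on (f(n := f n)) {..<Suc n}"
      by (rule orthonormal_on_insert) (use Suc in auto)
    then show ?case by simp
  qed (simp add: orthonormal_on_def)
  have "\<exists>f. \<forall>n. ?P f n (f n)"
  proof (rule dependent_wf_choice[OF wf_less_than])
    fix n f assume h: "\<And>y. (y, n) \<in> less_than \<Longrightarrow> ?P f y (f y)"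
    show "\<exists>r. ?P f n r"
      by (rule assms) (use h on in auto)
  qed auto
  then obtain f where f: "\<And>n. ?P f n (f n)" by blast
  have "orthonormal_on f UNIV"
    unfolding orthonormal_on_def
  proof (intro ballI)
    fix i j
    have "orthonormal_on f {..<Suc (max i j)}" using on f by blast
    then show "cinner (f i) (f j) = (if i = j then 1 else 0)"
      unfolding orthonormal_on_def by auto
  qed
  then show ?thesis using that f by blast
qed

text \<open>Gram-Schmidt inside \<open>S\<close> can be continued as long as the vectors found do
  not span all of \<open>S\<close>. The dichotomy serves for the kernel of a shift of
  \<open>T\<close>, where the infinite case is excluded, and for the whole space, where the finite
  case is.\<close>

lemma subspace_orthonormal_dichotomy:
  fixes S :: "'a::complex_hilbert set"
  assumes "complex_vector.subspace S"
  obtains (finite) f and n :: nat where "orthonormal_on f {..<n}" "complex_vector.span (f ` {..<n}) = S"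
  | (infinite) f :: "nat \<Rightarrow> 'a" where "orthonormal_on f UNIV" "range f \<subseteq> S"
proof (cases "\<exists>f n. orthonormal_on f {..<n::nat} \<and> complex_vector.span (f ` {..<n}) = S")
  case True then show ?thesis using finite by blast
next
  case False
  obtain f where "orthonormal_on f UNIV" "\<And>n::nat. f n \<in> S"
  proof (rule orthonormal_sequence_choice[where Q = "\<lambda>n r. r \<in> S"])
    fix f and n :: nat assume on: "orthonormal_on f {..<n}" and S: "\<And>j. j < n \<Longrightarrow> f j \<in> S"
    have sub: "complex_vector.span (f ` {..<n}) \<subseteq> S"
      by (rule complex_vector.span_minimal) (use S assms in auto)
    then obtain x where x: "x \<in> S" "x \<notin> complex_vector.span (f ` {..<n})"
      using False on by blast
    obtain r where r: "norm r = 1" "\<And>y. y \<in> complex_vector.span (f ` {..<n}) \<Longrightarrow> cinner r y = 0"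
      "r \<in> complex_vector.span (insert x (f ` {..<n}))"
      using gram_schmidt_step[OF _ on x(2)] by auto
    have "complex_vector.span (insert x (f ` {..<n})) \<subseteq> S"
    proof (rule complex_vector.span_minimal)
      show "insert x (f ` {..<n}) \<subseteq> S" using S x(1) by auto
    qed (rule assms)
    then have "r \<in> S" using r(3) by (rule subsetD)
    moreover have "cinner r (f j) = 0" if "j < n" for j
      using that by (intro r(2) complex_vector.span_base) simp
    ultimately show "\<exists>r. r \<in> S \<and> norm r = 1 \<and> (\<forall>j<n. cinner r (f j) = 0)"
      using r(1) by (intro exI[of _ r]) simp
  qed auto
  then show ?thesis using infinite by blast
qed

lemma finite_span_orthonormal_basis:
  fixes B :: "'a::complex_hilbert set"
  assumes "finite B"
  obtains f and n :: nat where "orthonormal_on f {..<n}" "complex_vector.span (f ` {..<n}) = complex_vector.span B"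
  using assms
proof (induction B arbitrary: thesis rule: finite_induct)
  case empty
  show ?case by (rule empty[of _ 0]) (auto simp: orthonormal_on_def)
next
  case (insert x B)
  obtain f and n :: nat where on: "orthonormal_on f {..<n}"
    and sp: "complex_vector.span (f ` {..<n}) = complex_vector.span B"
    using insert.IH by blast
  have sub: "complex_vector.span B \<subseteq> complex_vector.span (insert y B)" for y
    by (rule complex_vector.span_mono) auto
  show ?case
  proof (cases "x \<in> complex_vector.span B")
    case True
    then have "complex_vector.span (insert x B) = complex_vector.span B"
      by (rule complex_vector.span_redundant)
    then show ?thesis using insert.prems[of f n] on sp by simp
  next
    case False
    then obtain r where r: "norm r = 1" "\<And>y. y \<in> complex_vector.span (f ` {..<n}) \<Longrightarrow> cinner r y = 0"
      "r \<in> complex_vector.span (insert x (f ` {..<n}))" "x \<in> complex_vector.span (insert r (f ` {..<n}))"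
      using gram_schmidt_step[OF _ on, of x] sp by auto
    have eq: "complex_vector.span (insert z (f ` {..<n})) = complex_vector.span (insert z B)" for z
      using sp by (simp add: complex_vector.span_insert)
    have im: "(f(n := r)) ` {..<Suc n} = insert r (f ` {..<n})"
      by (auto simp: less_Suc_eq image_iff)
    show ?thesis
    proof (rule insert.prems)
      show "orthonormal_on (f(n := r)) {..<Suc n}"
        using r(2) by (intro orthonormal_on_insert on r(1)) (auto intro: complex_vector.span_base)
      have "complex_vector.span (insert u B) \<subseteq> complex_vector.span (insert w B)"
        if "u \<in> complex_vector.span (insert w B)" for u w
        using that complex_vector.span_superset[of "insert w B"]
        by (intro complex_vector.span_minimal complex_vector.subspace_span) auto
      then have "complex_vector.span (insert r B) = complex_vector.span (insert x B)"
        using r(3,4) unfolding eq by blast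
      then show "complex_vector.span ((f(n := r)) ` {..<Suc n}) = complex_vector.span (insert x B)"
        unfolding im eq .
    qed
  qed
qed

subsection \<open>Compactness arguments and orthogonal complements\<close>

text \<open>Bolzano-Weierstrass, applied to one coordinate after the other.\<close>

lemma bounded_coordinates_convergent_subseq:
  fixes c :: "nat \<Rightarrow> 'i \<Rightarrow> complex"
  assumes "finite I" "\<And>k i. i \<in> I \<Longrightarrow> cmod (c k i) \<le> B"
  obtains r :: "nat \<Rightarrow> nat" where "strict_mono r" "\<And>i. i \<in> I \<Longrightarrow> convergent (\<lambda>k. c (r k) i)"
  using assms
proof (induction I arbitrary: thesis rule: finite_induct)
  case empty
  show ?case by (rule empty.prems(1)[of id]) (auto simp: strict_mono_def)
next
  case (insert x I)
  obtain r where r: "strict_mono r" "\<And>i. i \<in> I \<Longrightarrow> convergent (\<lambda>k. c (r k) i)"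
    using insert.IH insert.prems by blast
  have "bounded (range (\<lambda>k. c (r k) x))"
    using insert.prems(2)[of x] by (intro boundedI[of _ B]) auto
  then obtain l s where s: "strict_mono s" "((\<lambda>k. c (r k) x) \<circ> s) \<longlonglongrightarrow> l"
    using bounded_imp_convergent_subsequence by blast
  show ?case
  proof (rule insert.prems)
    show "strict_mono (r \<circ> s)" using r s by (simp add: strict_mono_o)
    show "convergent (\<lambda>k. c ((r \<circ> s) k) i)" if "i \<in> insert x I" for i
      using that
    proof
      assume "i = x" then show ?thesis using s by (auto simp: convergent_def o_def)
    next
      assume "i \<in> I"
      then show ?thesis using convergent_subseq_convergent[OF r(2) s(1)] by (auto simp: o_def)
    qed
  qed
qed

text \<open>Convergent subsequences are demanded of all subsequences, because the diagonal
  extraction below passes to a further subsequence at every stage.\<close>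

definition subseq_compact :: "(nat \<Rightarrow> 'a::topological_space) \<Rightarrow> bool" where
  "subseq_compact w \<longleftrightarrow> (\<forall>s::nat \<Rightarrow> nat. strict_mono s \<longrightarrow>
     (\<exists>r::nat \<Rightarrow> nat. strict_mono r \<and> convergent (\<lambda>k. w (s (r k)))))"

text \<open>A uniform limit of relatively compact sequences is relatively compact: at stage
  \<open>n\<close> an approximant close to \<open>v\<close> brings the oscillation of a subsequence
  below \<open>1 / (n + 1)\<close>, so the diagonal sequence is Cauchy. The approximants will be
  resolvent smoothings in \<open>form_compact\<close> and finite sums in
  \<open>diag_compact\<close>.\<close>

lemma convergent_subseq_if_approximable:
  fixes v :: "nat \<Rightarrow> 'a::complete_space"
  assumes "\<And>\<epsilon>. \<epsilon> > 0 \<Longrightarrow> \<exists>w. (\<forall>k. dist (v k) (w k) \<le> \<epsilon>) \<and> subseq_compact w"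
  obtains r :: "nat \<Rightarrow> nat" where "strict_mono r" "convergent (\<lambda>k. v (r k))"
proof -
  let ?P = "\<lambda>n s. \<exists>N. \<forall>i\<ge>N. \<forall>j\<ge>N. dist (v (s i)) (v (s j)) < 1 / real (Suc n)"
  interpret subseqs ?P
  proof
    fix n and s :: "nat \<Rightarrow> nat" assume s: "strict_mono s"
    \<comment> \<open>Three errors of size at most \<open>\<epsilon>\<close> are added below: two
      approximations of \<open>v\<close> and one oscillation of \<open>w\<close>.\<close>
    define \<epsilon> where "\<epsilon> = 1 / (4 * real (Suc n))"
    have pos: "\<epsilon> > 0" by (simp add: \<epsilon>_def)
    from assms[OF pos] obtain w where w': "(\<forall>k. dist (v k) (w k) \<le> \<epsilon>) \<and> subseq_compact w" ..
    from w' have w: "dist (v k) (w k) \<le> \<epsilon>" for k by simp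
    have "subseq_compact w" by (rule conjunct2[OF w'])
    note sc = this[unfolded subseq_compact_def]
    from mp[OF spec[OF sc, of s] s]
    obtain r :: "nat \<Rightarrow> nat" where r': "strict_mono r \<and> convergent (\<lambda>k. w (s (r k)))" ..
    then have r: "strict_mono r" "convergent (\<lambda>k. w (s (r k)))" by simp_all
    have "Cauchy (\<lambda>k. w (s (r k)))" using r(2) by (simp add: Cauchy_convergent_iff)
    then obtain N where N: "\<And>i j. i \<ge> N \<Longrightarrow> j \<ge> N \<Longrightarrow> dist (w (s (r i))) (w (s (r j))) < \<epsilon>"
      using pos unfolding Cauchy_def by meson
    have "dist (v (s (r i))) (v (s (r j))) < 1 / real (Suc n)" if "i \<ge> N" "j \<ge> N" for i j
    proof -
      have "dist (v (s (r i))) (v (s (r j))) \<le> dist (v (s (r i))) (w (s (r i)))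
          + dist (w (s (r i))) (w (s (r j))) + dist (v (s (r j))) (w (s (r j)))"
        using dist_triangle[of "v (s (r i))" "v (s (r j))" "w (s (r i))"]
          dist_triangle[of "w (s (r i))" "v (s (r j))" "w (s (r j))"]
        by (simp add: dist_commute)
      also have "\<dots> < 4 * \<epsilon>" using w[of "s (r i)"] w[of "s (r j)"] N[OF that] pos by linarith
      also have "4 * \<epsilon> = 1 / real (Suc n)" by (simp add: \<epsilon>_def field_simps)
      finally show ?thesis .
    qed
    then have P: "?P n (s \<circ> r)" unfolding o_def by blast
    show "\<exists>r'::nat \<Rightarrow> nat. strict_mono r' \<and> ?P n (s \<circ> r')"
      by (rule exI[of _ r], rule conjI[OF r(1) P])
  qed
  have "?P n (diagseq \<circ> ((+) (Suc n)))" for n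
  proof (rule diagseq_holds)
    fix r s :: "nat \<Rightarrow> nat" and n assume "strict_mono r" "?P n s"
    then obtain N where N: "\<And>i j. i \<ge> N \<Longrightarrow> j \<ge> N \<Longrightarrow> dist (v (s i)) (v (s j)) < 1 / real (Suc n)"
      by blast
    have "r i \<ge> N" if "i \<ge> N" for i
      using seq_suble[OF \<open>strict_mono r\<close>, of i] that by simp
    then show "?P n (s \<circ> r)" using N by (intro exI[of _ N]) auto
  qed
  then have "Cauchy (\<lambda>k. v (diagseq k))"
    unfolding Cauchy_def
  proof (intro allI impI)
    fix \<epsilon> :: real assume "\<epsilon> > 0" and P: "\<And>n. ?P n (diagseq \<circ> ((+) (Suc n)))"
    then obtain n where n: "1 / real (Suc n) < \<epsilon>" using nat_approx_posE by blast
    obtain N where N: "\<And>i j. i \<ge> N \<Longrightarrow> j \<ge> N \<Longrightarrow>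
        dist (v (diagseq (Suc n + i))) (v (diagseq (Suc n + j))) < 1 / real (Suc n)"
      using P[of n] by auto
    have "dist (v (diagseq i)) (v (diagseq j)) < \<epsilon>" if "i \<ge> Suc n + N" "j \<ge> Suc n + N" for i j
    proof -
      have "dist (v (diagseq (Suc n + (i - Suc n)))) (v (diagseq (Suc n + (j - Suc n)))) < 1 / real (Suc n)"
        by (rule N) (use that in auto)
      then show ?thesis using that n by simp
    qed
    then show "\<exists>M. \<forall>i\<ge>M. \<forall>j\<ge>M. dist (v (diagseq i)) (v (diagseq j)) < \<epsilon>" by blast
  qed
  then show ?thesis using that[OF subseq_diagseq] by (simp add: Cauchy_convergent_iff)
qed

text \<open>The vector is \<open>x - p\<close> with \<open>p\<close> the point of \<open>M\<close>
  nearest to some \<open>x\<close> outside \<open>M\<close>. Completeness replaces compactness: the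
  parallelogram law makes a minimizing sequence Cauchy.\<close>

lemma exists_orthogonal_to_closed_subspace:
  fixes M :: "'a::complex_hilbert set"
  assumes "closed M" "complex_vector.subspace M" "M \<noteq> UNIV"
  obtains y where "y \<noteq> 0" "\<And>m. m \<in> M \<Longrightarrow> cinner m y = 0"
proof -
  obtain x where x: "x \<notin> M" using assms by blast
  have "0 \<in> M" using assms(2) by (rule complex_vector.subspace_0)
  then have ne: "M \<noteq> {}" by blast
  define d where "d = infdist x M"
  have d0: "d \<ge> 0" by (simp add: d_def infdist_nonneg)
  have dle: "d \<le> norm (x - m)" if "m \<in> M" for m
    using infdist_le[OF that, of x] by (simp add: d_def dist_norm)
  have "\<exists>m\<in>M. norm (x - m) < d + 1 / real (Suc n)" for n
  proof -
    have "(INF m\<in>M. dist x m) < d + 1 / real (Suc n)" using ne by (simp add: d_def infdist_def)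
    then show ?thesis using ne by (subst (asm) cINF_less_iff) (auto simp: dist_norm intro!: bdd_belowI[of _ 0])
  qed
  then obtain m where m: "\<And>n. m n \<in> M" "\<And>n. norm (x - m n) < d + 1 / real (Suc n)" by metis
  have half: "(1/2) *\<^sub>R (a + b) \<in> M" if "a \<in> M" "b \<in> M" for a b
    unfolding scaleR_scaleC using that assms(2)
    by (intro complex_vector.subspace_scale complex_vector.subspace_add)
  have par: "(norm (m i - m j))\<^sup>2 \<le> 2 * (norm (x - m i))\<^sup>2 + 2 * (norm (x - m j))\<^sup>2 - 4 * d\<^sup>2" for i j
  proof -
    have "(norm ((x - m i) - (x - m j)))\<^sup>2 + (norm ((x - m i) + (x - m j)))\<^sup>2
        = 2 * (norm (x - m i))\<^sup>2 + 2 * (norm (x - m j))\<^sup>2"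
      by (simp add: power2_norm_eq_inner inner_diff_left inner_diff_right inner_add_left inner_add_right inner_commute)
    moreover have "(x - m i) + (x - m j) = 2 *\<^sub>R (x - (1/2) *\<^sub>R (m i + m j))"
      by (simp add: algebra_simps scaleR_2)
    then have "norm ((x - m i) + (x - m j)) = 2 * norm (x - (1/2) *\<^sub>R (m i + m j))"
      by simp
    moreover have "d\<^sup>2 \<le> (norm (x - (1/2) *\<^sub>R (m i + m j)))\<^sup>2"
      by (intro power_mono dle half m d0)
    ultimately show ?thesis by (simp add: power_mult_distrib norm_minus_commute)
  qed
  have lim: "(\<lambda>n. norm (x - m n)) \<longlonglongrightarrow> d"
  proof (rule tendsto_sandwich[of "\<lambda>_. d" _ _ "\<lambda>n. d + 1 / real (Suc n)"])
    show "(\<lambda>n. d + 1 / real (Suc n)) \<longlonglongrightarrow> d"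
      using tendsto_add[OF tendsto_const[of d] LIMSEQ_inverse_real_of_nat] by (simp add: inverse_eq_divide)
    show "\<forall>\<^sub>F n in sequentially. norm (x - m n) \<le> d + 1 / real (Suc n)"
      using less_imp_le[OF m(2)] by (intro always_eventually allI)
    show "\<forall>\<^sub>F n in sequentially. d \<le> norm (x - m n)" using m(1) dle by simp
  qed simp
  have "Cauchy m"
  proof (rule metric_CauchyI)
    fix \<epsilon> :: real assume "\<epsilon> > 0"
    have "(\<lambda>n. (norm (x - m n))\<^sup>2) \<longlonglongrightarrow> d\<^sup>2" by (intro tendsto_intros lim)
    then have "eventually (\<lambda>n. (norm (x - m n))\<^sup>2 < d\<^sup>2 + \<epsilon>\<^sup>2 / 4) sequentially"
      by (rule order_tendstoD) (use \<open>\<epsilon> > 0\<close> in auto)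
    then obtain N where N: "\<And>n. n \<ge> N \<Longrightarrow> (norm (x - m n))\<^sup>2 < d\<^sup>2 + \<epsilon>\<^sup>2 / 4"
      by (auto simp: eventually_sequentially)
    have "dist (m i) (m j) < \<epsilon>" if "i \<ge> N" "j \<ge> N" for i j
    proof -
      have "(norm (m i - m j))\<^sup>2 < \<epsilon>\<^sup>2"
        using par[of i j] N[OF that(1)] N[OF that(2)] by linarith
      then show ?thesis using \<open>\<epsilon> > 0\<close> by (simp add: dist_norm power_less_imp_less_base)
    qed
    then show "\<exists>M. \<forall>i\<ge>M. \<forall>j\<ge>M. dist (m i) (m j) < \<epsilon>" by blast
  qed
  then obtain p where p: "m \<longlonglongrightarrow> p" by (auto simp: Cauchy_convergent_iff convergent_def)
  have pM: "p \<in> M" using closed_sequentially[OF assms(1)] m(1) p by blast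
  have "(\<lambda>n. norm (x - m n)) \<longlonglongrightarrow> norm (x - p)" by (intro tendsto_intros p)
  then have nd: "norm (x - p) = d" using lim LIMSEQ_unique by blast
  have "cinner u (x - p) = 0" if u: "u \<in> M" for u
  proof (cases "u = 0")
    case False
    \<comment> \<open>\<open>c *\<^sub>C u\<close> is the component of \<open>x - p\<close> along
      \<open>u\<close>; were it nonzero, \<open>p + c *\<^sub>C u\<close> would be nearer to
      \<open>x\<close> than the infimum \<open>d\<close> allows.\<close>
    define c where "c = cinner (x - p) u / complex_of_real ((norm u)\<^sup>2)"
    have "cinner ((x - p) - c *\<^sub>C u) u = 0"
      using False by (simp add: cinner_diff_left[of "x - p"] cinner_scaleC_left cinner_self c_def)
    then have "cinner ((x - p) - c *\<^sub>C u) (c *\<^sub>C u) = 0" by (simp add: cinner_scaleC_right)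
    from norm_add_orthogonal[OF this]
    have "(norm (x - p))\<^sup>2 = (norm (x - p - c *\<^sub>C u))\<^sup>2 + (norm (c *\<^sub>C u))\<^sup>2" by simp
    moreover have "d \<le> norm (x - (p + c *\<^sub>C u))"
      by (intro dle complex_vector.subspace_add complex_vector.subspace_scale assms(2) pM u)
    then have "d\<^sup>2 \<le> (norm (x - p - c *\<^sub>C u))\<^sup>2" using d0 by (simp add: diff_diff_eq power_mono)
    ultimately have "(norm (c *\<^sub>C u))\<^sup>2 \<le> 0" using nd by simp
    then have "c = 0" using False by simp
    then have "cinner (x - p) u = 0" using False by (simp add: c_def)
    then show ?thesis by (simp add: cinner_eq_zero_commute)
  qed simp
  moreover have "x - p \<noteq> 0" using x pM by auto
  ultimately show ?thesis using that by blast
qed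

subsection \<open>Arithmetic computations\<close>

lemma expr_value_cong:
  "(\<And>f. f \<in> inputs E \<Longrightarrow> v f = v' f) \<Longrightarrow> expr_value v E = expr_value v' E"
  by (induction E) auto

lemma computes_cong:
  assumes "computes v p F zs" "\<And>f. f \<in> F \<Longrightarrow> v f = v' f"
  shows "computes v' p F zs"
  using assms
proof (induction rule: computes.induct)
  case (1 es)
  have eq: "map (expr_value v) es = map (expr_value v') es"
    using 1 by (auto intro!: expr_value_cong)
  show ?case unfolding eq by (rule computes.intros(1))
next
  case (2 a p F zs q)
  have "expr_value v a = expr_value v' a" using 2 by (intro expr_value_cong) auto
  then show ?case using 2 by (intro computes.intros(2)) auto
next
  case (3 a q F zs p)
  have "expr_value v a = expr_value v' a" using 3 by (intro expr_value_cong) auto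
  then show ?case using 3 by (intro computes.intros(3)) auto
qed

lemma computes_deterministic:
  assumes "computes v p F zs" "computes v p F' zs'"
  shows "zs = zs'"
  using assms
proof (induction arbitrary: F' rule: computes.induct)
  case (1 es)
  from 1 show ?case by cases simp
next
  case (2 a p F zs q)
  from 2(4) show ?case by cases (use 2 in auto)
next
  case (3 a q F zs p)
  from 3(4) show ?case by cases (use 3 in auto)
qed

text \<open>One expression must produce \<open>g v\<close> for all data \<open>v\<close>. The
  closure rules below make it possible to show this for a formula without writing down its syntax
  tree.\<close>

definition expressible :: "'f set \<Rightarrow> (('f \<Rightarrow> complex) \<Rightarrow> complex) \<Rightarrow> bool" where
  "expressible A g \<longleftrightarrow> (\<exists>E. inputs E \<subseteq> A \<and> (\<forall>v. expr_value v E = g v))"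

lemma expressible_input: "f \<in> A \<Longrightarrow> expressible A (\<lambda>v. v f)"
  unfolding expressible_def by (intro exI[of _ "Input f"]) auto

lemma expressible_add: "expressible A g \<Longrightarrow> expressible A h \<Longrightarrow> expressible A (\<lambda>v. g v + h v)"
  unfolding expressible_def
proof (elim exE conjE)
  fix E E' assume "inputs E \<subseteq> A" "\<forall>v. expr_value v E = g v" "inputs E' \<subseteq> A" "\<forall>v. expr_value v E' = h v"
  then show "\<exists>E. inputs E \<subseteq> A \<and> (\<forall>v. expr_value v E = g v + h v)" by (intro exI[of _ "Add E E'"]) auto
qed

lemma expressible_diff: "expressible A g \<Longrightarrow> expressible A h \<Longrightarrow> expressible A (\<lambda>v. g v - h v)"
  unfolding expressible_def
proof (elim exE conjE)
  fix E E' assume "inputs E \<subseteq> A" "\<forall>v. expr_value v E = g v" "inputs E' \<subseteq> A" "\<forall>v. expr_value v E' = h v"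
  then show "\<exists>E. inputs E \<subseteq> A \<and> (\<forall>v. expr_value v E = g v - h v)" by (intro exI[of _ "Sub E E'"]) auto
qed

lemma expressible_mult: "expressible A g \<Longrightarrow> expressible A h \<Longrightarrow> expressible A (\<lambda>v. g v * h v)"
  unfolding expressible_def
proof (elim exE conjE)
  fix E E' assume "inputs E \<subseteq> A" "\<forall>v. expr_value v E = g v" "inputs E' \<subseteq> A" "\<forall>v. expr_value v E' = h v"
  then show "\<exists>E. inputs E \<subseteq> A \<and> (\<forall>v. expr_value v E = g v * h v)" by (intro exI[of _ "Mul E E'"]) auto
qed

lemma expressible_divide: "expressible A g \<Longrightarrow> expressible A h \<Longrightarrow> expressible A (\<lambda>v. g v / h v)"
  unfolding expressible_def
proof (elim exE conjE)
  fix E E' assume "inputs E \<subseteq> A" "\<forall>v. expr_value v E = g v" "inputs E' \<subseteq> A" "\<forall>v. expr_value v E' = h v"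
  then show "\<exists>E. inputs E \<subseteq> A \<and> (\<forall>v. expr_value v E = g v / h v)" by (intro exI[of _ "Div E E'"]) auto
qed

lemma expressible_cnj: "expressible A g \<Longrightarrow> expressible A (\<lambda>v. cnj (g v))"
  unfolding expressible_def
proof (elim exE conjE)
  fix E assume "inputs E \<subseteq> A" "\<forall>v. expr_value v E = g v"
  then show "\<exists>E. inputs E \<subseteq> A \<and> (\<forall>v. expr_value v E = cnj (g v))" by (intro exI[of _ "Conj E"]) auto
qed

lemma expressible_0: "expressible A (\<lambda>v. 0)"
  unfolding expressible_def by (intro exI[of _ Zero]) auto

lemma expressible_1: "expressible A (\<lambda>v. 1)"
  unfolding expressible_def by (intro exI[of _ One]) auto

lemma expressible_ii: "expressible A (\<lambda>v. \<i>)"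
  unfolding expressible_def by (intro exI[of _ Imag_Unit]) auto

lemma expressible_of_nat: "expressible A (\<lambda>v. of_nat n)"
proof (induction n)
  case 0 show ?case using expressible_0 by simp
next
  case (Suc n)
  show ?case using expressible_add[OF expressible_1 Suc] by simp
qed

lemma expressible_of_int: "expressible A (\<lambda>v. of_int n)"
proof (cases n)
  case (nonneg k)
  then show ?thesis using expressible_of_nat[of A k] by simp
next
  case (neg k)
  then have "complex_of_int n = 0 - of_nat (Suc k)" by simp
  then show ?thesis using expressible_diff[OF expressible_0 expressible_of_nat[of A "Suc k"]] by (simp only:)
qed

lemma expressible_sum:
  assumes "\<And>i. i \<in> I \<Longrightarrow> expressible A (g i)"
  shows "expressible A (\<lambda>v. \<Sum>i\<in>I. g i v)"
  using assms
  by (induction I rule: infinite_finite_induct) (auto intro: expressible_0 expressible_add)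

lemma expressible_prod:
  assumes "\<And>i. i \<in> I \<Longrightarrow> expressible A (g i)"
  shows "expressible A (\<lambda>v. \<Prod>i\<in>I. g i v)"
  using assms
  by (induction I rule: infinite_finite_induct) (auto intro: expressible_1 expressible_mult)

lemma expressible_power: "expressible A g \<Longrightarrow> expressible A (\<lambda>v. g v ^ n)"
  by (induction n) (auto intro: expressible_1 expressible_mult)

lemma expressible_norm_square:
  assumes "expressible A g"
  shows "expressible A (\<lambda>v. complex_of_real ((cmod (g v))\<^sup>2))"
  using expressible_mult[OF assms expressible_cnj[OF assms]]
  by (simp add: complex_norm_square del: of_real_power)

text \<open>Values are returned only at the leaves of the tree, so the expressions selected so far
  are carried along in the accumulator.\<close>

primrec filter_computation ::
  "('f arith_expr \<times> 'f arith_expr) list \<Rightarrow> 'f arith_expr list \<Rightarrow> 'f computation" where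
  "filter_computation [] acc = Return acc"
| "filter_computation (te # l) acc =
     If_Positive (fst te) (filter_computation l (snd te # acc)) (filter_computation l acc)"

lemma computes_filter_computation:
  assumes "\<And>t e. (t, e) \<in> set l \<Longrightarrow> inputs t \<subseteq> A \<and> inputs e \<subseteq> A" "\<And>e. e \<in> set acc \<Longrightarrow> inputs e \<subseteq> A"
  shows "\<exists>F zs. computes v (filter_computation l acc) F zs \<and> F \<subseteq> A \<and>
    set zs = expr_value v ` set acc \<union> {expr_value v e | t e. (t, e) \<in> set l \<and> Re (expr_value v t) > 0}"
  using assms
proof (induction l arbitrary: acc)
  case Nil
  have "computes v (Return acc) (\<Union>(inputs ` set acc)) (map (expr_value v) acc)" by (rule computes.intros)
  then show ?case using Nil by (intro exI[of _ "\<Union>(inputs ` set acc)"] exI[of _ "map (expr_value v) acc"]) auto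
next
  case (Cons te l)
  obtain t e where te: "te = (t, e)" by fastforce
  show ?case
  proof (cases "Re (expr_value v t) > 0")
    case True
    obtain F zs where F: "computes v (filter_computation l (e # acc)) F zs" "F \<subseteq> A"
      "set zs = expr_value v ` set (e # acc) \<union> {expr_value v e | t e. (t, e) \<in> set l \<and> Re (expr_value v t) > 0}"
      using Cons.IH[of "e # acc"] Cons.prems te by fastforce
    have "computes v (filter_computation (te # l) acc) (inputs t \<union> F) zs"
      using computes.intros(2)[OF True F(1)] by (simp add: te)
    moreover have "inputs t \<union> F \<subseteq> A" using F(2) Cons.prems(1) te by auto
    moreover have "set zs = expr_value v ` set acc \<union>
        {expr_value v e | t e. (t, e) \<in> set (te # l) \<and> Re (expr_value v t) > 0}"
      unfolding F(3) using te True by auto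
    ultimately show ?thesis by blast
  next
    case False
    obtain F zs where F: "computes v (filter_computation l acc) F zs" "F \<subseteq> A"
      "set zs = expr_value v ` set acc \<union> {expr_value v e | t e. (t, e) \<in> set l \<and> Re (expr_value v t) > 0}"
      using Cons.IH[of acc] Cons.prems te by fastforce
    have "computes v (filter_computation (te # l) acc) (inputs t \<union> F) zs"
      using computes.intros(3)[OF False F(1)] by (simp add: te)
    moreover have "inputs t \<union> F \<subseteq> A" using F(2) Cons.prems(1) te by auto
    moreover have "set zs = expr_value v ` set acc \<union>
        {expr_value v e | t e. (t, e) \<in> set (te # l) \<and> Re (expr_value v t) > 0}"
      unfolding F(3) using te False by auto
    ultimately show ?thesis by blast
  qed
qed

text \<open>Corecursive because the tree has to be infinite: how many tests fail before one succeeds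
  depends on the data and need not have a common bound.\<close>

primcorec search_computation ::
  "(nat \<Rightarrow> 'f arith_expr) \<Rightarrow> (nat \<Rightarrow> 'f computation) \<Rightarrow> nat \<Rightarrow> 'f computation" where
  "search_computation t P n = If_Positive (t n) (P n) (search_computation t P (Suc n))"

text \<open>The run stops at the first successful test from \<open>n\<close> on, which need not be
  the given \<open>m\<close>; the index \<open>m\<close> only guarantees termination. Stating the
  result for whatever \<open>P k\<close> computes keeps the search separate from the computation
  that follows it.\<close>

lemma computes_search_computation:
  assumes "Re (expr_value v (t m)) > 0" "n \<le> m" "\<And>k. inputs (t k) \<subseteq> A"
  shows "\<exists>k. Re (expr_value v (t k)) > 0 \<and> (\<forall>F zs. computes v (P k) F zs \<longrightarrow> F \<subseteq> A \<longrightarrow>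
    (\<exists>F'\<subseteq>A. computes v (search_computation t P n) F' zs))"
proof -
  have stop: "\<exists>F'\<subseteq>A. computes v (search_computation t P n) F' zs"
    if "Re (expr_value v (t n)) > 0" "computes v (P n) F zs" "F \<subseteq> A" for n F zs
  proof (intro exI conjI)
    show "computes v (search_computation t P n) (inputs (t n) \<union> F) zs"
      by (subst search_computation.code) (rule computes.intros(2)[OF that(1,2)])
    show "inputs (t n) \<union> F \<subseteq> A" using that(3) assms(3) by simp
  qed
  show ?thesis
    using assms(2,1)
  proof (induction n rule: inc_induct)
  case base
  show ?case by (rule exI[of _ m], rule conjI[OF base], intro allI impI, erule (1) stop[OF base])
next
  case (step n)
  show ?case
  proof (cases "Re (expr_value v (t n)) > 0")
    case True
    show ?thesis by (rule exI[of _ n], rule conjI[OF True], intro allI impI, erule (1) stop[OF True])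
  next
    case False
    obtain k where k: "Re (expr_value v (t k)) > 0" "\<forall>F zs. computes v (P k) F zs \<longrightarrow> F \<subseteq> A \<longrightarrow>
        (\<exists>F'\<subseteq>A. computes v (search_computation t P (Suc n)) F' zs)"
      using step.IH[OF assms(1)] by (elim exE conjE)
    have ext: "\<exists>F'\<subseteq>A. computes v (search_computation t P n) F' zs" if F: "computes v (P k) F zs" "F \<subseteq> A" for F zs
    proof -
      obtain F' where F': "F' \<subseteq> A" "computes v (search_computation t P (Suc n)) F' zs"
        using k(2)[rule_format, OF F] by (elim exE conjE)
      have "computes v (search_computation t P n) (inputs (t n) \<union> F') zs"
        by (subst search_computation.code) (rule computes.intros(3)[OF False F'(2)])
      moreover have "inputs (t n) \<union> F' \<subseteq> A" using F'(1) assms(3) by simp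
      ultimately show ?thesis by (rule_tac exI[of _ "inputs (t n) \<union> F'"], rule_tac conjI)
    qed
    show ?thesis by (rule exI[of _ k], rule conjI[OF k(1)], intro allI impI, erule (1) ext)
  qed
  qed
qed

text \<open>In the application \<open>test\<close> asks whether a mesh is fine enough,
  \<open>R\<close> consists of the Rayleigh quotients, \<open>G k\<close> is the grid of mesh
  \<open>1 / k\<close>, and \<open>accept\<close> asks whether the characteristic polynomial is
  small. Which successful \<open>k\<close> is used remains open.\<close>

lemma exists_search_computation:
  fixes test :: "nat \<Rightarrow> ('f \<Rightarrow> complex) \<Rightarrow> complex" and accept :: "nat \<Rightarrow> complex \<Rightarrow> ('f \<Rightarrow> complex) \<Rightarrow> complex"
  assumes test: "\<And>n. expressible A (test n)"
    and G: "\<And>n. finite (G n)" "\<And>n c. c \<in> G n \<Longrightarrow> expressible A (\<lambda>v. c)"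
    and accept: "\<And>n c. c \<in> G n \<Longrightarrow> expressible A (accept n c)"
    and R: "finite R" "\<And>g. g \<in> R \<Longrightarrow> expressible A g"
  obtains p where "\<And>v m. Re (test m v) > 0 \<Longrightarrow> \<exists>F zs k. F \<subseteq> A \<and> computes v p F zs \<and> Re (test k v) > 0 \<and>
      set zs = (\<lambda>g. g v) ` R \<union> {c \<in> G k. Re (accept k c v) > 0}"
proof -
  define ex where "ex g = (SOME E. inputs E \<subseteq> A \<and> (\<forall>v. expr_value v E = g v))" for g
  have ex: "inputs (ex g) \<subseteq> A" "expr_value v (ex g) = g v" if "expressible A g" for g v
    using someI_ex[OF that[unfolded expressible_def]] unfolding ex_def[symmetric] by blast+
  define t where "t n = ex (test n)" for n
  have t: "inputs (t n) \<subseteq> A" "expr_value v (t n) = test n v" for n v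
    using ex[OF test] by (simp_all add: t_def)
  obtain Rl where Rl: "set Rl = R" using finite_list[OF R(1)] ..
  define Gl where "Gl n = (SOME xs. set xs = G n)" for n
  have Gl: "set (Gl n) = G n" for n
    unfolding Gl_def by (rule someI_ex[OF finite_list[OF G(1)]])
  define P where "P n = filter_computation (map (\<lambda>c. (ex (accept n c), ex (\<lambda>v. c))) (Gl n)) (map ex Rl)" for n
  have P: "\<exists>F zs. computes v (P n) F zs \<and> F \<subseteq> A \<and> set zs = (\<lambda>g. g v) ` R \<union> {c \<in> G n. Re (accept n c v) > 0}" for n v
  proof -
    have "\<exists>F zs. computes v (P n) F zs \<and> F \<subseteq> A \<and> set zs = expr_value v ` set (map ex Rl) \<union>
       {expr_value v e | t e. (t, e) \<in> set (map (\<lambda>c. (ex (accept n c), ex (\<lambda>v. c))) (Gl n)) \<and> Re (expr_value v t) > 0}"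
      unfolding P_def
    proof (rule computes_filter_computation)
      fix t e assume "(t, e) \<in> set (map (\<lambda>c. (ex (accept n c), ex (\<lambda>v. c))) (Gl n))"
      then obtain c where c: "c \<in> set (Gl n)" "(t, e) = (ex (accept n c), ex (\<lambda>v. c))"
        unfolding set_map by (rule imageE)
      have c: "c \<in> G n" "t = ex (accept n c)" "e = ex (\<lambda>v. c)" using c unfolding Gl by simp_all
      show "inputs t \<subseteq> A \<and> inputs e \<subseteq> A" unfolding c(2,3) using ex(1) G(2)[OF c(1)] accept[OF c(1)] by blast
    next
      fix e assume "e \<in> set (map ex Rl)"
      then show "inputs e \<subseteq> A" using ex(1) R(2) Rl by auto
    qed
    moreover have "expr_value v ` set (map ex Rl) = (\<lambda>g. g v) ` R"
      using Rl R(2) ex(2) by (auto simp: image_iff)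
    moreover have "{expr_value v e | t e. (t, e) \<in> set (map (\<lambda>c. (ex (accept n c), ex (\<lambda>v. c))) (Gl n)) \<and>
        Re (expr_value v t) > 0} = {expr_value v (ex (\<lambda>v. c)) | c. c \<in> G n \<and> Re (expr_value v (ex (accept n c))) > 0}"
      using Gl by auto
    moreover have "\<dots> = {c \<in> G n. Re (accept n c v) > 0}"
    proof -
      have "expr_value v (ex (\<lambda>v. c)) = c" "expr_value v (ex (accept n c)) = accept n c v" if "c \<in> G n" for c
        using ex(2)[OF G(2)[OF that]] ex(2)[OF accept[OF that]] by simp_all
      then show ?thesis by auto metis
    qed
    ultimately show ?thesis by (simp only:)
  qed
  show ?thesis
  proof (rule that)
    fix v m assume "Re (test m v) > 0"
    then have "Re (expr_value v (t m)) > 0" by (simp add: t)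
    from computes_search_computation[where t = t and v = v and n = 0 and P = P and A = A, OF this le0 t(1)]
    obtain k where k: "Re (expr_value v (t k)) > 0" "\<forall>F zs. computes v (P k) F zs \<longrightarrow> F \<subseteq> A \<longrightarrow>
        (\<exists>F'\<subseteq>A. computes v (search_computation t P 0) F' zs)"
      by (elim exE conjE)
    obtain F zs where F: "computes v (P k) F zs" "F \<subseteq> A"
      "set zs = (\<lambda>g. g v) ` R \<union> {c \<in> G k. Re (accept k c v) > 0}" using P[of v k] by (elim exE conjE)
    obtain F' where "F' \<subseteq> A" "computes v (search_computation t P 0) F' zs" using k(2)[rule_format, OF F(1,2)] by (elim exE conjE)
    then show "\<exists>F zs k. F \<subseteq> A \<and> computes v (search_computation t P 0) F zs \<and> Re (test k v) > 0 \<and>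
      set zs = (\<lambda>g. g v) ` R \<union> {c \<in> G k. Re (accept k c v) > 0}"
      using F(3) k(1) unfolding t(2) by (intro exI conjI)
  qed
qed

subsection \<open>Convergence in the Attouch-Wets metric\<close>

lemma limitin_closed_subsets_metric:
  assumes "\<And>n. closed (\<Gamma> n)" "closed S"
    and "(\<lambda>n. attouch_wets_dist (\<Gamma> n) S) \<longlonglongrightarrow> 0"
  shows "limitin (mtopology_of closed_subsets_metric) \<Gamma> S sequentially"
proof -
  interpret Metric_space "{A. closed A}" attouch_wets_dist by (rule Metric_space_attouch_wets)
  have "mtopology_of closed_subsets_metric = mtopology"
    by (simp add: closed_subsets_metric_def mtopology_of_def mspace_metric mdist_metric)
  then show ?thesis using assms by (simp add: limitin_metric_dist_null)
qed

text \<open>The bound on the ball of radius \<open>N + 1\<close> controls the terms of index below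
  \<open>N\<close>; the geometric tail from \<open>N\<close> on sums to
  \<open>(1/2) ^ N\<close>.\<close>

lemma attouch_wets_dist_le:
  assumes "A \<noteq> {}" "B \<noteq> {}" "\<epsilon> \<ge> 0"
    and "\<And>x. x \<in> ball 0 (real (Suc N)) \<Longrightarrow> \<bar>infdist x A - infdist x B\<bar> \<le> \<epsilon>"
  shows "attouch_wets_dist A B \<le> \<epsilon> + (1/2) ^ N"
proof -
  define s where "s n = (SUP x\<in>ball 0 (real (Suc n)). \<bar>infdist x A - infdist x B\<bar>)" for n
  have s0: "0 \<le> s n" for n
    unfolding s_def by (rule order_trans[OF abs_ge_zero cSUP_upper[OF _ bdd_above_infdist_diff, of 0]]) simp
  have s_le: "s n \<le> \<epsilon>" if "n \<le> N" for n
    unfolding s_def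
  proof (rule cSUP_least)
    fix x :: complex assume "x \<in> ball 0 (real (Suc n))"
    then show "\<bar>infdist x A - infdist x B\<bar> \<le> \<epsilon>" using that by (intro assms(4)) auto
  qed simp
  define t where "t n = (1/2) ^ Suc n * min 1 (s n)" for n
  define g where "g n = (1/2::real) ^ Suc n * \<epsilon> + (if n < N then 0 else (1/2) ^ Suc n)" for n
  have half: "(\<lambda>n. (1/2::real) ^ Suc n) sums 1" by (rule power_half_series)
  have tail: "(\<lambda>n. if n < N then 0 else (1/2::real) ^ Suc n) sums (1/2) ^ N"
  proof -
    have "(\<lambda>n. (1/2) ^ N * (1/2::real) ^ Suc n) sums ((1/2) ^ N * 1)" by (intro sums_mult half)
    then have "(\<lambda>n. if n + N < N then 0 else (1/2::real) ^ Suc (n + N)) sums (1/2) ^ N"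
      by (simp add: power_add mult_ac)
    then show ?thesis by (subst (asm) sums_zero_iff_shift) auto
  qed
  have g: "g sums (1 * \<epsilon> + (1/2) ^ N)"
    unfolding g_def by (intro sums_add sums_mult2 half tail)
  have tg: "t n \<le> g n" for n
  proof (cases "n < N")
    case True
    then have "min 1 (s n) \<le> \<epsilon>" using s_le[of n] by auto
    then show ?thesis using True by (simp add: t_def g_def)
  next
    case False
    have "(1/2::real) ^ Suc n * min 1 (s n) \<le> (1/2) ^ Suc n" by (rule mult_left_le) auto
    moreover have "0 \<le> (1/2::real) ^ Suc n * \<epsilon>" using assms(3) by simp
    ultimately show ?thesis using False unfolding t_def g_def if_not_P[OF False] by linarith
  qed
  have t: "summable t"
  proof (rule summable_comparison_test'[OF sums_summable[OF g], of 0])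
    show "norm (t n) \<le> g n" for n using tg[of n] s0[of n] by (simp add: t_def)
  qed
  have "suminf t \<le> suminf g" by (rule suminf_le[OF tg t sums_summable[OF g]])
  then show ?thesis
    using assms(1,2) sums_unique[OF g]
    by (simp add: attouch_wets_dist_def t_def[abs_def] s_def)
qed

text \<open>The lower approximation may be pointwise, because the relevant bounded part of
  \<open>S\<close> is compact and a finite net makes it uniform. The upper approximation has to be
  uniform, but only over bounded parts of \<open>\<Gamma> n\<close>: once \<open>\<Gamma> n\<close>
  has a point near \<open>s0\<close>, remote points do not affect distances from a ball.\<close>

lemma attouch_wets_convergence:
  fixes \<Gamma> :: "nat \<Rightarrow> complex set"
  assumes S: "closed S" "S \<noteq> {}" and cl: "\<And>n. closed (\<Gamma> n)"
    and lower: "\<And>l \<epsilon>. l \<in> S \<Longrightarrow> \<epsilon> > 0 \<Longrightarrow> eventually (\<lambda>n. \<exists>z\<in>\<Gamma> n. dist z l < \<epsilon>) sequentially"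
    and upper: "\<And>r \<epsilon>. \<epsilon> > 0 \<Longrightarrow> eventually (\<lambda>n. \<forall>z\<in>\<Gamma> n. norm z \<le> r \<longrightarrow> (\<exists>l\<in>S. dist z l < \<epsilon>)) sequentially"
  shows "limitin (mtopology_of closed_subsets_metric) \<Gamma> S sequentially"
proof (rule limitin_closed_subsets_metric[OF cl S(1)])
  have key: "eventually (\<lambda>n. \<Gamma> n \<noteq> {} \<and> (\<forall>x\<in>ball 0 R. \<bar>infdist x (\<Gamma> n) - infdist x S\<bar> \<le> \<epsilon>)) sequentially"
    if "\<epsilon> > 0" for R \<epsilon> :: real
  proof -
    obtain s0 where s0: "s0 \<in> S" using S by blast
    \<comment> \<open>A point of \<open>S\<close> nearest to some \<open>x\<close> of the ball is no
      farther from \<open>x\<close> than \<open>s0\<close>, so its norm is at most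
      \<open>2 * norm x + norm s0\<close>.\<close>
    define r where "r = 2 * \<bar>R\<bar> + norm s0"
    have comp: "compact (S \<inter> cball 0 r)" using S(1) by (simp add: closed_Int_compact)
    obtain K where K: "finite K" "K \<subseteq> S \<inter> cball 0 r" "S \<inter> cball 0 r \<subseteq> (\<Union>x\<in>K. ball x (\<epsilon>/2))"
      using compactE_image[OF comp, of "S \<inter> cball 0 r" "\<lambda>x. ball x (\<epsilon>/2)"] \<open>\<epsilon> > 0\<close>
      by (metis (no_types, lifting) UN_I centre_in_ball half_gt_zero open_ball subsetI)
    have "eventually (\<lambda>n. \<forall>l\<in>K. \<exists>z\<in>\<Gamma> n. dist z l < \<epsilon>/2) sequentially"
      using K(1,2) lower[of _ "\<epsilon>/2"] \<open>\<epsilon> > 0\<close> by (intro eventually_ball_finite) auto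
    moreover have "eventually (\<lambda>n. \<exists>z\<in>\<Gamma> n. dist z s0 < \<epsilon>) sequentially" using lower s0 that by blast
    moreover have "eventually (\<lambda>n. \<forall>z\<in>\<Gamma> n. norm z \<le> r + \<epsilon> \<longrightarrow> (\<exists>l\<in>S. dist z l < \<epsilon>)) sequentially"
      using upper that by blast
    ultimately show ?thesis
    proof eventually_elim
      case (elim n)
      have ne: "\<Gamma> n \<noteq> {}" using elim(2) by blast
      have "\<bar>infdist x (\<Gamma> n) - infdist x S\<bar> \<le> \<epsilon>" if x: "x \<in> ball 0 R" for x
      proof -
        have R: "norm x < \<bar>R\<bar>" using x by simp
        obtain l where l: "l \<in> S" "infdist x S = dist x l" using infdist_attains_inf[OF S] by blast
        have dl: "dist x l \<le> dist x s0" using infdist_le[OF s0, of x] l(2) by simp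
        have ds: "dist x s0 \<le> norm x + norm s0" by (simp add: dist_norm norm_triangle_ineq4)
        have "norm l \<le> norm x + dist x l" by (metis dist_norm norm_triangle_sub norm_minus_commute)
        then have "l \<in> S \<inter> cball 0 r" using l(1) dl ds R by (simp add: r_def)
        then obtain k where k: "k \<in> K" "dist k l < \<epsilon>/2" using K(3) by auto
        then obtain z where z: "z \<in> \<Gamma> n" "dist z k < \<epsilon>/2" using elim(1) by blast
        have "dist x z \<le> dist x l + dist k l + dist z k"
          using dist_triangle[of x z l] dist_triangle[of l z k] by (simp add: dist_commute)
        then have up: "infdist x (\<Gamma> n) \<le> infdist x S + \<epsilon>"
          using infdist_le[OF z(1), of x] k z l by linarith
        obtain w where w: "w \<in> \<Gamma> n" "infdist x (\<Gamma> n) = dist x w" using infdist_attains_inf[OF cl ne] by blast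
        have "norm w \<le> norm x + dist x w" by (metis dist_norm norm_triangle_sub norm_minus_commute)
        then have "norm w \<le> r + \<epsilon>" using up w(2) l(2) dl ds R by (simp add: r_def)
        then obtain y where "y \<in> S" "dist w y < \<epsilon>" using elim(3) w(1) by blast
        then have "infdist x S \<le> infdist x (\<Gamma> n) + \<epsilon>"
          using infdist_le[of y S x] dist_triangle[of x y w] w(2) by linarith
        with up show ?thesis by linarith
      qed
      with ne show ?case by blast
    qed
  qed
  show "(\<lambda>n. attouch_wets_dist (\<Gamma> n) S) \<longlonglongrightarrow> 0"
  proof (rule tendstoI)
    fix \<epsilon> :: real assume "\<epsilon> > 0"
    obtain N where N: "(1/2::real) ^ N < \<epsilon>/2" using real_arch_pow_inv[of "\<epsilon>/2" "1/2"] \<open>\<epsilon> > 0\<close> by auto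
    have "eventually (\<lambda>n. \<Gamma> n \<noteq> {} \<and> (\<forall>x\<in>ball 0 (real (Suc N)). \<bar>infdist x (\<Gamma> n) - infdist x S\<bar> \<le> \<epsilon>/2)) sequentially"
      by (rule key) (use \<open>\<epsilon> > 0\<close> in simp)
    then show "eventually (\<lambda>n. dist (attouch_wets_dist (\<Gamma> n) S) 0 < \<epsilon>) sequentially"
    proof eventually_elim
      case (elim n)
      have "attouch_wets_dist (\<Gamma> n) S \<le> \<epsilon>/2 + (1/2) ^ N"
        by (rule attouch_wets_dist_le) (use elim S \<open>\<epsilon> > 0\<close> in auto)
      moreover have "0 \<le> attouch_wets_dist (\<Gamma> n) S"
        using Metric_space.nonneg[OF Metric_space_attouch_wets] by blast
      ultimately show ?case using N by simp
    qed
  qed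
qed

subsection \<open>Characteristic polynomials\<close>

text \<open>The Leibniz expansion of the determinant of \<open>z - a\<close>, written out so that it
  is visibly arithmetic in \<open>z\<close> and the entries; \<open>charpoly_det\<close> and
  \<open>charpoly_poly\<close> identify it with the library notions.\<close>

definition charpoly :: "nat \<Rightarrow> (nat \<Rightarrow> nat \<Rightarrow> complex) \<Rightarrow> complex \<Rightarrow> complex" where
  "charpoly d a z = (\<Sum>p | p permutes {0..<d}. signof p *
     (\<Prod>i = 0..<d. (if i = p i then z else 0) - a i (p i)))"

definition shift_mat :: "nat \<Rightarrow> (nat \<Rightarrow> nat \<Rightarrow> complex) \<Rightarrow> complex \<Rightarrow> complex mat" where
  "shift_mat d a z = Matrix.mat d d (\<lambda>(i, j). (if i = j then z else 0) - a i j)"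

lemma shift_mat_carrier: "shift_mat d a z \<in> carrier_mat d d"
  by (simp add: shift_mat_def)

lemma charpoly_det: "charpoly d a z = Determinant.det (shift_mat d a z)"
proof -
  have "(\<Prod>i = 0..<d. (if i = p i then z else 0) - a i (p i)) =
      (\<Prod>i = 0..<d. shift_mat d a z $$ (i, p i))" if "p permutes {0..<d}" for p
    using that by (intro prod.cong) (auto simp: shift_mat_def dest: permutes_in_image[of p _ ])
  then show ?thesis
    by (simp add: charpoly_def Determinant.det_def'[OF shift_mat_carrier])
qed

lemma charpoly_poly: "charpoly d a z = poly (char_poly (Matrix.mat d d (\<lambda>(i, j). a i j))) z"
proof -
  have A: "Matrix.mat d d (\<lambda>(i, j). a i j) \<in> carrier_mat d d" by simp
  have "- (char_matrix (Matrix.mat d d (\<lambda>(i, j). a i j)) z) = shift_mat d a z"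
    by (rule eq_matI) (auto simp: char_matrix_def shift_mat_def)
  then show ?thesis by (simp add: char_poly_matrix[OF A] charpoly_det)
qed

lemma charpoly_factorization:
  obtains xs where "length xs = d" "\<And>z. charpoly d a z = (\<Prod>x\<leftarrow>xs. z - x)"
proof -
  obtain xs where xs: "char_poly (Matrix.mat d d (\<lambda>(i, j). a i j)) = (\<Prod>x\<leftarrow>xs. [:- x, 1:])" "length xs = d"
    using char_poly_factorized[of "Matrix.mat d d (\<lambda>(i, j). a i j)" d] by auto
  have "charpoly d a z = (\<Prod>x\<leftarrow>xs. z - x)" for z
    unfolding charpoly_poly xs(1) by (induction xs) (auto simp: algebra_simps)
  then show ?thesis using that xs(2) by blast
qed

lemma charpoly_root_eigenvector:
  assumes "charpoly d a z = 0"
  obtains c where "\<exists>i<d. c i \<noteq> 0" "\<And>i. i < d \<Longrightarrow> (\<Sum>j<d. a i j * c j) = z * c i"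
proof -
  let ?A = "Matrix.mat d d (\<lambda>(i, j). a i j)"
  have "eigenvalue ?A z"
    using assms eigenvalue_root_char_poly[of ?A d z] by (simp add: charpoly_poly)
  then obtain v where v: "v \<in> carrier_vec d" "v \<noteq> 0\<^sub>v d" "?A *\<^sub>v v = z \<cdot>\<^sub>v v"
    unfolding eigenvalue_def eigenvector_def by auto
  have "\<exists>i<d. Matrix.vec_index v i \<noteq> 0" using v(1,2) by (metis carrier_vecD eq_vecI index_zero_vec)
  moreover have "(\<Sum>j<d. a i j * Matrix.vec_index v j) = z * Matrix.vec_index v i" if "i < d" for i
  proof -
    have "Matrix.vec_index (?A *\<^sub>v v) i = z * Matrix.vec_index v i" using v(1) that unfolding v(3) by simp
    moreover have "Matrix.vec_index (?A *\<^sub>v v) i = (\<Sum>j<d. a i j * Matrix.vec_index v j)"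
      using that v(1) by (simp add: scalar_prod_def atLeast0LessThan)
    ultimately show ?thesis by simp
  qed
  ultimately show ?thesis using that[of "\<lambda>i. Matrix.vec_index v i"] by blast
qed

lemma det_holomorphic:
  assumes "\<And>z. M z \<in> carrier_mat n n" "\<And>i j. i < n \<Longrightarrow> j < n \<Longrightarrow> (\<lambda>z. M z $$ (i, j)) holomorphic_on U"
  shows "(\<lambda>z. Determinant.det (M z)) holomorphic_on U"
proof -
  have "(\<lambda>z. M z $$ (i, p i)) holomorphic_on U" if "p permutes {0..<n}" "i < n" for p i
    using assms(2)[of i "p i"] that permutes_in_image[OF that(1), of i] by simp
  then show ?thesis
    unfolding Determinant.det_def'[OF assms(1)]
    by (intro holomorphic_intros) auto
qed

lemma charpoly_holomorphic: "charpoly d a holomorphic_on U"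
proof -
  have "(\<lambda>z. Determinant.det (shift_mat d a z)) holomorphic_on U"
  proof (rule det_holomorphic[OF shift_mat_carrier])
    fix i j assume "i < d" "j < d"
    then show "(\<lambda>z. shift_mat d a z $$ (i, j)) holomorphic_on U"
      by (cases "i = j") (auto simp: shift_mat_def intro!: holomorphic_intros)
  qed
  moreover have "charpoly d a = (\<lambda>z. Determinant.det (shift_mat d a z))" by (auto simp: charpoly_det)
  ultimately show ?thesis by simp
qed

text \<open>Cramer's rule: the adjugate of \<open>z - a\<close> divided by the characteristic
  polynomial is holomorphic in \<open>z\<close> off the roots. The last clause, uniqueness, serves
  to identify the solution at one particular \<open>z\<close> with a known vector.\<close>

lemma resolvent_solution_holomorphic:
  obtains c :: "nat \<Rightarrow> complex \<Rightarrow> complex"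
  where "\<And>j. c j holomorphic_on {z. charpoly d a z \<noteq> 0}"
    "\<And>z i. charpoly d a z \<noteq> 0 \<Longrightarrow> i < d \<Longrightarrow> (\<Sum>j<d. ((if i = j then z else 0) - a i j) * c j z) = b i"
    "\<And>z j x. charpoly d a z \<noteq> 0 \<Longrightarrow> j < d \<Longrightarrow>
       (\<And>i. i < d \<Longrightarrow> (\<Sum>j<d. ((if i = j then z else 0) - a i j) * x j) = b i) \<Longrightarrow> c j z = x j"
proof
  define q where "q j l z = cofactor (shift_mat d a z) l j" for j l z
  define c where "c j z = (if j < d then (\<Sum>l<d. q j l z * b l) / charpoly d a z else 0)" for j z
  have S: "shift_mat d a z $$ (i, j) = (if i = j then z else 0) - a i j" if "i < d" "j < d" for i j z
    using that by (simp add: shift_mat_def)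
  have dims: "dim_row (shift_mat d a z) = d" "dim_col (shift_mat d a z) = d" for z
    by (simp_all add: shift_mat_def)
  have q_right: "(\<Sum>j<d. ((if i = j then z else 0) - a i j) * q j l z) = (if i = l then charpoly d a z else 0)"
    if "i < d" "l < d" for i l z
  proof -
    have "(shift_mat d a z * adj_mat (shift_mat d a z)) $$ (i, l) = (if i = l then charpoly d a z else 0)"
      using that by (simp add: adj_mat(2)[OF shift_mat_carrier] charpoly_det)
    then show ?thesis
      using that by (simp add: adj_mat_def times_mat_def scalar_prod_def dims S q_def atLeast0LessThan)
  qed
  have q_left: "(\<Sum>j<d. q i j z * ((if j = l then z else 0) - a j l)) = (if i = l then charpoly d a z else 0)"
    if "i < d" "l < d" for i l z
  proof -
    have "(adj_mat (shift_mat d a z) * shift_mat d a z) $$ (i, l) = (if i = l then charpoly d a z else 0)"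
      using that by (simp add: adj_mat(3)[OF shift_mat_carrier] charpoly_det)
    then show ?thesis
      using that by (simp add: adj_mat_def times_mat_def scalar_prod_def dims S q_def atLeast0LessThan)
  qed
  have q_hol: "q j l holomorphic_on U" if "j < d" "l < d" for j l U
  proof -
    have "(\<lambda>z. Determinant.det (mat_delete (shift_mat d a z) l j)) holomorphic_on U"
    proof (rule det_holomorphic[where n = "d - 1"])
      show "mat_delete (shift_mat d a z) l j \<in> carrier_mat (d - 1) (d - 1)" for z
        by (rule mat_delete_carrier[OF shift_mat_carrier])
      fix i k assume ik: "i < d - 1" "k < d - 1"
      define i' k' where "i' = (if i < l then i else Suc i)" and "k' = (if k < j then k else Suc k)"
      have "i' < d" "k' < d" using ik by (auto simp: i'_def k'_def)
      then have "(\<lambda>z. shift_mat d a z $$ (i', k')) holomorphic_on U"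
        by (cases "i' = k'") (auto simp: S intro!: holomorphic_intros)
      moreover have "mat_delete (shift_mat d a z) l j $$ (i, k) = shift_mat d a z $$ (i', k')" for z
        using ik by (simp add: mat_delete_def dims i'_def k'_def)
      ultimately show "(\<lambda>z. mat_delete (shift_mat d a z) l j $$ (i, k)) holomorphic_on U" by simp
    qed
    then show ?thesis unfolding q_def[abs_def] cofactor_def by (intro holomorphic_intros)
  qed
  show "c j holomorphic_on {z. charpoly d a z \<noteq> 0}" for j
  proof (cases "j < d")
    case True
    then have "c j = (\<lambda>z. (\<Sum>l<d. q j l z * b l) / charpoly d a z)" by (auto simp: c_def)
    then show ?thesis using True by (auto intro!: holomorphic_intros q_hol charpoly_holomorphic)
  next
    case False
    then have "c j = (\<lambda>z. 0)" by (auto simp: c_def)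
    then show ?thesis by simp
  qed
  show "(\<Sum>j<d. ((if i = j then z else 0) - a i j) * c j z) = b i" if nz: "charpoly d a z \<noteq> 0" and i: "i < d" for z i
  proof -
    have "c j z * charpoly d a z = (\<Sum>l<d. q j l z * b l)" if "j < d" for j
      using nz that by (simp add: c_def)
    then have "(\<Sum>j<d. ((if i = j then z else 0) - a i j) * c j z) * charpoly d a z
        = (\<Sum>j<d. ((if i = j then z else 0) - a i j) * (\<Sum>l<d. q j l z * b l))"
      unfolding sum_distrib_right by (intro sum.cong) (simp_all only: mult.assoc lessThan_iff)
    also have "\<dots> = (\<Sum>j<d. \<Sum>l<d. ((if i = j then z else 0) - a i j) * q j l z * b l)"
      by (simp only: sum_distrib_left mult.assoc)
    also have "\<dots> = (\<Sum>l<d. (\<Sum>j<d. ((if i = j then z else 0) - a i j) * q j l z) * b l)"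
      by (subst sum.swap) (simp add: sum_distrib_right)
    also have "\<dots> = (\<Sum>l<d. if i = l then charpoly d a z * b l else 0)"
      using i by (intro sum.cong) (auto simp: q_right)
    also have "\<dots> = b i * charpoly d a z" using i by simp
    finally show ?thesis using nz by simp
  qed
  show "c j z = x j" if nz: "charpoly d a z \<noteq> 0" and j: "j < d" and
    x: "\<And>i. i < d \<Longrightarrow> (\<Sum>j<d. ((if i = j then z else 0) - a i j) * x j) = b i" for z j x
  proof -
    have "c j z * charpoly d a z = (\<Sum>l<d. q j l z * b l)" using nz j by (simp add: c_def)
    also have "\<dots> = (\<Sum>l<d. \<Sum>k<d. q j l z * ((if l = k then z else 0) - a l k) * x k)"
      by (simp add: x[symmetric] sum_distrib_left mult.assoc)
    also have "\<dots> = (\<Sum>k<d. (\<Sum>l<d. q j l z * ((if l = k then z else 0) - a l k)) * x k)"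
      by (subst sum.swap) (simp add: sum_distrib_right)
    also have "\<dots> = (\<Sum>k<d. if j = k then charpoly d a z * x k else 0)"
      using j by (intro sum.cong) (auto simp: q_left)
    also have "\<dots> = x j * charpoly d a z" using j by simp
    finally show ?thesis using nz by simp
  qed
qed

subsection \<open>Selfadjoint operators and their numerical range\<close>

lemma dom_op_shift [simp]: "dom (op_shift T z) = dom T"
  by (auto simp: op_shift_def dom_def)

lemma op_app_op_shift [simp]: "x \<in> dom T \<Longrightarrow> op_app (op_shift T z) x = op_app T x - z *\<^sub>C x"
  by (auto simp: op_shift_def)

lemma op_shift_eq_Some: "op_shift T z x = Some y \<longleftrightarrow> x \<in> dom T \<and> y = op_app T x - z *\<^sub>C x"
  by (auto simp: op_shift_def)

lemma ran_eq_image: "ran S = op_app S ` dom S"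
  by (force simp: ran_def dom_def image_iff)

text \<open>The closed range argument in abstract form: convergence of the images under a map that
  is bounded below is pulled back to the arguments.\<close>

lemma convergent_if_bounded_below:
  fixes x w :: "nat \<Rightarrow> 'a::complex_hilbert"
  assumes "c > 0" "\<And>m l. c * norm (x m - x l) \<le> norm (w m - w l)" "convergent w"
  shows "convergent x"
proof -
  have "Cauchy w" using assms(3) by (rule convergent_Cauchy)
  have "Cauchy x"
  proof (rule metric_CauchyI)
    fix \<epsilon> :: real assume "\<epsilon> > 0"
    then have "c * \<epsilon> > 0" using assms(1) by simp
    from metric_CauchyD[OF \<open>Cauchy w\<close> this] obtain M
      where M: "\<forall>m\<ge>M. \<forall>n\<ge>M. dist (w m) (w n) < c * \<epsilon>" ..
    have "dist (x m) (x n) < \<epsilon>" if "m \<ge> M" "n \<ge> M" for m n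
    proof -
      have "c * dist (x m) (x n) < c * \<epsilon>"
        using assms(2)[of m n] M[rule_format, OF that] by (simp add: dist_norm)
      then show ?thesis using assms(1) by simp
    qed
    then show "\<exists>M. \<forall>m\<ge>M. \<forall>n\<ge>M. dist (x m) (x n) < \<epsilon>" by (intro exI[of _ M]) simp
  qed
  then show ?thesis by (rule Cauchy_convergent)
qed

lemma resolvent_subset_Delta5:
  assumes "\<And>z. z \<in> resolvent_set T \<Longrightarrow> semi_fredholm (op_shift T z)"
  shows "resolvent_set T \<subseteq> Delta5 T"
proof
  fix z assume z: "z \<in> resolvent_set T"
  let ?F = "{z. semi_fredholm (op_shift T z)}"
  have "z \<in> ?F" using assms z by simp
  then have "connected_component_set ?F z \<in> components ?F" "z \<in> connected_component_set ?F z"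
    by (auto simp: components_def)
  then show "z \<in> Delta5 T" using z unfolding Delta5_def by blast
qed

lemma Delta5_if_connected:
  assumes "connected C" "z \<in> C" "w \<in> C" "w \<in> resolvent_set T"
    and "\<And>u. u \<in> C \<Longrightarrow> semi_fredholm (op_shift T u)"
  shows "z \<in> Delta5 T"
proof -
  let ?F = "{z. semi_fredholm (op_shift T z)}"
  have C: "C \<subseteq> connected_component_set ?F z"
    by (rule connected_component_maximal[OF assms(2,1)]) (use assms(5) in auto)
  have "connected_component_set ?F z \<in> components ?F"
    using assms(2,5) by (auto simp: components_def)
  moreover have "w \<in> connected_component_set ?F z" "z \<in> connected_component_set ?F z"
    using C assms(2,3) by auto
  ultimately show ?thesis using assms(4) unfolding Delta5_def by blast
qed

lemma Delta5_subset_semi_fredholm: "z \<in> Delta5 T \<Longrightarrow> semi_fredholm (op_shift T z)"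
  unfolding Delta5_def by (auto dest: in_components_subset)

section \<open>Closedness, and coercivity away from the numerical range\<close>

locale selfadjoint =
  fixes T :: "'a::complex_hilbert unbounded_op"
  assumes selfadjoint: "selfadjoint_op T"
begin

abbreviation D where "D \<equiv> dom T"
abbreviation A where "A \<equiv> op_app T"

lemma linear: "linear_op T" and dense: "closure D = UNIV" and adjoint: "op_adjoint T = T"
  using selfadjoint by (auto simp: selfadjoint_op_def)

lemma subspace_D: "complex_vector.subspace D"
  using linear by (simp add: linear_op_def)

lemma A_add: "x \<in> D \<Longrightarrow> y \<in> D \<Longrightarrow> A (x + y) = A x + A y"
  and A_scaleC: "x \<in> D \<Longrightarrow> A (c *\<^sub>C x) = c *\<^sub>C A x"
  using linear by (simp_all add: linear_op_def)

lemmas D_add = complex_vector.subspace_add[OF subspace_D]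
lemmas D_diff = complex_vector.subspace_diff[OF subspace_D]
lemmas D_scaleC = complex_vector.subspace_scale[OF subspace_D]
lemmas D_0 = complex_vector.subspace_0[OF subspace_D]
lemmas D_sum = complex_vector.subspace_sum[OF subspace_D]

lemma A_0: "A 0 = 0"
  using A_scaleC[OF D_0, of 0] by simp

lemma A_diff: "x \<in> D \<Longrightarrow> y \<in> D \<Longrightarrow> A (x - y) = A x - A y"
  using A_add[of x "(-1) *\<^sub>C y"] A_scaleC[of y "-1"] D_scaleC[of y "-1"]
  by (simp add: complex_vector.scale_minus_left[of 1, simplified] scaleC_one)

lemma A_sum: "(\<And>i. i \<in> I \<Longrightarrow> f i \<in> D) \<Longrightarrow> A (\<Sum>i\<in>I. f i) = (\<Sum>i\<in>I. A (f i))"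
  by (induction I rule: infinite_finite_induct) (auto simp: A_0 A_add D_sum)

lemma adjoint_unique:
  assumes "\<forall>x\<in>D. cinner u x = cinner v x"
  shows "u = v"
proof -
  have "u - v = 0"
    by (rule eq_zero_if_orthogonal_dense[OF dense]) (use assms in \<open>simp add: cinner_diff_left\<close>)
  then show ?thesis by simp
qed

text \<open>Here the equality of domains in \<open>op_adjoint T = T\<close> enters, beyond mere
  symmetry: a vector in the domain of the adjoint already belongs to \<open>D\<close>.\<close>

lemma in_D_if_adjoint:
  assumes "\<And>x. x \<in> D \<Longrightarrow> cinner (A x) y = cinner x z"
  shows "y \<in> D" "A y = z"
proof -
  have "op_adjoint T y = Some z"
  proof -
    have "(THE z. \<forall>x\<in>D. cinner (A x) y = cinner x z) = z"
    proof (rule the_equality)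
      fix w assume w: "\<forall>x\<in>D. cinner (A x) y = cinner x w"
      have "cinner w x = cinner z x" if "x \<in> D" for x
        using w assms that cinner_commute[of w x] cinner_commute[of z x] by simp
      then show "w = z" using adjoint_unique by blast
    qed (use assms in blast)
    then show ?thesis using assms unfolding op_adjoint_def by auto
  qed
  then have "T y = Some z" by (simp only: adjoint)
  then show "y \<in> D" "A y = z" by auto
qed

lemma symmetric:
  assumes "x \<in> D" "y \<in> D"
  shows "cinner (A x) y = cinner x (A y)"
proof -
  have "op_adjoint T y = Some (A y)" using assms(2) by (auto simp: adjoint)
  then have ex: "\<exists>z. \<forall>x\<in>D. cinner (A x) y = cinner x z"
    and A: "A y = (THE z. \<forall>x\<in>D. cinner (A x) y = cinner x z)"
    unfolding op_adjoint_def by (auto split: if_splits)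
  from ex obtain z where z: "\<forall>x\<in>D. cinner (A x) y = cinner x z" ..
  then have "A y = z" using in_D_if_adjoint(2) by blast
  then show ?thesis using z assms(1) by simp
qed

text \<open>An adjoint is closed: for fixed \<open>y\<close> the identity
  \<open>cinner (A y) (x k) = cinner y (A (x k))\<close> passes to the limit.\<close>

lemma closed_limit:
  assumes "\<And>k. x k \<in> D" "x \<longlonglongrightarrow> l" "(\<lambda>k. A (x k)) \<longlonglongrightarrow> w"
  shows "l \<in> D" "A l = w"
proof -
  have "cinner (A y) l = cinner y w" if y: "y \<in> D" for y
  proof -
    have "(\<lambda>k. cinner (A y) (x k)) \<longlonglongrightarrow> cinner (A y) l" by (intro tendsto_intros assms)
    moreover have "(\<lambda>k. cinner y (A (x k))) \<longlonglongrightarrow> cinner y w" by (intro tendsto_intros assms)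
    moreover have "(\<lambda>k. cinner (A y) (x k)) = (\<lambda>k. cinner y (A (x k)))" using symmetric y assms(1) by simp
    ultimately show ?thesis using LIMSEQ_unique by simp
  qed
  then show "l \<in> D" "A l = w" using in_D_if_adjoint by blast+
qed

lemma closed_op_shift: "closed_op (op_shift T z)"
  unfolding closed_op_def closed_sequential_limits
proof (intro allI impI, elim conjE)
  fix u l assume u: "\<forall>n. u n \<in> Map.graph (op_shift T z)" and lim: "u \<longlonglongrightarrow> l"
  have D: "fst (u n) \<in> D" "snd (u n) = A (fst (u n)) - z *\<^sub>C fst (u n)" for n
    using u[rule_format, of n] unfolding Map.graph_def by (auto simp: op_shift_eq_Some)
  have l1: "(\<lambda>n. fst (u n)) \<longlonglongrightarrow> fst l" and l2: "(\<lambda>n. snd (u n)) \<longlonglongrightarrow> snd l"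
    using lim by (auto intro: tendsto_intros)
  have "(\<lambda>n. snd (u n) + z *\<^sub>C fst (u n)) \<longlonglongrightarrow> snd l + z *\<^sub>C fst l" by (intro tendsto_intros l1 l2)
  then have "(\<lambda>n. A (fst (u n))) \<longlonglongrightarrow> snd l + z *\<^sub>C fst l" by (simp add: D(2))
  from closed_limit[OF D(1) l1 this] have "op_shift T z (fst l) = Some (snd l)"
    by (simp add: op_shift_eq_Some)
  then show "l \<in> Map.graph (op_shift T z)" unfolding Map.graph_def by (cases l) auto
qed

lemma cinner_A_real: "x \<in> D \<Longrightarrow> cinner (A x) x = complex_of_real (Re (cinner (A x) x))"
  using symmetric[of x x] arg_cong[OF cinner_commute[of x "A x"], of Im] by (simp add: complex_eq_iff)

definition num_range :: "real set" where
  "num_range = {Re (cinner (A x) x) | x. x \<in> D \<and> norm x = 1}"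

text \<open>The closed numerical range, placed in the complex plane; despite the name no convex hull
  is formed.\<close>

definition nr_hull :: "complex set" where
  "nr_hull = complex_of_real ` closure num_range"

lemma closed_nr_hull: "closed nr_hull"
proof -
  have "nr_hull = {z. Im z = 0} \<inter> Re -` closure num_range"
    unfolding nr_hull_def by (auto simp: complex_eq_iff intro!: image_eqI)
  moreover have "closed {z. Im z = 0}" by (intro closed_Collect_eq continuous_intros)
  moreover have "closed (Re -` closure num_range)" by (intro closed_vimage closed_closure continuous_intros)
  ultimately show ?thesis by (simp only: closed_Int)
qed

lemma rayleigh_in_hull:
  assumes "x \<in> D" "x \<noteq> 0"
  shows "cinner (A x) x / complex_of_real ((norm x)\<^sup>2) \<in> nr_hull"
proof -
  define u where "u = complex_of_real (1 / norm x) *\<^sub>C x"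
  have u: "u \<in> D" "norm u = 1" using assms by (simp_all add: u_def D_scaleC norm_divide)
  have "Re (cinner (A u) u) \<in> num_range" using u unfolding num_range_def by blast
  then have "complex_of_real (Re (cinner (A u) u)) \<in> nr_hull"
    unfolding nr_hull_def by (intro imageI) (rule subsetD[OF closure_subset])
  then have "cinner (A u) u \<in> nr_hull" by (simp only: cinner_A_real[OF u(1), symmetric])
  moreover have "cinner (A u) u = cinner (A x) x / complex_of_real ((norm x)\<^sup>2)"
    using assms by (simp add: u_def A_scaleC cinner_scaleC_left cinner_scaleC_right power2_eq_square)
  ultimately show ?thesis by (simp only:)
qed

text \<open>At a unit vector the form of \<open>T - z\<close> is a Rayleigh quotient minus
  \<open>z\<close>. Giving away half the radius of a disc around \<open>l\<close> that misses the
  hull leaves one constant for all \<open>z\<close> near \<open>l\<close>, as is required when the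
  shift varies along a sequence.\<close>

lemma coercive:
  assumes "l \<notin> nr_hull"
  shows "\<exists>c>0. \<forall>z. dist l z \<le> c \<longrightarrow> z \<notin> nr_hull \<and>
    (\<forall>x\<in>D. c * (norm x)\<^sup>2 \<le> cmod (cinner (A x - z *\<^sub>C x) x))"
proof -
  have "open (- nr_hull)" using closed_nr_hull by auto
  then obtain e where e: "e > 0" "ball l e \<subseteq> - nr_hull" using assms openE by blast
  show ?thesis
  proof (intro exI[of _ "e/2"] conjI allI impI ballI)
    fix z x assume z: "dist l z \<le> e/2" and x: "x \<in> D"
    show "e/2 * (norm x)\<^sup>2 \<le> cmod (cinner (A x - z *\<^sub>C x) x)"
    proof (cases "x = 0")
      case False
      define w where "w = cinner (A x) x / complex_of_real ((norm x)\<^sup>2)"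
      have "w \<in> nr_hull" unfolding w_def using rayleigh_in_hull x False by blast
      then have "w \<notin> ball l e" using e(2) by blast
      then have "e \<le> dist l w" by simp
      then have "e/2 \<le> cmod (w - z)"
        using z dist_triangle[of l w z] by (simp add: dist_norm norm_minus_commute)
      then have "e/2 * (norm x)\<^sup>2 \<le> cmod (w - z) * (norm x)\<^sup>2" by (intro mult_right_mono) auto
      also have "\<dots> = cmod ((w - z) * complex_of_real ((norm x)\<^sup>2))" by (simp add: norm_mult norm_power)
      also have "(w - z) * complex_of_real ((norm x)\<^sup>2) = cinner (A x - z *\<^sub>C x) x"
        using False by (simp add: w_def cinner_diff_left cinner_scaleC_left cinner_self left_diff_distrib)
      finally show ?thesis .
    qed simp
  next
    fix z assume "dist l z \<le> e/2"
    then have "z \<in> ball l e" using e(1) by simp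
    then show "z \<notin> nr_hull" using e(2) by blast
  qed (use e in simp)
qed

lemma coercive_at:
  assumes "l \<notin> nr_hull"
  shows "\<exists>c>0. \<forall>x\<in>D. c * (norm x)\<^sup>2 \<le> cmod (cinner (A x - l *\<^sub>C x) x)"
proof -
  from coercive[OF assms] obtain c where c: "c > 0 \<and> (\<forall>z. dist l z \<le> c \<longrightarrow> z \<notin> nr_hull \<and>
    (\<forall>x\<in>D. c * (norm x)\<^sup>2 \<le> cmod (cinner (A x - z *\<^sub>C x) x)))" ..
  then have "dist l l \<le> c" by simp
  with c have "\<forall>x\<in>D. c * (norm x)\<^sup>2 \<le> cmod (cinner (A x - l *\<^sub>C x) x)" by blast
  with c show ?thesis by (intro exI[of _ c] conjI) (rule conjunct1)
qed

lemma shift_bounded_below: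
  assumes "c * (norm x)\<^sup>2 \<le> cmod (cinner (A x - z *\<^sub>C x) x)"
  shows "c * norm x \<le> norm (A x - z *\<^sub>C x)"
proof (cases "x = 0")
  case False
  have "c * norm x * norm x \<le> norm (A x - z *\<^sub>C x) * norm x"
    using order_trans[OF assms cinner_bound] by (simp add: power2_eq_square mult.assoc)
  then show ?thesis using False by simp
qed simp

lemma shift_diff: "x \<in> D \<Longrightarrow> y \<in> D \<Longrightarrow> A x - z *\<^sub>C x - (A y - z *\<^sub>C y) = A (x - y) - z *\<^sub>C (x - y)"
  by (simp add: A_diff scaleC_diff_right)

text \<open>Coercivity makes the range closed. A nonzero \<open>y\<close> orthogonal to it would be
  an eigenvector of \<open>T\<close> for \<open>cnj l\<close>, and its Rayleigh quotient would put
  \<open>cnj l\<close>, then real and equal to \<open>l\<close>, into the hull.\<close>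

lemma shift_surjective:
  assumes "l \<notin> nr_hull"
  obtains x where "x \<in> D" "A x - l *\<^sub>C x = g"
proof -
  obtain c where c: "c > 0" and co': "\<forall>x\<in>D. c * (norm x)\<^sup>2 \<le> cmod (cinner (A x - l *\<^sub>C x) x)"
    using coercive_at[OF assms] by (elim exE conjE)
  note co = co'[rule_format]
  define M where "M = (\<lambda>x. A x - l *\<^sub>C x) ` D"
  have "complex_vector.subspace M"
    unfolding complex_vector.subspace_def
  proof (intro conjI ballI allI)
    show "0 \<in> M" unfolding M_def by (rule image_eqI[of _ _ 0]) (simp_all add: A_0 D_0)
    show "u + v \<in> M" if uv: "u \<in> M" "v \<in> M" for u v
    proof -
      obtain x y where "x \<in> D" "y \<in> D" "u = A x - l *\<^sub>C x" "v = A y - l *\<^sub>C y" using uv unfolding M_def by blast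
      then show ?thesis unfolding M_def
        by (intro image_eqI[of _ _ "x + y"]) (simp_all add: A_add D_add scaleC_add_right)
    qed
    show "b *\<^sub>C u \<in> M" if u: "u \<in> M" for b u
    proof -
      obtain x where "x \<in> D" "u = A x - l *\<^sub>C x" using u unfolding M_def by blast
      then show ?thesis unfolding M_def
        by (intro image_eqI[of _ _ "b *\<^sub>C x"]) (simp_all add: A_scaleC D_scaleC scaleC_diff_right scaleC_scaleC mult.commute)
    qed
  qed
  moreover have "closed M"
    unfolding closed_sequential_limits
  proof (intro allI impI, elim conjE)
    fix u w assume u: "\<forall>n. u n \<in> M" "u \<longlonglongrightarrow> w"
    have "\<forall>n. \<exists>x. x \<in> D \<and> u n = A x - l *\<^sub>C x" using u(1) unfolding M_def by blast
    from choice[OF this] obtain x where "\<forall>n. x n \<in> D \<and> u n = A (x n) - l *\<^sub>C x n" ..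
    then have x: "x n \<in> D" "u n = A (x n) - l *\<^sub>C x n" for n by simp_all
    have "convergent x"
    proof (rule convergent_if_bounded_below[OF c])
      show "c * norm (x m - x k) \<le> norm (u m - u k)" for m k
        unfolding x(2) shift_diff[OF x(1) x(1)]
        by (rule shift_bounded_below[OF co]) (simp add: D_diff x(1))
      show "convergent u" using u(2) by (auto simp: convergent_def)
    qed
    then obtain y where y: "x \<longlonglongrightarrow> y" by (auto simp: convergent_def)
    have "(\<lambda>n. u n + l *\<^sub>C x n) \<longlonglongrightarrow> w + l *\<^sub>C y" by (intro tendsto_intros u(2) y)
    then have "(\<lambda>n. A (x n)) \<longlonglongrightarrow> w + l *\<^sub>C y" by (simp add: x(2))
    from closed_limit[OF x(1) y this] show "w \<in> M" unfolding M_def by (intro image_eqI[of _ _ y]) simp_all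
  qed
  ultimately have "M = UNIV"
  proof (rule_tac ccontr)
    assume M: "complex_vector.subspace M" "closed M" and "M \<noteq> UNIV"
    then obtain y where y: "y \<noteq> 0" "\<And>m. m \<in> M \<Longrightarrow> cinner m y = 0"
      using exists_orthogonal_to_closed_subspace by blast
    have "cinner (A x) y = cinner x (cnj l *\<^sub>C y)" if "x \<in> D" for x
      using y(2)[of "A x - l *\<^sub>C x"] that
      by (simp add: M_def cinner_diff_left cinner_scaleC_left cinner_scaleC_right)
    from in_D_if_adjoint[OF this] have yD: "y \<in> D" "A y = cnj l *\<^sub>C y" by blast+
    have "cnj l \<in> nr_hull" using rayleigh_in_hull[OF yD(1) y(1)] y(1)
      by (simp add: yD(2) cinner_scaleC_left cinner_self)
    then obtain r where "cnj l = complex_of_real r" "r \<in> closure num_range" unfolding nr_hull_def by blast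
    then have "l = complex_of_real r" by (simp add: complex_eq_iff)
    then have "l \<in> nr_hull" unfolding nr_hull_def using \<open>r \<in> closure num_range\<close> by simp
    then show False using assms by blast
  qed
  then have "g \<in> M" by simp
  then show ?thesis using that unfolding M_def by blast
qed

lemma in_resolvent_if_not_hull:
  assumes "l \<notin> nr_hull"
  shows "l \<in> resolvent_set T"
proof -
  obtain c where c: "c > 0" and co': "\<forall>x\<in>D. c * (norm x)\<^sup>2 \<le> cmod (cinner (A x - l *\<^sub>C x) x)"
    using coercive_at[OF assms] by (elim exE conjE)
  note co = co'[rule_format]
  have inj: "inj_on (op_app (op_shift T l)) D"
  proof (rule inj_onI)
    fix x y assume xy: "x \<in> D" "y \<in> D" "op_app (op_shift T l) x = op_app (op_shift T l) y"
    then have "A x - l *\<^sub>C x - (A y - l *\<^sub>C y) = 0" by simp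
    then have "A (x - y) - l *\<^sub>C (x - y) = 0" by (simp only: shift_diff[OF xy(1,2)])
    then have "c * norm (x - y) \<le> 0"
      using shift_bounded_below[OF co[OF D_diff[OF xy(1,2)]]] by simp
    then show "x = y" using c by (simp add: mult_le_0_iff)
  qed
  have "op_app (op_shift T l) ` D = UNIV"
  proof (rule subset_antisym[OF subset_UNIV subsetI])
    fix g :: 'a
    obtain x where "x \<in> D" "A x - l *\<^sub>C x = g" using shift_surjective[OF assms] .
    then show "g \<in> op_app (op_shift T l) ` D" by (intro image_eqI[of _ _ x]) simp_all
  qed
  moreover have "norm x \<le> 1 / c * norm (op_app (op_shift T l) x)" if "x \<in> D" for x
    using shift_bounded_below[OF co[OF that]] c that by (simp add: field_simps)
  ultimately show ?thesis using inj unfolding resolvent_set_def bij_betw_def by blast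
qed

section \<open>Semi-Fredholm shifts and the essential spectra\<close>

lemma semi_fredholm_if_resolvent:
  assumes "z \<in> resolvent_set T"
  shows "semi_fredholm (op_shift T z)"
proof -
  have bij: "bij_betw (op_app (op_shift T z)) D UNIV" using assms by (simp add: resolvent_set_def)
  have "ran (op_shift T z) = UNIV" using bij by (simp add: ran_eq_image bij_betw_def)
  moreover have "op_kernel (op_shift T z) \<subseteq> {0}"
  proof
    fix x assume "x \<in> op_kernel (op_shift T z)"
    then have x: "x \<in> D" "op_app (op_shift T z) x = 0"
      by (auto simp: op_kernel_def op_shift_eq_Some)
    have "op_app (op_shift T z) 0 = 0" using D_0 by (simp add: A_0)
    then show "x \<in> {0}" using bij x D_0 unfolding bij_betw_def inj_on_def by simp
  qed
  then have "finite_dim (op_kernel (op_shift T z))"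
    unfolding finite_dim_def by (intro exI[of _ "{}"]) simp
  ultimately show ?thesis by (simp add: semi_fredholm_def closed_op_shift)
qed

text \<open>An orthonormal sequence in \<open>D\<close> along which \<open>L\<close> tends to zero
  would be a singular sequence at \<open>l\<close> (\<open>no_seq\<close>). This excludes an
  infinite dimensional kernel, and it yields finitely many vectors \<open>g\<close> such that
  \<open>L\<close> is bounded below on their orthogonal complement. As only finitely many directions
  are left, a compactness argument carries the lower bound over to the orthogonal complement of the
  kernel, and the range is closed.\<close>

lemma semi_fredholm_if_not_ess2:
  assumes "l \<notin> ess_spectrum2 T"
  shows "semi_fredholm (op_shift T l)"
proof -
  define L where "L x = A x - l *\<^sub>C x" for x
  have L_diff: "L (x - y) = L x - L y" if "x \<in> D" "y \<in> D" for x y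
    using shift_diff[OF that, of l] by (simp add: L_def)
  have no_seq: False if on: "orthonormal_on f UNIV" and f: "\<And>n. f n \<in> D" "(\<lambda>n. norm (L (f n))) \<longlonglongrightarrow> 0"
    for f :: "nat \<Rightarrow> 'a"
  proof -
    have "range f \<subseteq> D" "\<forall>k. norm (f k) = 1" "weakly_null f"
      using f(1) orthonormal_on_norm[OF on] orthonormal_weakly_null[OF on] by auto
    moreover have "(\<lambda>k. norm (op_app (op_shift T l) (f k))) \<longlonglongrightarrow> 0" using f by (simp add: L_def)
    ultimately have "l \<in> ess_spectrum2 T" unfolding ess_spectrum2_def mem_Collect_eq by (intro exI[of _ f] conjI)
    with assms show False ..
  qed
  define N where "N = op_kernel (op_shift T l)"
  have N: "x \<in> N \<longleftrightarrow> x \<in> D \<and> L x = 0" for x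
    unfolding N_def op_kernel_def mem_Collect_eq op_shift_eq_Some L_def by (simp only: eq_commute[of 0])
  have "complex_vector.subspace N"
    by (rule complex_vector.subspaceI)
       (auto simp: N L_def D_0 A_0 D_add A_add D_scaleC A_scaleC scaleC_add_right scaleC_scaleC mult.commute)
  then obtain f n where f: "orthonormal_on f {..<n::nat}" "complex_vector.span (f ` {..<n}) = N"
  proof (cases rule: subspace_orthonormal_dichotomy)
    case (infinite f)
    have f: "f n \<in> D" "L (f n) = 0" for n using subsetD[OF infinite(2), of "f n"] by (simp_all add: N)
    have False by (rule no_seq[OF infinite(1) f(1)]) (simp add: f(2))
    then show ?thesis ..
  next
    case (finite f n)
    then show ?thesis by (rule that)
  qed
  define Q where "Q = oproj f {..<n}"
  have Q: "Q x \<in> N" for x unfolding Q_def using oproj_in_span[of "{..<n}" f x] f by simp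
  have Q_orth: "cinner (x - Q x) y = 0" if "y \<in> N" for x y
    unfolding Q_def by (rule cinner_diff_oproj) (use f that in simp_all)
  \<comment> \<open>The length \<open>m\<close> of the family also fixes the bound
    \<open>1 / (m + 1)\<close>. If no family worked, then a family of length \<open>n\<close> could
    always be prolonged by a unit vector \<open>r\<close> with \<open>norm (L r)\<close> at most
    \<open>1 / (n + 1)\<close>, and a singular sequence would arise.\<close>
  have "\<exists>g m. orthonormal_on g {..<m::nat} \<and> (\<forall>j<m. g j \<in> D) \<and>
    (\<forall>r. r \<in> D \<longrightarrow> norm r = 1 \<longrightarrow> (\<forall>j<m. cinner r (g j) = 0) \<longrightarrow> 1 / real (Suc m) < norm (L r))"
  proof (rule ccontr)
    assume *: "\<not> ?thesis"
    obtain f where f: "orthonormal_on f UNIV" "\<And>n. f n \<in> D \<and> norm (L (f n)) \<le> 1 / real (Suc n)"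
    proof (rule orthonormal_sequence_choice[where Q = "\<lambda>n r. r \<in> D \<and> norm (L r) \<le> 1 / real (Suc n)"])
      fix f and n :: nat
      assume f: "orthonormal_on f {..<n}" "\<And>j. j < n \<Longrightarrow> f j \<in> D \<and> norm (L (f j)) \<le> 1 / real (Suc j)"
      show "\<exists>r. (r \<in> D \<and> norm (L r) \<le> 1 / real (Suc n)) \<and> norm r = 1 \<and> (\<forall>j<n. cinner r (f j) = 0)"
      proof -
        have "\<not> (\<forall>r. r \<in> D \<longrightarrow> norm r = 1 \<longrightarrow> (\<forall>j<n. cinner r (f j) = 0) \<longrightarrow> 1 / real (Suc n) < norm (L r))"
        proof
          assume below: "\<forall>r. r \<in> D \<longrightarrow> norm r = 1 \<longrightarrow> (\<forall>j<n. cinner r (f j) = 0) \<longrightarrow> 1 / real (Suc n) < norm (L r)"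
          have "\<forall>j<n. f j \<in> D" using f(2) by simp
          with f(1) below have "orthonormal_on f {..<n} \<and> (\<forall>j<n. f j \<in> D) \<and>
            (\<forall>r. r \<in> D \<longrightarrow> norm r = 1 \<longrightarrow> (\<forall>j<n. cinner r (f j) = 0) \<longrightarrow> 1 / real (Suc n) < norm (L r))"
            by (intro conjI)
          then have "\<exists>g m. orthonormal_on g {..<m::nat} \<and> (\<forall>j<m. g j \<in> D) \<and>
            (\<forall>r. r \<in> D \<longrightarrow> norm r = 1 \<longrightarrow> (\<forall>j<m. cinner r (g j) = 0) \<longrightarrow> 1 / real (Suc m) < norm (L r))"
            by (rule_tac exI[of _ f], rule_tac exI[of _ n])
          with * show False by contradiction
        qed
        then obtain r where "r \<in> D" "norm r = 1" "\<forall>j<n. cinner r (f j) = 0" "\<not> 1 / real (Suc n) < norm (L r)"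
          by (simp only: not_all not_imp) (elim exE conjE)
        then show ?thesis by (intro exI[of _ r]) simp
      qed
    qed (rule that)
    have "(\<lambda>n. norm (L (f n))) \<longlonglongrightarrow> 0"
    proof (rule tendsto_sandwich[of "\<lambda>_. 0" _ _ "\<lambda>n. 1 / real (Suc n)"])
      show "(\<lambda>n. 1 / real (Suc n)) \<longlonglongrightarrow> 0"
        using LIMSEQ_inverse_real_of_nat by (simp add: inverse_eq_divide)
      show "\<forall>\<^sub>F n in sequentially. norm (L (f n)) \<le> 1 / real (Suc n)"
        using f(2) by (intro always_eventually allI) blast
    qed simp_all
    then show False by (rule no_seq[OF f(1) conjunct1[OF f(2)]])
  qed
  then obtain g m where g1: "orthonormal_on g {..<m::nat}" and g2: "\<forall>j<m. g j \<in> D"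
    and below': "\<forall>r. r \<in> D \<longrightarrow> norm r = 1 \<longrightarrow> (\<forall>j<m. cinner r (g j) = 0) \<longrightarrow> 1 / real (Suc m) < norm (L r)"
    by (elim exE conjE)
  have g: "orthonormal_on g {..<m}" "j < m \<Longrightarrow> g j \<in> D" for j using g1 g2 by simp_all
  have below: "1 / real (Suc m) < norm (L r)" if "r \<in> D" "norm r = 1" "\<forall>j<m. cinner r (g j) = 0" for r
    by (rule below'[rule_format, OF that(1,2)]) (rule that(3)[rule_format])
  define c where "c = 1 / real (Suc m)"
  have c: "c > 0" by (simp add: c_def)
  define P where "P = oproj g {..<m}"
  have P: "P x \<in> D" for x
    unfolding P_def oproj_def by (intro D_sum D_scaleC) (use g(2) in auto)
  have LP: "L (P x) = (\<Sum>j<m. cinner x (g j) *\<^sub>C L (g j))" for x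
  proof -
    have "A (P x) = (\<Sum>j<m. cinner x (g j) *\<^sub>C A (g j))"
      unfolding P_def oproj_def by (subst A_sum) (use g(2) in \<open>auto intro!: D_scaleC sum.cong simp: A_scaleC\<close>)
    then show ?thesis unfolding L_def P_def oproj_def
      by (simp add: scaleC_diff_right sum_subtractf complex_vector.scale_sum_right scaleC_scaleC mult.commute)
  qed
  have L_below: "c * norm r \<le> norm (L r)" if r: "r \<in> D" "\<forall>j<m. cinner r (g j) = 0" for r
  proof (cases "r = 0")
    case True then show ?thesis by simp
  next
    case False
    define u where "u = complex_of_real (1 / norm r) *\<^sub>C r"
    have "u \<in> D" "norm u = 1" "\<forall>j<m. cinner u (g j) = 0"
      using r False by (simp_all add: u_def D_scaleC norm_divide cinner_scaleC_left)
    then have "c < norm (L u)" unfolding c_def by (rule below)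
    moreover have "L u = complex_of_real (1 / norm r) *\<^sub>C L r"
      using r(1) by (simp add: L_def u_def A_scaleC scaleC_diff_right scaleC_scaleC mult.commute)
    ultimately show ?thesis using False by (simp add: norm_divide field_simps)
  qed
  have ker_below: "\<exists>d>0. \<forall>x\<in>D. (\<forall>y\<in>N. cinner x y = 0) \<longrightarrow> d * norm x \<le> norm (L x)"
  proof (rule ccontr)
    assume no: "\<not> ?thesis"
    have "\<forall>k. \<exists>x. x \<in> D \<and> (\<forall>y\<in>N. cinner x y = 0) \<and> norm x = 1 \<and> norm (L x) \<le> 1 / real (Suc k)"
    proof
      fix k
      have "1 / real (Suc k) > 0" by simp
      with no have "\<not> (\<forall>x\<in>D. (\<forall>y\<in>N. cinner x y = 0) \<longrightarrow> 1 / real (Suc k) * norm x \<le> norm (L x))"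
        by (rule_tac notI) (elim notE, intro exI conjI)
      then obtain x where "x \<in> D" and x': "\<not> ((\<forall>y\<in>N. cinner x y = 0) \<longrightarrow> 1 / real (Suc k) * norm x \<le> norm (L x))"
        unfolding ball_simps by (rule bexE)
      then have x: "x \<in> D" "\<forall>y\<in>N. cinner x y = 0" "norm (L x) < 1 / real (Suc k) * norm x"
        by simp_all
      have x0: "x \<noteq> 0"
      proof
        assume "x = 0"
        with x(3) have "norm (L x) < 0" by simp
        then show False by simp
      qed
      define u where "u = complex_of_real (1 / norm x) *\<^sub>C x"
      have "L u = complex_of_real (1 / norm x) *\<^sub>C L x"
        using x(1) by (simp add: L_def u_def A_scaleC scaleC_diff_right scaleC_scaleC mult.commute)
      then have "norm (L u) \<le> 1 / real (Suc k)"
        using x(3) x0 by (simp add: norm_divide field_simps)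
      moreover have "u \<in> D" "norm u = 1" "\<forall>y\<in>N. cinner u y = 0"
        using x x0 by (simp_all add: u_def D_scaleC norm_divide cinner_scaleC_left)
      ultimately show "\<exists>x. x \<in> D \<and> (\<forall>y\<in>N. cinner x y = 0) \<and> norm x = 1 \<and> norm (L x) \<le> 1 / real (Suc k)"
        by blast
    qed
    from choice[OF this] obtain y where y': "\<forall>k. y k \<in> D \<and> (\<forall>w\<in>N. cinner (y k) w = 0) \<and> norm (y k) = 1 \<and>
      norm (L (y k)) \<le> 1 / real (Suc k)" ..
    have y: "y k \<in> D" "w \<in> N \<Longrightarrow> cinner (y k) w = 0" "norm (y k) = 1" "norm (L (y k)) \<le> 1 / real (Suc k)" for k w
      using y'[rule_format, of k] by simp_all
    have Ly: "(\<lambda>k. L (y k)) \<longlonglongrightarrow> 0"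
    proof (rule tendsto_norm_zero_cancel, rule tendsto_sandwich[of "\<lambda>_. 0" _ _ "\<lambda>n. 1 / real (Suc n)"])
      show "(\<lambda>n. 1 / real (Suc n)) \<longlonglongrightarrow> 0"
        using LIMSEQ_inverse_real_of_nat by (simp add: inverse_eq_divide)
    qed (use y(4) in simp_all)
    obtain r where r: "strict_mono (r::nat \<Rightarrow> nat)" "\<And>j. j \<in> {..<m} \<Longrightarrow> convergent (\<lambda>k. cinner (y (r k)) (g j))"
    proof (rule bounded_coordinates_convergent_subseq[where c = "\<lambda>k j. cinner (y k) (g j)" and I = "{..<m}" and B = 1])
      show "cmod (cinner (y k) (g j)) \<le> 1" if "j \<in> {..<m}" for k j
        using cinner_bound[of "y k" "g j"] y(3) orthonormal_on_norm[OF g(1) that] by simp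
    qed auto
    define b where "b j = lim (\<lambda>k. cinner (y (r k)) (g j))" for j
    have b: "(\<lambda>k. cinner (y (r k)) (g j)) \<longlonglongrightarrow> b j" if "j \<in> {..<m}" for j
      using r(2)[OF that] unfolding b_def convergent_LIMSEQ_iff .
    have PL: "(\<lambda>k. P (y (r k))) \<longlonglongrightarrow> (\<Sum>j<m. b j *\<^sub>C g j)"
      unfolding P_def oproj_def by (intro tendsto_intros b)
    have LPL: "(\<lambda>k. L (P (y (r k)))) \<longlonglongrightarrow> (\<Sum>j<m. b j *\<^sub>C L (g j))"
      unfolding LP by (intro tendsto_intros b)
    have Lyr: "(\<lambda>k. L (y (r k))) \<longlonglongrightarrow> 0" using LIMSEQ_subseq_LIMSEQ[OF Ly r(1)] by (simp add: o_def)
    \<comment> \<open>The part of \<open>y (r k)\<close> orthogonal to \<open>g\<close>, where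
      \<open>L\<close> is bounded below. Its image converges because \<open>L (y (r k))\<close> and
      \<open>L (P (y (r k)))\<close> do.\<close>
    define x where "x k = y (r k) - P (y (r k))" for k
    have xD: "x k \<in> D" for k unfolding x_def by (intro D_diff y P)
    have "convergent x"
    proof (rule convergent_if_bounded_below[OF c])
      have Lx: "L (x k) = L (y (r k)) - L (P (y (r k)))" for k unfolding x_def by (rule L_diff[OF y(1) P])
      show "convergent (\<lambda>k. L (x k))" unfolding Lx convergent_def using tendsto_diff[OF Lyr LPL] by blast
      fix i k
      have "cinner (x i) (g j) = 0" if "j < m" for i j
        unfolding x_def P_def by (rule cinner_diff_oproj) (use g that in \<open>auto intro: complex_vector.span_base\<close>)
      then show "c * norm (x i - x k) \<le> norm (L (x i) - L (x k))"
        unfolding L_diff[OF xD xD, symmetric] by (intro L_below D_diff xD) (simp add: cinner_diff_left)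
    qed
    then obtain x0 where "x \<longlonglongrightarrow> x0" by (auto simp: convergent_def)
    from tendsto_add[OF this PL] obtain y0 where y0: "(\<lambda>k. y (r k)) \<longlonglongrightarrow> y0" by (auto simp: x_def)
    have "(\<lambda>k. L (y (r k)) + l *\<^sub>C y (r k)) \<longlonglongrightarrow> 0 + l *\<^sub>C y0" by (intro tendsto_intros Lyr y0)
    then have "(\<lambda>k. A (y (r k))) \<longlonglongrightarrow> l *\<^sub>C y0" by (simp add: L_def)
    from closed_limit[OF y(1) y0 this] have "y0 \<in> N" by (simp add: N L_def)
    \<comment> \<open>The limit \<open>y0\<close> lies in the kernel and, as a limit of vectors
      orthogonal to the kernel, is orthogonal to itself, yet it has norm \<open>1\<close>.\<close>
    have "(\<lambda>k. cinner (y (r k)) y0) \<longlonglongrightarrow> cinner y0 y0" by (intro tendsto_intros y0)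
    then have "cinner y0 y0 = 0" using y(2)[OF \<open>y0 \<in> N\<close>] by (simp add: LIMSEQ_const_iff)
    moreover have "(\<lambda>k. norm (y (r k))) \<longlonglongrightarrow> norm y0" by (intro tendsto_intros y0)
    then have "norm y0 = 1" using y(3) by (simp add: LIMSEQ_const_iff)
    ultimately show False by (simp add: cinner_self)
  qed
  from ker_below obtain d where d': "d > 0 \<and> (\<forall>x\<in>D. (\<forall>y\<in>N. cinner x y = 0) \<longrightarrow> d * norm x \<le> norm (L x))" ..
  have d: "d > 0" by (rule conjunct1[OF d'])
  have dL: "d * norm x \<le> norm (L x)" if "x \<in> D" "\<forall>y\<in>N. cinner x y = 0" for x
    by (rule mp[OF bspec[OF conjunct2[OF d'] that(1)] that(2)])
  have ran: "ran (op_shift T l) = L ` D"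
    unfolding ran_eq_image dom_op_shift by (intro image_cong) (simp_all add: L_def)
  have "closed (L ` D)"
    unfolding closed_sequential_limits
  proof (intro allI impI, elim conjE)
    fix u w assume u: "\<forall>k. u k \<in> L ` D" "u \<longlonglongrightarrow> w"
    have "\<forall>k. \<exists>x. x \<in> D \<and> u k = L x" using u(1) by blast
    from choice[OF this] obtain y where "\<forall>k. y k \<in> D \<and> u k = L (y k)" ..
    then have y: "y k \<in> D" "u k = L (y k)" for k by simp_all
    define x where "x k = y k - Q (y k)" for k
    have QD: "Q v \<in> D" "L (Q v) = 0" for v using Q[of v] by (simp_all add: N)
    have xD: "x k \<in> D" for k unfolding x_def by (intro D_diff y QD)
    have Lx: "L (x k) = u k" for k unfolding x_def by (simp add: L_diff[OF y(1) QD(1)] QD(2) y(2))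
    have "convergent x"
    proof (rule convergent_if_bounded_below[OF d])
      show "convergent u" using u(2) by (auto simp: convergent_def)
      fix i k
      have "cinner (x i) v = 0" if "v \<in> N" for v i unfolding x_def by (rule Q_orth[OF that])
      then show "d * norm (x i - x k) \<le> norm (u i - u k)"
        unfolding Lx[symmetric] L_diff[OF xD xD, symmetric] by (intro dL D_diff xD) (simp add: cinner_diff_left)
    qed
    then obtain x0 where x0: "x \<longlonglongrightarrow> x0" by (auto simp: convergent_def)
    have "A (x k) = u k + l *\<^sub>C x k" for k using Lx[of k] unfolding L_def by (simp only: diff_eq_eq)
    moreover have "(\<lambda>k. u k + l *\<^sub>C x k) \<longlonglongrightarrow> w + l *\<^sub>C x0" by (intro tendsto_intros u(2) x0)
    ultimately have "(\<lambda>k. A (x k)) \<longlonglongrightarrow> w + l *\<^sub>C x0" by simp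
    from closed_limit[OF xD x0 this] show "w \<in> L ` D"
      by (intro image_eqI[of _ _ x0]) (simp_all add: L_def)
  qed
  moreover have "finite_dim N" unfolding finite_dim_def by (intro exI[of _ "f ` {..<n}"]) (simp add: f(2))
  ultimately show ?thesis unfolding semi_fredholm_def ran N_def[symmetric] using closed_op_shift by simp
qed

text \<open>The segment from \<open>r\<close> to \<open>r + i\<close> meets the real line only in
  \<open>r\<close>, and its other points are in the resolvent set. If \<open>T - r\<close> were
  semi-Fredholm, the segment would join \<open>r\<close> to the resolvent set inside the
  semi-Fredholm region.\<close>

lemma ess5_subset_ess2:
  assumes "complex_of_real r \<in> ess_spectrum5 T"
  shows "complex_of_real r \<in> ess_spectrum2 T"
proof (rule ccontr)
  assume "complex_of_real r \<notin> ess_spectrum2 T"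
  then have sf: "semi_fredholm (op_shift T (complex_of_real r))" by (rule semi_fredholm_if_not_ess2)
  let ?C = "closed_segment (complex_of_real r) (Complex r 1)"
  have Im: "u = complex_of_real r \<or> u \<in> resolvent_set T" if u: "u \<in> ?C" for u
  proof (cases "Im u = 0")
    case True
    obtain t where t: "u = (1 - t) *\<^sub>R complex_of_real r + t *\<^sub>R Complex r 1" using u by (auto simp: closed_segment_def)
    have "Im u = t" "Re u = r" unfolding t by (simp_all add: left_diff_distrib)
    then show ?thesis using True by (simp add: complex_eq_iff)
  next
    case False
    then have "u \<notin> nr_hull" unfolding nr_hull_def by auto
    then show ?thesis using in_resolvent_if_not_hull by blast
  qed
  have "Complex r 1 \<notin> nr_hull" unfolding nr_hull_def by (auto simp: complex_eq_iff)
  have "complex_of_real r \<in> Delta5 T"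
  proof (rule Delta5_if_connected[of ?C _ "Complex r 1"])
    show "Complex r 1 \<in> resolvent_set T"
      by (rule in_resolvent_if_not_hull) fact
    show "semi_fredholm (op_shift T u)" if "u \<in> ?C" for u
      using Im[OF that] sf semi_fredholm_if_resolvent by blast
  qed simp_all
  then show False using assms by (simp add: ess_spectrum5_def)
qed

text \<open>The sign \<open>s\<close> selects the lower or the upper end \<open>a\<close> of the
  numerical range, so that the form \<open>B\<close> of \<open>s (T - a)\<close> is nonnegative.
  Were \<open>a\<close> in the resolvent set, a near minimizer \<open>x\<close> would have a
  preimage \<open>y\<close> of controlled norm, and \<open>B\<close> would be negative at a suitable
  \<open>x + t y\<close>.\<close>

lemma endpoint_in_spectrum:
  fixes s a :: real
  assumes s: "s = 1 \<or> s = -1"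
    and pos: "\<And>x. x \<in> D \<Longrightarrow> 0 \<le> s * (Re (cinner (A x) x) - a * (norm x)\<^sup>2)"
    and inf: "\<And>e. e > 0 \<Longrightarrow> \<exists>x. x \<in> D \<and> norm x = 1 \<and> s * (Re (cinner (A x) x) - a) < e"
  shows "complex_of_real a \<in> spectrum T"
proof (rule ccontr)
  assume "complex_of_real a \<notin> spectrum T"
  then have res: "complex_of_real a \<in> resolvent_set T" by (simp add: spectrum_def)
  then obtain K where K: "\<And>x. x \<in> D \<Longrightarrow> norm x \<le> K * norm (op_app (op_shift T (complex_of_real a)) x)"
    unfolding resolvent_set_def by blast
  define M where "M = max K 1"
  have M: "M > 0" by (simp add: M_def)
  obtain x where x: "x \<in> D" "norm x = 1" "s * (Re (cinner (A x) x) - a) < 1 / M"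
    using inf[of "1 / M"] M by auto
  have "x \<in> op_app (op_shift T (complex_of_real a)) ` D"
    using res unfolding resolvent_set_def bij_betw_def by simp
  then obtain y where y: "y \<in> D" "x = A y - complex_of_real a *\<^sub>C y" by auto
  have "norm y \<le> K * norm x" using K[OF y(1)] y by simp
  then have ny: "norm y \<le> M" using x(2) by (simp add: M_def)
  define B where "B u v = s * Re (cinner (A u - complex_of_real a *\<^sub>C u) v)" for u v
  have ss: "s * s = 1" using s by auto
  have Bpos: "0 \<le> B u u" if "u \<in> D" for u
    using pos[OF that] by (simp add: B_def cinner_diff_left cinner_scaleC_left cinner_self)
  have Byx: "B y x = s" by (simp add: B_def y(2)[symmetric] cinner_self x(2))
  have Bxy: "B x y = s"
  proof -
    have "cinner (A x - complex_of_real a *\<^sub>C x) y = cinner x (A y - complex_of_real a *\<^sub>C y)"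
      by (simp add: cinner_diff_left cinner_diff_right symmetric[OF x(1) y(1)] cinner_scaleC_left cinner_scaleC_right)
    then show ?thesis by (simp add: B_def y(2)[symmetric] cinner_self x(2))
  qed
  have Byy: "B y y \<le> M"
  proof -
    have "B y y \<le> \<bar>Re (cinner x y)\<bar>" using s by (auto simp: B_def y(2)[symmetric])
    also have "\<dots> \<le> cmod (cinner x y)" by (rule abs_Re_le_cmod)
    also have "\<dots> \<le> norm x * norm y" by (rule cinner_bound)
    finally show ?thesis using ny x(2) by simp
  qed
  \<comment> \<open>This minimizes \<open>B x x + 2 * t * s + t * t * M\<close>, an upper bound for
    the form at \<open>x + t y\<close>; the minimum is \<open>B x x - 1 / M\<close>.\<close>
  define t where "t = - s / M"
  have "B (x + complex_of_real t *\<^sub>C y) (x + complex_of_real t *\<^sub>C y) = B x x + t * B x y + t * B y x + t * t * B y y"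
    unfolding B_def A_add[OF x(1) D_scaleC[OF y(1)]] A_scaleC[OF y(1)]
    by (simp add: cinner_add_left cinner_add_right cinner_diff_left cinner_scaleC_left cinner_scaleC_right scaleC_add_right
        algebra_simps)
  then have "0 \<le> B x x + t * s + t * s + t * t * B y y"
    using Bpos[OF D_add[OF x(1) D_scaleC[OF y(1)]], of "complex_of_real t"] Bxy Byx by simp
  also have "\<dots> \<le> B x x + t * s + t * s + t * t * M"
    using Byy by (intro add_left_mono mult_left_mono) auto
  also have "\<dots> = B x x - 1 / M" using M ss by (simp add: t_def field_simps)
  finally have "1 / M \<le> B x x" by simp
  moreover have "B x x = s * (Re (cinner (A x) x) - a)"
    by (simp add: B_def cinner_diff_left cinner_scaleC_left cinner_self x(2))
  ultimately show False using x(3) by simp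
qed

lemma rayleigh_le:
  assumes "\<And>r. r \<in> num_range \<Longrightarrow> s * r \<le> b" "x \<in> D"
  shows "s * Re (cinner (A x) x) \<le> b * (norm x)\<^sup>2"
proof (cases "x = 0")
  case True then show ?thesis by (simp add: A_0)
next
  case False
  define u where "u = complex_of_real (1 / norm x) *\<^sub>C x"
  have u: "u \<in> D" "norm u = 1" using assms(2) False by (simp_all add: u_def D_scaleC norm_divide)
  then have "s * Re (cinner (A u) u) \<le> b" using assms(1) unfolding num_range_def by blast
  moreover have "cinner (A u) u = cinner (A x) x / complex_of_real ((norm x)\<^sup>2)"
    using assms False by (simp add: u_def A_scaleC cinner_scaleC_left cinner_scaleC_right power2_eq_square)
  moreover have "Re (cinner (A x) x / complex_of_real ((norm x)\<^sup>2)) = Re (cinner (A x) x) / (norm x)\<^sup>2"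
    by (rule Re_divide_of_real)
  ultimately have "s * (Re (cinner (A x) x) / (norm x)\<^sup>2) \<le> b" by simp
  then show ?thesis using False by (simp add: field_simps)
qed

text \<open>A finite end of the numerical range lies in the spectrum, hence in
  \<open>ess_spectrum5 T\<close> and, being real, in \<open>ess_spectrum2 T\<close>. An infinite end
  belongs to the extended essential spectrum by definition, and convexity supplies everything in
  between.\<close>

lemma hull_subset_ess2:
  assumes spec: "spectrum T = ess_spectrum5 T" and convex: "ereal_convex (ext_ess_spectrum T)"
  shows "nr_hull \<subseteq> ess_spectrum2 T"
proof
  fix z assume "z \<in> nr_hull"
  then obtain r where r: "z = complex_of_real r" "r \<in> closure num_range" unfolding nr_hull_def by blast
  then have ne: "num_range \<noteq> {}" by auto
  have upper: "\<exists>b\<in>ext_ess_spectrum T. ereal r \<le> b"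
  proof (cases "bounded_above_op T")
    case True
    then obtain c where c: "\<And>x. x \<in> D \<Longrightarrow> Re (cinner (A x) x) \<le> c * (norm x)\<^sup>2"
      unfolding bounded_above_op_def by blast
    have bdd: "bdd_above num_range" unfolding num_range_def using c by (intro bdd_aboveI[of _ c]) force
    define b where "b = Sup num_range"
    have le: "v \<le> b" if "v \<in> num_range" for v unfolding b_def by (rule cSup_upper[OF that bdd])
    have "complex_of_real b \<in> spectrum T"
    proof (rule endpoint_in_spectrum[of "-1"])
      show "0 \<le> - 1 * (Re (cinner (A x) x) - b * (norm x)\<^sup>2)" if "x \<in> D" for x
        using rayleigh_le[of 1 b x] le that by simp
      fix e :: real assume "e > 0"
      then obtain v where "v \<in> num_range" "b - e < v"
        using less_cSup_iff[OF ne bdd, of "b - e"] unfolding b_def by auto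
      then show "\<exists>x. x \<in> D \<and> norm x = 1 \<and> - 1 * (Re (cinner (A x) x) - b) < e"
        unfolding num_range_def by auto
    qed simp
    then have "complex_of_real b \<in> ess_spectrum2 T" unfolding spec by (rule ess5_subset_ess2)
    then have "ereal b \<in> ext_ess_spectrum T" unfolding ext_ess_spectrum_def by blast
    moreover have "closure num_range \<subseteq> {..b}" by (rule closure_minimal) (use le in auto)
    ultimately show ?thesis using r(2) by (intro bexI[of _ "ereal b"]) auto
  next
    case False
    then have "\<infinity> \<in> ext_ess_spectrum T" unfolding ext_ess_spectrum_def by simp
    then show ?thesis by (rule bexI[rotated]) simp
  qed
  have lower: "\<exists>a\<in>ext_ess_spectrum T. a \<le> ereal r"
  proof (cases "bounded_below_op T")
    case True
    then obtain c where c: "\<And>x. x \<in> D \<Longrightarrow> c * (norm x)\<^sup>2 \<le> Re (cinner (A x) x)"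
      unfolding bounded_below_op_def by blast
    have bdd: "bdd_below num_range" unfolding num_range_def using c by (intro bdd_belowI[of _ c]) force
    define b where "b = Inf num_range"
    have le: "b \<le> v" if "v \<in> num_range" for v unfolding b_def by (rule cInf_lower[OF that bdd])
    have "complex_of_real b \<in> spectrum T"
    proof (rule endpoint_in_spectrum[of 1])
      show "0 \<le> 1 * (Re (cinner (A x) x) - b * (norm x)\<^sup>2)" if "x \<in> D" for x
        using rayleigh_le[of "-1" "-b" x] le that by simp
      fix e :: real assume "e > 0"
      then obtain v where "v \<in> num_range" "v < b + e"
        using cInf_less_iff[OF ne bdd, of "b + e"] unfolding b_def by auto
      then show "\<exists>x. x \<in> D \<and> norm x = 1 \<and> 1 * (Re (cinner (A x) x) - b) < e"
        unfolding num_range_def by auto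
    qed simp
    then have "complex_of_real b \<in> ess_spectrum2 T" unfolding spec by (rule ess5_subset_ess2)
    then have "ereal b \<in> ext_ess_spectrum T" unfolding ext_ess_spectrum_def by blast
    moreover have "closure num_range \<subseteq> {b..}" by (rule closure_minimal) (use le in auto)
    ultimately show ?thesis using r(2) by (intro bexI[of _ "ereal b"]) auto
  next
    case False
    then have "-\<infinity> \<in> ext_ess_spectrum T" unfolding ext_ess_spectrum_def by simp
    then show ?thesis by (rule bexI[rotated]) simp
  qed
  have "ereal r \<in> ext_ess_spectrum T"
    using upper lower convex unfolding ereal_convex_def by blast
  then show "z \<in> ess_spectrum2 T"
    unfolding ext_ess_spectrum_def r(1) by (auto split: if_splits)
qed

end

subsection \<open>Galerkin approximation of a relatively compact perturbation\<close>

locale galerkin = selfadjoint T for T :: "'a::complex_hilbert unbounded_op" +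
  fixes V :: "'a unbounded_op" and Hs :: "nat \<Rightarrow> 'a set" and f :: "nat \<Rightarrow> nat \<Rightarrow> 'a" and d :: "nat \<Rightarrow> nat"
  assumes admissible: "admissible_decomposition Hs T V"
    and Hs_Suc: "\<And>n. Hs n \<subseteq> Hs (Suc n)"
    and basis: "\<And>n. orthonormal_on (f n) {..<d n}"
    and span_basis: "\<And>n. complex_vector.span (f n ` {..<d n}) = Hs n"
begin

definition B where "B = op_app V"
definition H where "H x = A x + B x"
definition eigen :: "complex \<Rightarrow> bool" where "eigen l \<longleftrightarrow> (\<exists>x. x \<in> D \<and> norm x = 1 \<and> H x = l *\<^sub>C x)"
text \<open>On \<open>Hs n\<close> this is the compression of \<open>H - z\<close>. In the matrix
  \<open>entry n\<close> of the compression of \<open>H\<close> the column index belongs to the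
  first argument of the inner product.\<close>

definition G :: "nat \<Rightarrow> complex \<Rightarrow> 'a \<Rightarrow> 'a" where "G n z x = oproj (f n) {..<d n} (H x - z *\<^sub>C x)"
definition entry where "entry n i j = cinner (H (f n j)) (f n i)"
definition chp where "chp n z = charpoly (d n) (entry n) z"

lemma bounded_V: "bounded_op V" and compact_V: "relatively_compact T V"
  and compact_V_adj: "relatively_compact T (op_adjoint V)" and core: "core_of (\<Union>n. Hs n) T"
  and semibounded: "semibounded_op T"
  using admissible by (simp_all add: admissible_decomposition_def)

lemma B_add: "B (x + y) = B x + B y" and B_scaleC: "B (c *\<^sub>C x) = c *\<^sub>C B x"
  using bounded_V by (simp_all add: bounded_op_def linear_op_def B_def)

lemma B_diff: "B (x - y) = B x - B y"
  using B_add[of "x - y" y] by simp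

lemma B_0: "B 0 = 0"
  using B_diff[of 0 0] by simp

lemma B_bound: "\<exists>K>0. \<forall>x. norm (B x) \<le> K * norm x"
proof -
  obtain K where K: "\<forall>x. norm (op_app V x) \<le> K * norm x" using bounded_V unfolding bounded_op_def by (elim conjE exE)
  have "norm (B x) \<le> (\<bar>K\<bar> + 1) * norm x" for x
  proof -
    have "norm (B x) \<le> K * norm x" using K by (simp add: B_def)
    also have "\<dots> \<le> (\<bar>K\<bar> + 1) * norm x" by (intro mult_right_mono) auto
    finally show ?thesis .
  qed
  then show ?thesis by (intro exI[of _ "\<bar>K\<bar> + 1"]) simp
qed

definition K where "K = (SOME K. K > 0 \<and> (\<forall>x. norm (B x) \<le> K * norm x))"

lemma K_pos: "K > 0" and norm_B: "norm (B x) \<le> K * norm x"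
  using someI_ex[OF B_bound] unfolding K_def by simp_all

lemma tendsto_B: "x \<longlonglongrightarrow> l \<Longrightarrow> (\<lambda>n. B (x n)) \<longlonglongrightarrow> B l"
proof -
  assume x: "x \<longlonglongrightarrow> l"
  have "(\<lambda>n. norm (B (x n) - B l)) \<longlonglongrightarrow> 0"
  proof (rule tendsto_sandwich[of "\<lambda>_. 0" _ _ "\<lambda>n. K * norm (x n - l)"])
    show "\<forall>\<^sub>F n in sequentially. norm (B (x n) - B l) \<le> K * norm (x n - l)"
      unfolding B_diff[symmetric] by (intro always_eventually allI norm_B)
    have "(\<lambda>n. K * norm (x n - l)) \<longlonglongrightarrow> K * norm (l - l)" by (intro tendsto_intros x)
    then show "(\<lambda>n. K * norm (x n - l)) \<longlonglongrightarrow> 0" by simp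
  qed simp_all
  then show ?thesis by (rule LIM_zero_cancel[OF tendsto_norm_zero_cancel])
qed

lemma H_add: "x \<in> D \<Longrightarrow> y \<in> D \<Longrightarrow> H (x + y) = H x + H y"
  and H_scaleC: "x \<in> D \<Longrightarrow> H (c *\<^sub>C x) = c *\<^sub>C H x"
  and H_diff: "x \<in> D \<Longrightarrow> y \<in> D \<Longrightarrow> H (x - y) = H x - H y"
  by (simp_all add: H_def A_add A_scaleC A_diff B_add B_scaleC B_diff scaleC_add_right)

lemma H_0: "H 0 = 0"
  by (simp add: H_def A_0 B_0)

lemma H_sum: "(\<And>i. i \<in> I \<Longrightarrow> x i \<in> D) \<Longrightarrow> H (\<Sum>i\<in>I. x i) = (\<Sum>i\<in>I. H (x i))"
  by (induction I rule: infinite_finite_induct) (auto simp: H_0 H_add D_sum)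

lemma Hs_mono: "m \<le> n \<Longrightarrow> Hs m \<subseteq> Hs n"
  by (rule lift_Suc_mono_le[of Hs]) (rule Hs_Suc)

lemma Hs_subspace: "complex_vector.subspace (Hs n)"
  unfolding span_basis[symmetric] by (rule complex_vector.subspace_span)

lemma Hs_D: "x \<in> Hs n \<Longrightarrow> x \<in> D"
  using core unfolding core_of_def by blast

lemma f_Hs: "j < d n \<Longrightarrow> f n j \<in> Hs n"
  unfolding span_basis[symmetric] by (intro complex_vector.span_base imageI) simp

lemma core_approx:
  assumes "x \<in> D" "\<epsilon> > 0"
  obtains y n where "y \<in> Hs n" "norm (x - y) < \<epsilon>" "norm (A x - A y) < \<epsilon>"
proof -
  have "(x, A x) \<in> Map.graph T" using assms(1) by (auto simp: Map.graph_def)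
  then have "(x, A x) \<in> closure (Map.graph (T |` (\<Union>n. Hs n)))" using core by (simp add: core_of_def)
  then obtain p where p: "p \<in> Map.graph (T |` (\<Union>n. Hs n))" "dist p (x, A x) < \<epsilon>"
    using assms(2) unfolding closure_approachable by (elim allE impE bexE)
  obtain y w where yw: "p = (y, w)" by (cases p)
  have "(T |` (\<Union>n. Hs n)) y = Some w" using p(1) unfolding yw Map.graph_def by simp
  then have y: "y \<in> (\<Union>n. Hs n)" "T y = Some w" by (auto simp: restrict_map_def split: if_splits)
  then obtain n where n: "y \<in> Hs n" by (elim UN_E)
  have "dist y x < \<epsilon>" "dist w (A x) < \<epsilon>"
    using p(2) dist_fst_le[of p "(x, A x)"] dist_snd_le[of p "(x, A x)"] unfolding yw by simp_all
  then show ?thesis using that[OF n] y(2) by (simp add: dist_norm norm_minus_commute)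
qed

lemma core_approx_H:
  assumes "x \<in> D" "\<epsilon> > 0"
  obtains y n where "y \<in> Hs n" "norm (x - y) < \<epsilon>" "norm (H x - H y) < \<epsilon>"
proof -
  define \<delta> where "\<delta> = \<epsilon> / (1 + K)"
  have \<delta>: "\<delta> > 0" "\<delta> * (1 + K) = \<epsilon>" using assms K_pos by (simp_all add: \<delta>_def)
  obtain y n where y: "y \<in> Hs n" "norm (x - y) < \<delta>" "norm (A x - A y) < \<delta>"
    using core_approx[OF assms(1) \<delta>(1)] .
  have "\<delta> \<le> \<epsilon>" using \<delta> K_pos by (simp add: algebra_simps flip: \<delta>(2))
  have "H x - H y = (A x - A y) + B (x - y)" by (simp add: H_def B_diff)
  then have "norm (H x - H y) \<le> norm (A x - A y) + norm (B (x - y))" by (simp only: norm_triangle_ineq)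
  also have "\<dots> \<le> norm (A x - A y) + K * norm (x - y)" using norm_B by simp
  also have "\<dots> < \<delta> + K * \<delta>" using y(2,3) K_pos by (intro add_strict_mono) simp_all
  also have "\<dots> = \<epsilon>" using \<delta>(2) by (simp add: algebra_simps)
  finally have "norm (H x - H y) < \<epsilon>" .
  then show ?thesis using that[OF y(1)] y(2) \<open>\<delta> \<le> \<epsilon>\<close> by simp
qed

text \<open>Relative compactness of the adjoint includes that its domain contains
  \<open>dom T\<close>; this supplies \<open>z\<close>.\<close>

lemma adjoint_B:
  assumes "y \<in> D"
  shows "\<exists>z. \<forall>x. cinner (B x) y = cinner x z"
proof -
  have "y \<in> dom (op_adjoint V)" using assms compact_V_adj unfolding relatively_compact_def by blast
  then have "\<exists>z. \<forall>x\<in>dom V. cinner (op_app V x) y = cinner x z"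
    unfolding op_adjoint_def by (auto split: if_splits)
  then obtain z where "\<forall>x\<in>dom V. cinner (op_app V x) y = cinner x z" ..
  moreover have "dom V = UNIV" using bounded_V by (simp add: bounded_op_def)
  ultimately show ?thesis by (intro exI[of _ z]) (simp add: B_def)
qed

text \<open>The sign \<open>s\<close> makes it possible to treat operators bounded below and
  operators bounded above at once, through the nonnegative form of \<open>s (T - a)\<close>.\<close>

lemma semibound:
  "\<exists>s a::real. (s = 1 \<or> s = -1) \<and> (\<forall>x\<in>D. 0 \<le> s * (Re (cinner (A x) x) - a * (norm x)\<^sup>2))"
proof (cases "bounded_below_op T")
  case True
  then obtain c where "\<forall>x\<in>D. c * (norm x)\<^sup>2 \<le> Re (cinner (A x) x)" unfolding bounded_below_op_def ..
  then show ?thesis by (intro exI[of _ 1] exI[of _ c]) simp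
next
  case False
  then have "bounded_above_op T" using semibounded by (simp add: semibounded_op_def)
  then obtain c where "\<forall>x\<in>D. Re (cinner (A x) x) \<le> c * (norm x)\<^sup>2" unfolding bounded_above_op_def ..
  then show ?thesis by (intro exI[of _ "-1"] exI[of _ c]) simp
qed

section \<open>From compactness in the graph norm to compactness in the form norm\<close>

lemma compact_B_sequence:
  assumes "\<And>n. x n \<in> D" "\<And>n. norm (x n) \<le> b" "\<And>n. norm (A (x n)) \<le> b'"
  shows "\<exists>r::nat \<Rightarrow> nat. strict_mono r \<and> convergent (\<lambda>n. B (x (r n)))"
proof -
  have "range x \<subseteq> D" using assms(1) by auto
  moreover have "bounded (range x)" using assms(2) by (intro boundedI[of _ b]) auto
  moreover have "bounded (range (\<lambda>n. A (x n)))" using assms(3) by (intro boundedI[of _ b']) auto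
  ultimately show ?thesis using compact_V unfolding relatively_compact_def B_def by simp
qed

lemma subseq_compact_B:
  assumes "\<And>n. x n \<in> D" "\<And>n. norm (x n) \<le> b" "\<And>n. norm (A (x n)) \<le> b'"
  shows "subseq_compact (\<lambda>n. B (x n))"
  unfolding subseq_compact_def
proof (rule allI, rule impI)
  fix s :: "nat \<Rightarrow> nat"
  define y where "y n = x (s n)" for n
  have "y n \<in> D" "norm (y n) \<le> b" "norm (A (y n)) \<le> b'" for n
    using assms by (simp_all add: y_def)
  then have "\<exists>r::nat \<Rightarrow> nat. strict_mono r \<and> convergent (\<lambda>n. B (y (r n)))"
    by (rule compact_B_sequence)
  then show "\<exists>r::nat \<Rightarrow> nat. strict_mono r \<and> convergent (\<lambda>n. B (x (s (r n))))"
    by (simp only: y_def)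
qed

text \<open>With the nonnegative operator \<open>A' = s (T - a)\<close> and
  \<open>u = (A' + t)^(-1) x\<close>, the vector \<open>w = t u\<close> is a smoothing of
  \<open>x\<close> and the error \<open>v = x - w\<close> equals \<open>A' u\<close>. Expanding the
  form of \<open>A'\<close> at \<open>x = v + t u\<close> gives \<open>2 t\<close> times the squared
  norm of \<open>v\<close> plus two nonnegative terms.\<close>

lemma resolvent_form_estimate:
  fixes s a t :: real
  assumes s: "s = 1 \<or> s = -1" and pos: "\<And>x. x \<in> D \<Longrightarrow> 0 \<le> s * (Re (cinner (A x) x) - a * (norm x)\<^sup>2)"
    and t: "t > 0" and x: "x \<in> D"
  obtains w where "w \<in> D" "2 * t * (norm (x - w))\<^sup>2 \<le> s * (Re (cinner (A x) x) - a * (norm x)\<^sup>2)"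
    "A w = complex_of_real (t * s) *\<^sub>C (x - w) + complex_of_real a *\<^sub>C w"
proof -
  have ss: "s * s = 1" using s by auto
  \<comment> \<open>With this choice \<open>T - l = s (A' + t)\<close>, and positivity of the form
    keeps \<open>l\<close> off the hull.\<close>
  define l where "l = a - s * t"
  have "complex_of_real l \<notin> nr_hull"
  proof
    assume "complex_of_real l \<in> nr_hull"
    then have "l \<in> closure num_range" unfolding nr_hull_def by (auto simp: of_real_eq_iff)
    moreover have "closure num_range \<subseteq> {r. 0 \<le> s * (r - a)}"
    proof (rule closure_minimal)
      show "num_range \<subseteq> {r. 0 \<le> s * (r - a)}"
      proof
        fix r assume "r \<in> num_range"
        then obtain x where "r = Re (cinner (A x) x)" "x \<in> D" "norm x = 1" unfolding num_range_def by blast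
        then show "r \<in> {r. 0 \<le> s * (r - a)}" using pos[of x] by simp
      qed
      show "closed {r. 0 \<le> s * (r - a)}" by (intro closed_Collect_le continuous_intros)
    qed
    ultimately have "0 \<le> s * (l - a)" by auto
    also have "s * (l - a) = - t * (s * s)" by (simp add: l_def algebra_simps)
    finally show False using t ss by simp
  qed
  then obtain u where u: "u \<in> D" "A u - complex_of_real l *\<^sub>C u = complex_of_real s *\<^sub>C x"
    by (rule shift_surjective)
  define w where "w = complex_of_real t *\<^sub>C u"
  define v where "v = x - w"
  define A' where "A' y = complex_of_real s *\<^sub>C (A y - complex_of_real a *\<^sub>C y)" for y
  have wD: "w \<in> D" unfolding w_def by (rule D_scaleC[OF u(1)])
  have vD: "v \<in> D" unfolding v_def by (rule D_diff[OF x wD])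
  have css: "complex_of_real s * complex_of_real s = 1" using ss by (simp flip: of_real_mult)
  have A'u: "A' u = v"
  proof -
    have "A u = complex_of_real s *\<^sub>C x + complex_of_real l *\<^sub>C u" using u(2) by (simp add: diff_eq_eq)
    then have "A u - complex_of_real a *\<^sub>C u = complex_of_real s *\<^sub>C x - complex_of_real (s * t) *\<^sub>C u"
      by (simp add: l_def scaleC_diff_left)
    then have "A' u = complex_of_real s *\<^sub>C (complex_of_real s *\<^sub>C x - complex_of_real (s * t) *\<^sub>C u)"
      by (simp add: A'_def)
    also have "\<dots> = x - complex_of_real t *\<^sub>C u"
      using css by (simp add: scaleC_diff_right scaleC_scaleC scaleC_one flip: mult.assoc)
    finally show ?thesis by (simp add: v_def w_def)
  qed
  have A'sym: "cinner (A' y) z = cinner y (A' z)" if "y \<in> D" "z \<in> D" for y z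
    using that by (simp add: A'_def cinner_scaleC_left cinner_scaleC_right cinner_diff_left cinner_diff_right symmetric)
  have A'pos: "0 \<le> Re (cinner (A' y) y)" if "y \<in> D" for y
    using pos[OF that] by (simp add: A'_def cinner_scaleC_left cinner_diff_left cinner_self)
  have xv: "x = v + complex_of_real t *\<^sub>C u" by (simp add: v_def w_def)
  have "A' (v + complex_of_real t *\<^sub>C u) = A' v + complex_of_real t *\<^sub>C A' u"
    unfolding A'_def A_add[OF vD D_scaleC[OF u(1)]] A_scaleC[OF u(1)]
    by (simp add: scaleC_diff_right scaleC_add_right scaleC_scaleC mult_ac)
  then have A'x: "A' x = A' v + complex_of_real t *\<^sub>C v" by (simp only: xv[symmetric] A'u)
  have "cinner (A' x) x = cinner (A' v + complex_of_real t *\<^sub>C v) (v + complex_of_real t *\<^sub>C u)"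
    by (simp only: A'x xv[symmetric])
  then have "cinner (A' x) x = cinner (A' v) v + complex_of_real t * cinner (A' v) u
      + complex_of_real t * cinner v v + complex_of_real (t * t) * cinner v u"
    by (simp add: cinner_add_left cinner_add_right cinner_scaleC_left cinner_scaleC_right algebra_simps)
  moreover have "cinner (A' v) u = cinner v v" using A'sym[OF vD u(1)] by (simp only: A'u)
  moreover have "cinner v u = cinner (A' u) u" by (simp only: A'u)
  ultimately have "cinner (A' x) x = cinner (A' v) v + complex_of_real (2 * t) * cinner v v
      + complex_of_real (t * t) * cinner (A' u) u" by (simp add: algebra_simps)
  then have "Re (cinner (A' x) x) = Re (cinner (A' v) v) + 2 * t * (norm v)\<^sup>2 + t * t * Re (cinner (A' u) u)"
    by (simp add: cinner_self)
  then have "2 * t * (norm v)\<^sup>2 \<le> Re (cinner (A' x) x)"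
    using A'pos[OF vD] A'pos[OF u(1)] t by simp
  also have "Re (cinner (A' x) x) = s * (Re (cinner (A x) x) - a * (norm x)\<^sup>2)"
    by (simp add: A'_def cinner_scaleC_left cinner_diff_left cinner_self)
  finally have est: "2 * t * (norm (x - w))\<^sup>2 \<le> s * (Re (cinner (A x) x) - a * (norm x)\<^sup>2)" by (simp only: v_def)
  have "A u = complex_of_real s *\<^sub>C v + complex_of_real a *\<^sub>C u"
  proof -
    have "complex_of_real s *\<^sub>C A' u = A u - complex_of_real a *\<^sub>C u"
      unfolding A'_def scaleC_scaleC css scaleC_one ..
    then show ?thesis by (simp add: A'u)
  qed
  then have "A w = complex_of_real (t * s) *\<^sub>C (x - w) + complex_of_real a *\<^sub>C w"
    unfolding w_def A_scaleC[OF u(1)] v_def by (simp add: scaleC_add_right scaleC_scaleC mult.commute)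
  with wD est show ?thesis by (rule that)
qed

text \<open>\<open>T\<close>-compactness of \<open>V\<close> is about sequences bounded in the graph norm of \<open>T\<close>. The resolvent at distance
  \<open>t\<close> from the numerical range turns a form-bounded sequence into such a sequence and, \<open>T\<close> being
  semibounded, moves it by \<open>O(1/sqrt t)\<close> only.\<close>

lemma form_compact:
  assumes x: "\<And>n. x n \<in> D" "\<And>n. norm (x n) \<le> b" "\<And>n. cmod (cinner (A (x n)) (x n)) \<le> b"
  shows "\<exists>r::nat \<Rightarrow> nat. strict_mono r \<and> convergent (\<lambda>n. B (x (r n)))"
proof -
  from semibound obtain s a :: real where sa: "(s = 1 \<or> s = -1) \<and>
    (\<forall>x\<in>D. 0 \<le> s * (Re (cinner (A x) x) - a * (norm x)\<^sup>2))" by (elim exE)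
  have s: "s = 1 \<or> s = -1" by (rule conjunct1[OF sa])
  have pos: "0 \<le> s * (Re (cinner (A x) x) - a * (norm x)\<^sup>2)" if "x \<in> D" for x
    by (rule bspec[OF conjunct2[OF sa] that])
  define M where "M = b + \<bar>a\<bar> * b\<^sup>2"
  have b0: "0 \<le> b" using order_trans[OF norm_ge_zero x(2)] .
  have M0: "0 \<le> M" using b0 by (simp add: M_def)
  have M: "s * (Re (cinner (A (x n)) (x n)) - a * (norm (x n))\<^sup>2) \<le> M" for n
  proof -
    have "s * (Re (cinner (A (x n)) (x n)) - a * (norm (x n))\<^sup>2)
        \<le> \<bar>Re (cinner (A (x n)) (x n))\<bar> + \<bar>a * (norm (x n))\<^sup>2\<bar>"
      using s by (elim disjE, simp_all only: mult_1_left mult_minus_left)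
    also have "\<dots> \<le> b + \<bar>a\<bar> * b\<^sup>2"
    proof (rule add_mono)
      show "\<bar>Re (cinner (A (x n)) (x n))\<bar> \<le> b" using abs_Re_le_cmod x(3) by (rule order_trans)
      show "\<bar>a * (norm (x n))\<^sup>2\<bar> \<le> \<bar>a\<bar> * b\<^sup>2"
        unfolding abs_mult using x(2) by (intro mult_left_mono) (simp_all add: power_mono)
    qed
    finally show ?thesis by (simp only: M_def)
  qed
  obtain r :: "nat \<Rightarrow> nat" where "strict_mono r" "convergent (\<lambda>n. B (x (r n)))"
  proof (rule convergent_subseq_if_approximable[of "\<lambda>n. B (x n)"])
    fix \<epsilon> :: real assume \<epsilon>: "\<epsilon> > 0"
    \<comment> \<open>Chosen so that \<open>K\<^sup>2 * M \<le> 2 * t * \<epsilon>\<^sup>2\<close>,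
      which brings the images under \<open>B\<close> of a vector and its smoothing within
      \<open>\<epsilon>\<close>; the summand \<open>1\<close> keeps \<open>t\<close> positive when
      \<open>M = 0\<close>.\<close>
    define t where "t = 1 + K\<^sup>2 * M / (2 * \<epsilon>\<^sup>2)"
    have t: "t > 0" using M0 by (simp add: t_def add_pos_nonneg)
    have "\<forall>n. \<exists>w. w \<in> D \<and> 2 * t * (norm (x n - w))\<^sup>2 \<le> s * (Re (cinner (A (x n)) (x n)) - a * (norm (x n))\<^sup>2) \<and>
      A w = complex_of_real (t * s) *\<^sub>C (x n - w) + complex_of_real a *\<^sub>C w"
    proof
      fix n
      show "\<exists>w. w \<in> D \<and> 2 * t * (norm (x n - w))\<^sup>2 \<le> s * (Re (cinner (A (x n)) (x n)) - a * (norm (x n))\<^sup>2) \<and>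
        A w = complex_of_real (t * s) *\<^sub>C (x n - w) + complex_of_real a *\<^sub>C w"
      proof (rule resolvent_form_estimate[OF s pos t x(1)[of n]])
        fix w
        assume "w \<in> D" "2 * t * (norm (x n - w))\<^sup>2 \<le> s * (Re (cinner (A (x n)) (x n)) - a * (norm (x n))\<^sup>2)"
          "A w = complex_of_real (t * s) *\<^sub>C (x n - w) + complex_of_real a *\<^sub>C w"
        then show ?thesis by (intro exI[of _ w] conjI)
      qed
    qed
    from choice[OF this] obtain w where "\<forall>n. w n \<in> D \<and>
      2 * t * (norm (x n - w n))\<^sup>2 \<le> s * (Re (cinner (A (x n)) (x n)) - a * (norm (x n))\<^sup>2) \<and>
      A (w n) = complex_of_real (t * s) *\<^sub>C (x n - w n) + complex_of_real a *\<^sub>C w n" ..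
    then have w: "w n \<in> D" "2 * t * (norm (x n - w n))\<^sup>2 \<le> s * (Re (cinner (A (x n)) (x n)) - a * (norm (x n))\<^sup>2)"
      "A (w n) = complex_of_real (t * s) *\<^sub>C (x n - w n) + complex_of_real a *\<^sub>C w n" for n by simp_all
    have sq: "2 * t * (norm (x n - w n))\<^sup>2 \<le> M" for n using w(2) M by (rule order_trans)
    have close: "dist (B (x n)) (B (w n)) \<le> \<epsilon>" for n
    proof -
      have "norm (B (x n) - B (w n)) \<le> K * norm (x n - w n)" unfolding B_diff[symmetric] by (rule norm_B)
      moreover have "(K * norm (x n - w n))\<^sup>2 \<le> \<epsilon>\<^sup>2"
      proof -
        have "2 * t * (K * norm (x n - w n))\<^sup>2 = K\<^sup>2 * (2 * t * (norm (x n - w n))\<^sup>2)"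
          by (simp add: power_mult_distrib)
        also have "\<dots> \<le> K\<^sup>2 * M" using sq by (intro mult_left_mono) simp_all
        also have "\<dots> \<le> 2 * t * \<epsilon>\<^sup>2"
        proof -
          have "t * (2 * \<epsilon>\<^sup>2) = 2 * \<epsilon>\<^sup>2 + K\<^sup>2 * M / (2 * \<epsilon>\<^sup>2) * (2 * \<epsilon>\<^sup>2)"
            by (simp only: t_def distrib_right mult_1_left)
          also have "K\<^sup>2 * M / (2 * \<epsilon>\<^sup>2) * (2 * \<epsilon>\<^sup>2) = K\<^sup>2 * M" using \<epsilon> by simp
          finally have "t * (2 * \<epsilon>\<^sup>2) = 2 * \<epsilon>\<^sup>2 + K\<^sup>2 * M" .
          moreover have "2 * t * \<epsilon>\<^sup>2 = t * (2 * \<epsilon>\<^sup>2)" by (simp only: mult_ac)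
          moreover have "0 \<le> 2 * \<epsilon>\<^sup>2" by simp
          ultimately show ?thesis by linarith
        qed
        finally have "2 * t * (K * norm (x n - w n))\<^sup>2 \<le> 2 * t * \<epsilon>\<^sup>2" .
        then show ?thesis by (rule mult_left_le_imp_le) (use t in simp)
      qed
      then have "K * norm (x n - w n) \<le> \<epsilon>" by (rule power2_le_imp_le) (use \<epsilon> in simp)
      ultimately show ?thesis by (simp add: dist_norm)
    qed
    define v where "v n = B (w n)" for n
    \<comment> \<open>A crude bound on the norm obtained from the bound \<open>M / (2 * t)\<close>
      on its square; it need not be small, because only boundedness of \<open>w n\<close> and
      \<open>A (w n)\<close> is at stake.\<close>
    define c where "c = 1 + M / (2 * t)"
    have c: "norm (x n - w n) \<le> c" for n
    proof -
      have "(norm (x n - w n))\<^sup>2 * (2 * t) \<le> M" using sq[of n] by (simp only: mult.commute)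
      then have "(norm (x n - w n))\<^sup>2 \<le> M / (2 * t)" by (subst pos_le_divide_eq) (use t in linarith)
      moreover have "2 * norm (x n - w n) * 1 \<le> (norm (x n - w n))\<^sup>2 + 1\<^sup>2" by (rule sum_squares_bound)
      moreover have "0 \<le> M / (2 * t)" using M0 t by simp
      ultimately show ?thesis unfolding c_def power_one mult_1_right using norm_ge_zero[of "x n - w n"] by linarith
    qed
    have nw: "norm (w n) \<le> b + c" for n
  proof -
    have "norm (x n - (x n - w n)) \<le> b + c"
      by (rule order_trans[OF norm_triangle_ineq4 add_mono[OF x(2) c]])
    then show ?thesis by simp
  qed
    have nA: "norm (A (w n)) \<le> \<bar>t * s\<bar> * c + \<bar>a\<bar> * (b + c)" for n
    proof -
      have "norm (A (w n)) \<le> norm (complex_of_real (t * s) *\<^sub>C (x n - w n)) + norm (complex_of_real a *\<^sub>C w n)"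
        unfolding w(3)[of n] by (rule norm_triangle_ineq)
      also have "\<dots> = \<bar>t * s\<bar> * norm (x n - w n) + \<bar>a\<bar> * norm (w n)" unfolding norm_scaleC norm_of_real ..
      also have "\<dots> \<le> \<bar>t * s\<bar> * c + \<bar>a\<bar> * (b + c)"
        by (rule add_mono[OF mult_left_mono[OF c abs_ge_zero] mult_left_mono[OF nw abs_ge_zero]])
      finally show ?thesis .
    qed
    have sub: "subseq_compact v" unfolding v_def[abs_def] by (rule subseq_compact_B[OF w(1) nw nA])
    have close': "\<forall>n. dist (B (x n)) (v n) \<le> \<epsilon>" unfolding v_def by (rule allI) (rule close)
    show "\<exists>w. (\<forall>n. dist (B (x n)) (w n) \<le> \<epsilon>) \<and> subseq_compact w"
      by (rule exI[of _ v], rule conjI[OF close' sub])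
  qed (rule that)
  then show ?thesis by (intro exI[of _ r] conjI)
qed

text \<open>Testing the equation with \<open>x n\<close> itself bounds the form, so
  \<open>form_compact\<close> makes \<open>B (x n)\<close> converge to some \<open>h\<close> along a
  subsequence. What remains is a Galerkin problem for \<open>T - l\<close> with right-hand side
  tending to \<open>g0 - h\<close>. It is coercive, so its solutions converge to the exact solution
  \<open>w\<close>, as in Cea's lemma, and continuity of \<open>B\<close> identifies
  \<open>h\<close> as \<open>B w\<close>. Shifts and right-hand sides may vary with
  \<open>n\<close>, which makes the later stability estimates locally uniform.\<close>

lemma galerkin_limit:
  fixes z :: "nat \<Rightarrow> complex" and m :: "nat \<Rightarrow> nat"
  assumes l: "l \<notin> nr_hull" and z: "z \<longlonglongrightarrow> l" and g: "g \<longlonglongrightarrow> g0"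
    and m: "filterlim m at_top sequentially"
    and x: "\<And>n. x n \<in> Hs (m n)" "\<And>n. norm (x n) \<le> b"
    and eq: "\<And>n y. y \<in> Hs (m n) \<Longrightarrow> cinner (H (x n) - z n *\<^sub>C x n) y = cinner (g n) y"
  shows "\<exists>r w. strict_mono r \<and> (\<lambda>n. x (r n)) \<longlonglongrightarrow> w \<and> w \<in> D \<and> H w - l *\<^sub>C w = g0"
proof -
  have xD: "x n \<in> D" for n using x(1) by (rule Hs_D)
  obtain bz where "0 < bz \<and> (\<forall>n. norm (z n) \<le> bz)"
    using convergent_imp_Bseq[OF convergentI[OF z]] unfolding Bseq_def ..
  then have bz: "norm (z n) \<le> bz" for n by simp
  obtain bg where "0 < bg \<and> (\<forall>n. norm (g n) \<le> bg)"
    using convergent_imp_Bseq[OF convergentI[OF g]] unfolding Bseq_def ..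
  then have bg: "norm (g n) \<le> bg" for n by simp
  have b0: "0 \<le> b" "0 \<le> bz" "0 \<le> bg"
    using order_trans[OF norm_ge_zero x(2)] order_trans[OF norm_ge_zero bz] order_trans[OF norm_ge_zero bg] by simp_all
  have form: "cmod (cinner (A (x n)) (x n)) \<le> bg * b + bz * b * b + K * b * b" for n
  proof -
    have "A (x n) = (H (x n) - z n *\<^sub>C x n) + z n *\<^sub>C x n - B (x n)" by (simp add: H_def)
    then have "cinner (A (x n)) (x n) = cinner (g n) (x n) + cinner (z n *\<^sub>C x n) (x n) - cinner (B (x n)) (x n)"
      using eq[OF x(1)] by (simp only: cinner_add_left cinner_diff_left[of _ "B (x n)"])
    then have "cmod (cinner (A (x n)) (x n)) \<le> cmod (cinner (g n) (x n)) + cmod (cinner (z n *\<^sub>C x n) (x n)) + cmod (cinner (B (x n)) (x n))"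
      using norm_triangle_ineq4[of "cinner (g n) (x n) + cinner (z n *\<^sub>C x n) (x n)" "cinner (B (x n)) (x n)"]
        norm_triangle_ineq[of "cinner (g n) (x n)" "cinner (z n *\<^sub>C x n) (x n)"] by simp
    also have "\<dots> \<le> norm (g n) * norm (x n) + norm (z n *\<^sub>C x n) * norm (x n) + norm (B (x n)) * norm (x n)"
      by (intro add_mono cinner_bound)
    also have "\<dots> \<le> bg * b + bz * b * b + K * b * b"
    proof (intro add_mono mult_mono)
      show "norm (z n *\<^sub>C x n) \<le> bz * b" unfolding norm_scaleC using bz x(2) b0 by (intro mult_mono) auto
      show "norm (B (x n)) \<le> K * b" by (rule order_trans[OF norm_B mult_left_mono[OF x(2)]]) (use K_pos in simp)
    qed (use bg x(2) b0 K_pos in auto)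
    finally show ?thesis .
  qed
  define b' where "b' = max b (bg * b + bz * b * b + K * b * b)"
  have "norm (x n) \<le> b'" "cmod (cinner (A (x n)) (x n)) \<le> b'" for n
    using x(2)[of n] form[of n] by (simp_all add: b'_def)
  from form_compact[OF xD this] obtain r :: "nat \<Rightarrow> nat" where "strict_mono r \<and> convergent (\<lambda>n. B (x (r n)))" ..
  then have r: "strict_mono r" "convergent (\<lambda>n. B (x (r n)))" by simp_all
  from r(2) obtain h where h: "(\<lambda>n. B (x (r n))) \<longlonglongrightarrow> h" unfolding convergent_def ..
  obtain w where w: "w \<in> D" "A w - l *\<^sub>C w = g0 - h" by (rule shift_surjective[OF l])
  from coercive[OF l] obtain c where c': "c > 0 \<and> (\<forall>z. dist l z \<le> c \<longrightarrow> z \<notin> nr_hull \<and>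
    (\<forall>x\<in>D. c * (norm x)\<^sup>2 \<le> cmod (cinner (A x - z *\<^sub>C x) x)))" ..
  have c: "c > 0" "dist l z \<le> c \<Longrightarrow> x \<in> D \<Longrightarrow> c * (norm x)\<^sup>2 \<le> cmod (cinner (A x - z *\<^sub>C x) x)" for z x
    using c' by blast+
  have zr: "(\<lambda>n. z (r n)) \<longlonglongrightarrow> l" and gr: "(\<lambda>n. g (r n)) \<longlonglongrightarrow> g0"
    using LIMSEQ_subseq_LIMSEQ[OF z r(1)] LIMSEQ_subseq_LIMSEQ[OF g r(1)] by (simp_all add: o_def)
  have mr: "filterlim (\<lambda>n. m (r n)) at_top sequentially"
    by (rule filterlim_compose[OF m filterlim_subseq[OF r(1)]])
  have lim: "(\<lambda>n. x (r n)) \<longlonglongrightarrow> w"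
  proof (rule tendstoI)
    fix \<epsilon> :: real assume \<epsilon>: "\<epsilon> > 0"
    \<comment> \<open>Coercivity will bound \<open>norm y\<close> by
      \<open>\<delta> * (2 + cmod l) / c\<close>, and the approximation of \<open>w\<close> by
      \<open>w'\<close> costs another \<open>\<delta>\<close>.\<close>
    define C where "C = (2 + cmod l) / c + 1"
    have C: "C > 0" using c(1) by (simp add: C_def add_pos_nonneg add_nonneg_pos divide_nonneg_pos)
    define \<delta> where "\<delta> = \<epsilon> / (2 * C)"
    have \<delta>: "\<delta> > 0" "\<delta> * C < \<epsilon>" using C \<epsilon> by (simp_all add: \<delta>_def)
    obtain w' N where w': "w' \<in> Hs N" "norm (w - w') < \<delta>" "norm (A w - A w') < \<delta>"
      using core_approx[OF w(1) \<delta>(1)] .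
    have w'D: "w' \<in> D" using w'(1) by (rule Hs_D)
    define p where "p n = g (r n) - B (x (r n)) - (A w' - z (r n) *\<^sub>C w')" for n
    have "p \<longlonglongrightarrow> g0 - h - (A w' - l *\<^sub>C w')" unfolding p_def[abs_def] by (intro tendsto_intros gr h zr)
    then have pn: "(\<lambda>n. norm (p n)) \<longlonglongrightarrow> norm (g0 - h - (A w' - l *\<^sub>C w'))" by (rule tendsto_norm)
    have "norm (g0 - h - (A w' - l *\<^sub>C w')) < \<delta> * (2 + cmod l)"
    proof -
      have "g0 - h - (A w' - l *\<^sub>C w') = (A w - A w') - l *\<^sub>C (w - w')"
        unfolding w(2)[symmetric] by (simp add: scaleC_diff_right)
      then have "norm (g0 - h - (A w' - l *\<^sub>C w')) \<le> norm (A w - A w') + norm (l *\<^sub>C (w - w'))"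
        by (simp only: norm_triangle_ineq4)
      also have "\<dots> = norm (A w - A w') + cmod l * norm (w - w')" by simp
      also have "\<dots> \<le> \<delta> + cmod l * \<delta>" using w'(2,3) by (intro add_mono mult_left_mono) simp_all
      also have "\<dots> < \<delta> * (2 + cmod l)" using \<delta>(1) by (simp add: algebra_simps)
      finally show ?thesis .
    qed
    then have "\<forall>\<^sub>F n in sequentially. norm (p n) < \<delta> * (2 + cmod l)" by (rule order_tendstoD(2)[OF pn])
    moreover have "\<forall>\<^sub>F n in sequentially. dist (z (r n)) l < c" by (rule tendstoD[OF zr c(1)])
    moreover have "\<forall>\<^sub>F n in sequentially. N \<le> m (r n)" using mr by (simp add: filterlim_at_top)
    ultimately show "\<forall>\<^sub>F n in sequentially. dist (x (r n)) w < \<epsilon>"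
    proof eventually_elim
      case (elim n)
      \<comment> \<open>The comparison is with \<open>w'\<close> and not with \<open>w\<close>,
        since only a vector of the Galerkin space may be used as a test vector.\<close>
      define y where "y = x (r n) - w'"
      have w'm: "w' \<in> Hs (m (r n))" using Hs_mono[OF elim(3)] w'(1) by (rule subsetD)
      have yH: "y \<in> Hs (m (r n))" unfolding y_def by (rule complex_vector.subspace_diff[OF Hs_subspace x(1) w'm])
      have "A y - z (r n) *\<^sub>C y = (H (x (r n)) - z (r n) *\<^sub>C x (r n)) - (B (x (r n)) + (A w' - z (r n) *\<^sub>C w'))"
        unfolding y_def A_diff[OF xD w'D] by (simp add: H_def scaleC_diff_right)
      then have "cinner (A y - z (r n) *\<^sub>C y) y = cinner (H (x (r n)) - z (r n) *\<^sub>C x (r n)) y - cinner (B (x (r n)) + (A w' - z (r n) *\<^sub>C w')) y"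
        by (simp only: cinner_diff_left[of "H (x (r n)) - z (r n) *\<^sub>C x (r n)"])
      also have "\<dots> = cinner (p n) y"
        unfolding eq[OF yH] by (simp add: p_def cinner_diff_left cinner_add_left)
      finally have id: "cinner (A y - z (r n) *\<^sub>C y) y = cinner (p n) y" .
      have "c * (norm y)\<^sup>2 \<le> cmod (cinner (p n) y)"
        unfolding id[symmetric] using elim(2) by (intro c(2) Hs_D[OF yH]) (simp add: dist_commute)
      also have "\<dots> \<le> norm (p n) * norm y" by (rule cinner_bound)
      finally have cy: "c * norm y \<le> norm (p n)"
        by (cases "y = 0") (simp_all add: power2_eq_square)
      then have "c * norm y < \<delta> * (2 + cmod l)" using elim(1) by simp
      then have "norm y < \<delta> * ((2 + cmod l) / c)" using c(1) by (simp add: field_simps)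
      moreover have "norm (x (r n) - w) \<le> norm y + norm (w' - w)"
        unfolding y_def using norm_triangle_ineq[of "x (r n) - w'" "w' - w"] by simp
      ultimately have "norm (x (r n) - w) < \<delta> * ((2 + cmod l) / c) + \<delta>"
        using w'(2) by (simp add: norm_minus_commute)
      also have "\<dots> = \<delta> * C" by (simp only: C_def distrib_left mult_1_right)
      finally show ?case using \<delta>(2) by (simp add: dist_norm)
    qed
  qed
  have "B w = h" using LIMSEQ_unique[OF tendsto_B[OF lim] h] .
  moreover have "H w - l *\<^sub>C w = (A w - l *\<^sub>C w) + B w" by (simp add: H_def)
  ultimately have "H w - l *\<^sub>C w = g0" using w(2) by simp
  then show ?thesis using r(1) lim w(1) by (intro exI[of _ r] exI[of _ w] conjI)
qed

end

lemma tendsto_zero_if_le_inverse_Suc: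
  fixes u :: "nat \<Rightarrow> 'b::real_normed_vector"
  assumes "\<And>j. norm (u j) \<le> 1 / real (Suc j)"
  shows "u \<longlonglongrightarrow> 0"
proof (rule tendsto_norm_zero_cancel, rule tendsto_sandwich[of "\<lambda>_. 0" _ _ "\<lambda>n. 1 / real (Suc n)"])
  show "(\<lambda>n. 1 / real (Suc n)) \<longlonglongrightarrow> 0"
    using LIMSEQ_inverse_real_of_nat by (simp add: inverse_eq_divide)
  show "\<forall>\<^sub>F n in sequentially. norm (u n) \<le> 1 / real (Suc n)"
    using assms by (intro always_eventually allI)
qed simp_all

text \<open>Strictly decreasing distances to \<open>l\<close> make the sequence injective.\<close>

lemma islimpt_distinct_sequence:
  fixes l :: "'b::metric_space"
  assumes "l islimpt S"
  obtains e :: "nat \<Rightarrow> 'b" where "\<forall>n. e n \<in> S - {l}" "inj e" "e \<longlonglongrightarrow> l"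
proof -
  have pick: "\<exists>x. x \<in> S \<and> x \<noteq> l \<and> dist x l < \<epsilon>" if "\<epsilon> > 0" for \<epsilon>
    using assms that unfolding islimpt_approachable by blast
  let ?P = "\<lambda>n x. x \<in> S \<and> x \<noteq> l \<and> dist x l < 1 / real (Suc n)"
  have "\<exists>e. \<forall>n. ?P n (e n) \<and> dist (e (Suc n)) l < dist (e n) l"
  proof (rule dependent_nat_choice)
    show "\<exists>x. ?P 0 x" by (rule pick) simp
    fix x n assume "?P n x"
    then obtain y where "y \<in> S \<and> y \<noteq> l \<and> dist y l < min (dist x l) (1 / real (Suc (Suc n)))"
      using pick[of "min (dist x l) (1 / real (Suc (Suc n)))"] by auto
    then show "\<exists>y. ?P (Suc n) y \<and> dist y l < dist x l" by (intro exI[of _ y]) simp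
  qed
  then obtain e where "\<forall>n. ?P n (e n) \<and> dist (e (Suc n)) l < dist (e n) l" ..
  then have e: "e n \<in> S - {l}" "dist (e n) l < 1 / real (Suc n)" "dist (e (Suc n)) l < dist (e n) l" for n by simp_all
  have mono: "dist (e n) l < dist (e m) l" if "m < n" for m n
    using that by (induction rule: less_Suc_induct) (use e(3) in \<open>auto intro: less_trans\<close>)
  have "inj e"
  proof (rule injI)
    fix m n assume "e m = e n"
    then show "m = n" using mono[of m n] mono[of n m] by (cases m n rule: linorder_cases) simp_all
  qed
  moreover have "e \<longlonglongrightarrow> l"
  proof (rule tendsto_dist_iff[THEN iffD2], rule tendsto_zero_if_le_inverse_Suc)
    show "norm (dist (e n) l) \<le> 1 / real (Suc n)" for n using e(2)[of n] by simp
  qed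
  ultimately show ?thesis using e(1) by (intro that[of e]) simp_all
qed

section \<open>Stability of the Galerkin method away from hull and eigenvalues\<close>

context galerkin
begin

lemma G_scaleC: "x \<in> D \<Longrightarrow> G n z (c *\<^sub>C x) = c *\<^sub>C G n z x"
proof -
  assume "x \<in> D"
  then have "H (c *\<^sub>C x) - z *\<^sub>C c *\<^sub>C x = c *\<^sub>C (H x - z *\<^sub>C x)"
    by (simp add: H_scaleC scaleC_diff_right scaleC_scaleC mult.commute)
  then show ?thesis by (simp only: G_def oproj_scaleC)
qed

lemma oproj_Hs: "oproj (f n) {..<d n} x \<in> Hs n"
  using oproj_in_span[of "{..<d n}" "f n" x] basis span_basis by simp

lemma cinner_oproj_Hs: "y \<in> Hs n \<Longrightarrow> cinner (oproj (f n) {..<d n} u) y = cinner u y"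
  using cinner_diff_oproj[of "{..<d n}" "f n" y u] basis span_basis by (simp add: cinner_diff_left)

lemma cinner_G: "y \<in> Hs n \<Longrightarrow> cinner (H x - z *\<^sub>C x) y = cinner (G n z x) y"
  unfolding G_def by (rule cinner_oproj_Hs[symmetric])

lemma norm_G_le: "norm (G n z x) \<le> norm (H x - z *\<^sub>C x)"
  unfolding G_def by (rule norm_oproj_le) (simp_all add: basis)

lemma normalize_in:
  assumes "x \<noteq> 0"
  shows "norm (complex_of_real (1 / norm x) *\<^sub>C (x::'a)) = 1"
  using assms by (simp add: norm_divide)

text \<open>Otherwise there would be unit vectors in spaces of growing index with shifts tending to
  \<open>l\<close> and Galerkin residuals tending to zero. By \<open>galerkin_limit\<close> a
  subsequence converges in norm, hence to a unit eigenvector at \<open>l\<close>. Letting the shifts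
  vary in this argument is what makes the estimate hold on a disc.\<close>

lemma stable_point:
  assumes l: "l \<notin> nr_hull" "\<not> eigen l"
  shows "\<exists>\<epsilon>>0. \<exists>N. \<forall>n\<ge>N. \<forall>z. dist l z < \<epsilon> \<longrightarrow> (\<forall>x\<in>Hs n. \<epsilon> * norm x \<le> norm (G n z x))"
proof (rule ccontr)
  assume no: "\<not> ?thesis"
  have "\<forall>j. \<exists>n z x. j \<le> n \<and> dist l z < 1 / real (Suc j) \<and> x \<in> Hs n \<and> norm x = 1 \<and> norm (G n z x) \<le> 1 / real (Suc j)"
  proof
    fix j
    define \<epsilon> where "\<epsilon> = 1 / real (Suc j)"
    have "\<epsilon> > 0" by (simp add: \<epsilon>_def)
    with no have "\<not> (\<forall>n\<ge>j. \<forall>z. dist l z < \<epsilon> \<longrightarrow> (\<forall>x\<in>Hs n. \<epsilon> * norm x \<le> norm (G n z x)))"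
      by blast
    then obtain n z x where nzx: "j \<le> n" "dist l z < \<epsilon>" "x \<in> Hs n" "norm (G n z x) < \<epsilon> * norm x"
      by (auto simp: not_le)
    have x0: "x \<noteq> 0"
    proof
      assume "x = 0"
      with nzx(4) have "norm (G n z x) < 0" by simp
      then show False by simp
    qed
    define u where "u = complex_of_real (1 / norm x) *\<^sub>C x"
    have "u \<in> Hs n" unfolding u_def by (rule complex_vector.subspace_scale[OF Hs_subspace nzx(3)])
    moreover have "norm u = 1" unfolding u_def by (rule normalize_in[OF x0])
    moreover have "norm (G n z u) \<le> \<epsilon>"
    proof -
      have "norm (G n z u) = norm (G n z x) / norm x"
        unfolding u_def G_scaleC[OF Hs_D[OF nzx(3)]] by (simp add: norm_divide)
      also have "\<dots> \<le> \<epsilon>" using nzx(4) x0 by (simp add: pos_divide_le_eq)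
      finally show ?thesis .
    qed
    ultimately show "\<exists>n z x. j \<le> n \<and> dist l z < 1 / real (Suc j) \<and> x \<in> Hs n \<and> norm x = 1 \<and> norm (G n z x) \<le> 1 / real (Suc j)"
      using nzx(1,2) unfolding \<epsilon>_def[symmetric] by (intro exI[of _ n] exI[of _ z] exI[of _ u] conjI)
  qed
  from choice[OF this] obtain m where
    "\<forall>j. \<exists>z x. j \<le> m j \<and> dist l z < 1 / real (Suc j) \<and> x \<in> Hs (m j) \<and> norm x = 1 \<and> norm (G (m j) z x) \<le> 1 / real (Suc j)" ..
  from choice[OF this] obtain z where
    "\<forall>j. \<exists>x. j \<le> m j \<and> dist l (z j) < 1 / real (Suc j) \<and> x \<in> Hs (m j) \<and> norm x = 1 \<and> norm (G (m j) (z j) x) \<le> 1 / real (Suc j)" ..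
  from choice[OF this] obtain x where
    x': "\<forall>j. j \<le> m j \<and> dist l (z j) < 1 / real (Suc j) \<and> x j \<in> Hs (m j) \<and> norm (x j) = 1 \<and> norm (G (m j) (z j) (x j)) \<le> 1 / real (Suc j)" ..
  have m: "filterlim m at_top sequentially"
    by (rule filterlim_at_top_mono[OF filterlim_ident]) (use x' in simp)
  have "(\<lambda>j. z j - l) \<longlonglongrightarrow> 0"
  proof (rule tendsto_zero_if_le_inverse_Suc)
    show "norm (z j - l) \<le> 1 / real (Suc j)" for j
      using x'[rule_format, of j] by (simp add: dist_norm norm_minus_commute)
  qed
  then have z: "z \<longlonglongrightarrow> l" by (rule LIM_zero_cancel)
  have g: "(\<lambda>j. G (m j) (z j) (x j)) \<longlonglongrightarrow> 0"
    by (rule tendsto_zero_if_le_inverse_Suc) (use x' in blast)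
  have "\<exists>r w. strict_mono r \<and> (\<lambda>n. x (r n)) \<longlonglongrightarrow> w \<and> w \<in> D \<and> H w - l *\<^sub>C w = 0"
  proof (rule galerkin_limit[OF l(1) z g m])
    show "x n \<in> Hs (m n)" for n using x' by blast
    show "norm (x n) \<le> 1" for n using x' by simp
    show "cinner (H (x n) - z n *\<^sub>C x n) y = cinner (G (m n) (z n) (x n)) y" if "y \<in> Hs (m n)" for n y
      by (rule cinner_G[OF that])
  qed
  then obtain r w where "strict_mono r \<and> (\<lambda>n. x (r n)) \<longlonglongrightarrow> w \<and> w \<in> D \<and> H w - l *\<^sub>C w = 0" by (elim exE)
  then have rw: "(\<lambda>n. x (r n)) \<longlonglongrightarrow> w" "w \<in> D" "H w - l *\<^sub>C w = 0" by simp_all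
  have "(\<lambda>n. norm (x (r n))) \<longlonglongrightarrow> norm w" by (rule tendsto_norm[OF rw(1)])
  moreover have "(\<lambda>n. norm (x (r n))) = (\<lambda>n. 1)" using x' by simp
  ultimately have "norm w = 1" by (simp add: LIMSEQ_const_iff)
  then have "eigen l" unfolding eigen_def using rw(2,3) by (intro exI[of _ w]) simp
  with l(2) show False ..
qed

lemma core_sequence:
  assumes "x \<in> D"
  obtains y n where "\<And>j. y j \<in> Hs (n j)" "y \<longlonglongrightarrow> x" "(\<lambda>j. H (y j)) \<longlonglongrightarrow> H x"
proof -
  have "\<forall>j. \<exists>y n. y \<in> Hs n \<and> norm (x - y) < 1 / real (Suc j) \<and> norm (H x - H y) < 1 / real (Suc j)"
  proof
    fix j
    have "1 / real (Suc j) > 0" by simp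
    then obtain y n where "y \<in> Hs n" "norm (x - y) < 1 / real (Suc j)" "norm (H x - H y) < 1 / real (Suc j)"
      by (rule core_approx_H[OF assms])
    then show "\<exists>y n. y \<in> Hs n \<and> norm (x - y) < 1 / real (Suc j) \<and> norm (H x - H y) < 1 / real (Suc j)"
      by (intro exI[of _ y] exI[of _ n] conjI)
  qed
  from choice[OF this] obtain y where
    "\<forall>j. \<exists>n. y j \<in> Hs n \<and> norm (x - y j) < 1 / real (Suc j) \<and> norm (H x - H (y j)) < 1 / real (Suc j)" ..
  from choice[OF this] obtain n where
    y: "\<forall>j. y j \<in> Hs (n j) \<and> norm (x - y j) < 1 / real (Suc j) \<and> norm (H x - H (y j)) < 1 / real (Suc j)" ..
  show ?thesis
  proof (rule that[of y n])
    show "y j \<in> Hs (n j)" for j using y by blast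
    have "(\<lambda>j. y j - x) \<longlonglongrightarrow> 0"
    proof (rule tendsto_zero_if_le_inverse_Suc)
      show "norm (y j - x) \<le> 1 / real (Suc j)" for j
        using y[rule_format, of j] by (simp add: norm_minus_commute)
    qed
    then show "y \<longlonglongrightarrow> x" by (rule LIM_zero_cancel)
    have "(\<lambda>j. H (y j) - H x) \<longlonglongrightarrow> 0"
    proof (rule tendsto_zero_if_le_inverse_Suc)
      show "norm (H (y j) - H x) \<le> 1 / real (Suc j)" for j
        using y[rule_format, of j] by (simp add: norm_minus_commute)
    qed
    then show "(\<lambda>j. H (y j)) \<longlonglongrightarrow> H x" by (rule LIM_zero_cancel)
  qed
qed

text \<open>A core approximant from \<open>Hs (n j)\<close> also lies in the later spaces, where
  stability holds, so the discrete estimate passes to \<open>H - z\<close> itself.\<close>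

lemma bounded_below_if_stable:
  assumes stable: "\<And>n y. n \<ge> N \<Longrightarrow> y \<in> Hs n \<Longrightarrow> c * norm y \<le> norm (G n z y)" and x: "x \<in> D"
  shows "c * norm x \<le> norm (H x - z *\<^sub>C x)"
proof (rule core_sequence[OF x])
  fix y n assume y: "\<And>j. y j \<in> Hs (n j)" "y \<longlonglongrightarrow> x" "(\<lambda>j. H (y j)) \<longlonglongrightarrow> H x"
  have le: "c * norm (y j) \<le> norm (H (y j) - z *\<^sub>C y j)" for j
  proof -
    have "y j \<in> Hs (max N (n j))" using y(1) Hs_mono[of "n j" "max N (n j)"] by (auto simp: subset_iff)
    then have "c * norm (y j) \<le> norm (G (max N (n j)) z (y j))" by (intro stable) simp_all
    also have "\<dots> \<le> norm (H (y j) - z *\<^sub>C y j)" by (rule norm_G_le)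
    finally show ?thesis .
  qed
  have "(\<lambda>j. c * norm (y j)) \<longlonglongrightarrow> c * norm x" by (intro tendsto_intros y(2))
  moreover have "(\<lambda>j. norm (H (y j) - z *\<^sub>C y j)) \<longlonglongrightarrow> norm (H x - z *\<^sub>C x)" by (intro tendsto_intros y(2,3))
  ultimately show ?thesis using le by (intro LIMSEQ_le) auto
qed

section \<open>The Galerkin matrices and their resolvents\<close>

definition cvec where "cvec n c = (\<Sum>j<d n. c j *\<^sub>C f n j)"

lemma cvec_Hs: "cvec n c \<in> Hs n"
  unfolding cvec_def
  by (intro complex_vector.subspace_sum complex_vector.subspace_scale Hs_subspace f_Hs) simp

lemma cinner_cvec: "i < d n \<Longrightarrow> cinner (cvec n c) (f n i) = c i"
  unfolding cvec_def by (rule cinner_orthonormal_sum) (simp_all add: basis)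

lemma Hs_eqI:
  assumes "u \<in> Hs n" "v \<in> Hs n" "\<And>i. i < d n \<Longrightarrow> cinner u (f n i) = cinner v (f n i)"
  shows "u = v"
proof -
  have "u = oproj (f n) {..<d n} u" "v = oproj (f n) {..<d n} v"
    using assms(1,2) oproj_span[of "{..<d n}" "f n"] basis span_basis by simp_all
  moreover have "oproj (f n) {..<d n} u = oproj (f n) {..<d n} v"
    unfolding oproj_def using assms(3) by (intro sum.cong) simp_all
  ultimately show ?thesis by simp
qed

lemma G_Hs: "G n z x \<in> Hs n"
  unfolding G_def by (rule oproj_Hs)

lemma cinner_shift_cvec:
  assumes "i < d n"
  shows "cinner (H (cvec n c) - z *\<^sub>C cvec n c) (f n i) = - (\<Sum>j<d n. ((if i = j then z else 0) - entry n i j) * c j)"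
proof -
  have "H (cvec n c) = (\<Sum>j<d n. c j *\<^sub>C H (f n j))"
    unfolding cvec_def
  proof (subst H_sum)
    show "c j *\<^sub>C f n j \<in> D" if "j \<in> {..<d n}" for j
      using that by (intro D_scaleC Hs_D[OF f_Hs]) simp
    show "(\<Sum>j<d n. H (c j *\<^sub>C f n j)) = (\<Sum>j<d n. c j *\<^sub>C H (f n j))"
      by (intro sum.cong refl H_scaleC Hs_D[OF f_Hs]) simp
  qed
  then have "cinner (H (cvec n c)) (f n i) = (\<Sum>j<d n. c j * entry n i j)"
    by (simp add: cinner_sum_left cinner_scaleC_left entry_def)
  moreover have "z * c i = (\<Sum>j<d n. (if i = j then z else 0) * c j)"
  proof -
    have "(\<Sum>j<d n. (if i = j then z else 0) * c j) = (\<Sum>j<d n. if i = j then z * c j else 0)"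
      by (intro sum.cong) simp_all
    then show ?thesis using assms by simp
  qed
  ultimately show ?thesis
    by (simp add: cinner_diff_left cinner_scaleC_left cinner_cvec[OF assms] left_diff_distrib sum_subtractf mult.commute[of "c _"])
qed

lemma cinner_G_cvec:
  assumes "i < d n"
  shows "cinner (G n z (cvec n c)) (f n i) = - (\<Sum>j<d n. ((if i = j then z else 0) - entry n i j) * c j)"
  unfolding cinner_shift_cvec[OF assms, symmetric] by (rule cinner_G[OF f_Hs[OF assms], symmetric])

lemma cvec_coefficients: "x \<in> Hs n \<Longrightarrow> x = cvec n (\<lambda>j. cinner x (f n j))"
  by (rule Hs_eqI[OF _ cvec_Hs]) (simp_all add: cinner_cvec)

lemma chp_root:
  assumes "chp n z = 0"
  obtains x where "x \<in> Hs n" "norm x = 1" "G n z x = 0"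
proof (rule charpoly_root_eigenvector[OF assms[unfolded chp_def]])
  fix c assume c: "\<exists>i<d n. c i \<noteq> 0" "\<And>i. i < d n \<Longrightarrow> (\<Sum>j<d n. entry n i j * c j) = z * c i"
  define x where "x = cvec n c"
  have xH: "x \<in> Hs n" unfolding x_def by (rule cvec_Hs)
  have x0: "x \<noteq> 0"
  proof
    assume "x = 0"
    then have "c i = 0" if "i < d n" for i using cinner_cvec[OF that, of c] by (simp add: x_def)
    then show False using c(1) by blast
  qed
  have "G n z x = 0"
  proof (rule Hs_eqI[OF G_Hs complex_vector.subspace_0[OF Hs_subspace]])
    fix i assume i: "i < d n"
    have "(\<Sum>j<d n. ((if i = j then z else 0) - entry n i j) * c j) = (\<Sum>j<d n. if i = j then z * c j else 0) - (\<Sum>j<d n. entry n i j * c j)"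
      unfolding sum_subtractf[symmetric] by (intro sum.cong) (simp_all add: left_diff_distrib)
    also have "\<dots> = 0" using i c(2)[OF i] by simp
    finally show "cinner (G n z x) (f n i) = cinner 0 (f n i)"
      unfolding x_def cinner_G_cvec[OF i] by simp
  qed
  then have "G n z (complex_of_real (1 / norm x) *\<^sub>C x) = 0"
    unfolding G_scaleC[OF Hs_D[OF xH]] by simp
  with that[OF complex_vector.subspace_scale[OF Hs_subspace xH] normalize_in[OF x0]] show thesis by simp
qed

text \<open>The right-hand side changes sign because \<open>charpoly\<close> belongs to the matrix
  \<open>z - entry n\<close>, whereas \<open>G n z\<close> compresses \<open>H - z\<close>.\<close>

lemma chp_solve:
  assumes "chp n z \<noteq> 0"
  shows "\<exists>x\<in>Hs n. G n z x = oproj (f n) {..<d n} g"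
proof (rule resolvent_solution_holomorphic[of "d n" "entry n" "\<lambda>i. - cinner g (f n i)"])
  fix c :: "nat \<Rightarrow> complex \<Rightarrow> complex"
  assume c: "\<And>z i. charpoly (d n) (entry n) z \<noteq> 0 \<Longrightarrow> i < d n \<Longrightarrow>
    (\<Sum>j<d n. ((if i = j then z else 0) - entry n i j) * c j z) = - cinner g (f n i)"
  have "G n z (cvec n (\<lambda>j. c j z)) = oproj (f n) {..<d n} g"
  proof (rule Hs_eqI[OF G_Hs oproj_Hs])
    fix i assume i: "i < d n"
    show "cinner (G n z (cvec n (\<lambda>j. c j z))) (f n i) = cinner (oproj (f n) {..<d n} g) (f n i)"
      unfolding cinner_G_cvec[OF i] c[OF assms[unfolded chp_def] i] cinner_oproj_Hs[OF f_Hs[OF i]] by simp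
  qed
  then show ?thesis by (rule bexI[OF _ cvec_Hs])
qed

text \<open>The maximum principle for the resolvent of the Galerkin matrix: a point that is less stable
  than a surrounding circle forces an eigenvalue inside the circle.\<close>

lemma chp_root_in_ball:
  assumes r: "r > 0" and c: "c > 0"
    and circle: "\<And>z x. dist l z = r \<Longrightarrow> x \<in> Hs n \<Longrightarrow> c * norm x \<le> norm (G n z x)"
    and x: "x \<in> Hs n" "norm x = 1" "norm (G n l x) < c"
  shows "\<exists>z. dist l z \<le> r \<and> chp n z = 0"
proof (rule ccontr)
  assume no: "\<not> ?thesis"
  then have nz: "charpoly (d n) (entry n) z \<noteq> 0" if "z \<in> cball l r" for z using that by (auto simp: chp_def)
  \<comment> \<open>The right-hand side stays \<open>G n l x\<close> for all \<open>z\<close>, so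
    that the solution at \<open>z = l\<close> is \<open>x\<close> itself.\<close>
  define b where "b i = - cinner (G n l x) (f n i)" for i
  show False
  proof (rule resolvent_solution_holomorphic[of "d n" "entry n" b])
    fix s :: "nat \<Rightarrow> complex \<Rightarrow> complex"
    assume hol: "\<And>j. s j holomorphic_on {z. charpoly (d n) (entry n) z \<noteq> 0}"
      and sol: "\<And>z i. charpoly (d n) (entry n) z \<noteq> 0 \<Longrightarrow> i < d n \<Longrightarrow>
        (\<Sum>j<d n. ((if i = j then z else 0) - entry n i j) * s j z) = b i"
      and unique: "\<And>z j y. charpoly (d n) (entry n) z \<noteq> 0 \<Longrightarrow> j < d n \<Longrightarrow>
        (\<And>i. i < d n \<Longrightarrow> (\<Sum>j<d n. ((if i = j then z else 0) - entry n i j) * y j) = b i) \<Longrightarrow> s j z = y j"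
    define u where "u z = cvec n (\<lambda>j. s j z)" for z
    have Gu: "G n z (u z) = G n l x" if "z \<in> cball l r" for z
    proof (rule Hs_eqI[OF G_Hs G_Hs])
      fix i assume i: "i < d n"
      show "cinner (G n z (u z)) (f n i) = cinner (G n l x) (f n i)"
        unfolding u_def cinner_G_cvec[OF i] sol[OF nz[OF that] i] b_def by simp
    qed
    \<comment> \<open>A scalar holomorphic function to which the maximum principle applies: it
      equals \<open>1\<close> at the centre, while stability on the circle bounds it there by
      \<open>norm (G n l x) / c\<close>, which is less than \<open>1\<close>.\<close>
    define \<phi> where "\<phi> z = (\<Sum>j<d n. s j z * cinner (f n j) x)" for z
    have \<phi>: "\<phi> z = cinner (u z) x" for z
      by (simp add: \<phi>_def u_def cvec_def cinner_sum_left cinner_scaleC_left)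
    have xc: "x = cvec n (\<lambda>j. cinner x (f n j))" by (rule cvec_coefficients[OF x(1)])
    have "u l = x"
    proof -
      have "s j l = cinner x (f n j)" if j: "j < d n" for j
      proof (rule unique[OF nz j])
        show "l \<in> cball l r" using r by simp
        fix i assume i: "i < d n"
        show "(\<Sum>j<d n. ((if i = j then l else 0) - entry n i j) * cinner x (f n j)) = b i"
          using cinner_G_cvec[OF i, of l "\<lambda>j. cinner x (f n j)"] unfolding xc[symmetric] b_def by simp
      qed
      then have "u l = cvec n (\<lambda>j. cinner x (f n j))"
        unfolding u_def cvec_def by (intro sum.cong) simp_all
      then show ?thesis by (simp only: xc[symmetric])
    qed
    then have \<phi>l: "\<phi> l = 1" by (simp add: \<phi> cinner_self x(2))
    have hol': "\<phi> holomorphic_on cball l r"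
      unfolding \<phi>_def[abs_def]
    proof (intro holomorphic_intros)
      show "s j holomorphic_on cball l r" if "j \<in> {..<d n}" for j
        by (rule holomorphic_on_subset[OF hol]) (use nz in blast)
    qed
    have "norm (\<phi> l) \<le> norm (G n l x) / c"
    proof (rule maximum_modulus_frontier[of \<phi> "cball l r"])
      show "\<phi> holomorphic_on interior (cball l r)"
        by (rule holomorphic_on_subset[OF hol' interior_subset])
      show "continuous_on (closure (cball l r)) \<phi>"
        using holomorphic_on_imp_continuous_on[OF hol'] by simp
      show "norm (\<phi> z) \<le> norm (G n l x) / c" if "z \<in> frontier (cball l r)" for z
      proof -
        have z: "dist l z = r" using that r by (simp add: frontier_cball)
        then have zc: "z \<in> cball l r" by simp
        have "norm (\<phi> z) \<le> norm (u z)" using cinner_bound[of "u z" x] x(2) by (simp add: \<phi>)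
        moreover have "c * norm (u z) \<le> norm (G n z (u z))" by (rule circle[OF z]) (simp add: u_def cvec_Hs)
        then have "norm (u z) \<le> norm (G n l x) / c" unfolding Gu[OF zc] using c by (simp add: pos_le_divide_eq mult.commute)
        ultimately show ?thesis by (rule order_trans)
      qed
    qed (use r in simp_all)
    then show False using \<phi>l x(3) c by simp
  qed
qed

text \<open>Stability makes the Galerkin systems solvable with bounded solutions;
  \<open>galerkin_limit\<close> extracts a solution of the full equation.\<close>

lemma shift_H_surjective:
  assumes l: "l \<notin> nr_hull" "\<not> eigen l"
  shows "\<exists>x\<in>D. H x - l *\<^sub>C x = g"
proof -
  from stable_point[OF l] obtain \<epsilon> where e: "0 < \<epsilon> \<and> (\<exists>N. \<forall>n\<ge>N. \<forall>z. dist l z < \<epsilon> \<longrightarrow>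
    (\<forall>x\<in>Hs n. \<epsilon> * norm x \<le> norm (G n z x)))" ..
  then obtain N where N: "\<forall>n\<ge>N. \<forall>z. dist l z < \<epsilon> \<longrightarrow> (\<forall>x\<in>Hs n. \<epsilon> * norm x \<le> norm (G n z x))" by (elim conjE exE)
  have \<epsilon>: "\<epsilon> > 0" using e by (rule conjunct1)
  have st: "\<epsilon> * norm x \<le> norm (G n l x)" if "n \<ge> N" "x \<in> Hs n" for n x
    using N[rule_format, OF that(1) _ that(2), of l] \<epsilon> by simp
  have chp: "chp n l \<noteq> 0" if "n \<ge> N" for n
  proof
    assume "chp n l = 0"
    then obtain x where "x \<in> Hs n" "norm x = 1" "G n l x = 0" by (rule chp_root)
    then show False using st[OF that, of x] \<epsilon> by simp
  qed
  have "\<forall>n. \<exists>x. x \<in> Hs (n + N) \<and> G (n + N) l x = oproj (f (n + N)) {..<d (n + N)} g"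
  proof
    fix n
    show "\<exists>x. x \<in> Hs (n + N) \<and> G (n + N) l x = oproj (f (n + N)) {..<d (n + N)} g"
      using chp_solve[OF chp, of "n + N" g] by (simp add: Bex_def)
  qed
  from choice[OF this] obtain x where x: "\<forall>n. x n \<in> Hs (n + N) \<and> G (n + N) l (x n) = oproj (f (n + N)) {..<d (n + N)} g" ..
  have "\<exists>r w. strict_mono r \<and> (\<lambda>n. x (r n)) \<longlonglongrightarrow> w \<and> w \<in> D \<and> H w - l *\<^sub>C w = g"
  proof (rule galerkin_limit[OF l(1) tendsto_const tendsto_const, of "\<lambda>n. n + N"])
    show "filterlim (\<lambda>n. n + N) at_top sequentially"
      by (rule filterlim_at_top_mono[OF filterlim_ident]) simp
    show "x n \<in> Hs (n + N)" for n using x by blast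
    show "norm (x n) \<le> norm g / \<epsilon>" for n
    proof -
      have "\<epsilon> * norm (x n) \<le> norm (oproj (f (n + N)) {..<d (n + N)} g)"
        using st[of "n + N" "x n"] x by simp
      also have "\<dots> \<le> norm g" by (rule norm_oproj_le) (simp_all add: basis)
      finally show ?thesis using \<epsilon> by (simp add: pos_le_divide_eq mult.commute)
    qed
    show "cinner (H (x n) - l *\<^sub>C x n) y = cinner g y" if "y \<in> Hs (n + N)" for n y
    proof -
      have "cinner (H (x n) - l *\<^sub>C x n) y = cinner (G (n + N) l (x n)) y" by (rule cinner_G[OF that])
      also have "G (n + N) l (x n) = oproj (f (n + N)) {..<d (n + N)} g" using x by blast
      also have "cinner \<dots> y = cinner g y" by (rule cinner_oproj_Hs[OF that])
      finally show ?thesis .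
    qed
  qed
  then show ?thesis by blast
qed

section \<open>The spectrum of the perturbed operator\<close>

lemma dom_op_add: "dom (op_add T V) = D" and op_app_op_add: "x \<in> D \<Longrightarrow> op_app (op_add T V) x = H x"
  using bounded_V by (auto simp: op_add_def bounded_op_def H_def B_def dom_def split: if_splits)

lemma op_app_shift_H: "x \<in> D \<Longrightarrow> op_app (op_shift (op_add T V) l) x = H x - l *\<^sub>C x"
  by (simp add: dom_op_add op_app_op_add)

lemma in_resolvent_H:
  assumes l: "l \<notin> nr_hull" "\<not> eigen l"
  shows "l \<in> resolvent_set (op_add T V)"
proof -
  from stable_point[OF l] obtain \<epsilon> where e: "0 < \<epsilon> \<and> (\<exists>N. \<forall>n\<ge>N. \<forall>z. dist l z < \<epsilon> \<longrightarrow>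
    (\<forall>x\<in>Hs n. \<epsilon> * norm x \<le> norm (G n z x)))" ..
  then obtain N where N: "\<forall>n\<ge>N. \<forall>z. dist l z < \<epsilon> \<longrightarrow> (\<forall>x\<in>Hs n. \<epsilon> * norm x \<le> norm (G n z x))" by (elim conjE exE)
  have \<epsilon>: "\<epsilon> > 0" using e by (rule conjunct1)
  have below: "\<epsilon> * norm x \<le> norm (H x - l *\<^sub>C x)" if "x \<in> D" for x
  proof (rule bounded_below_if_stable[OF _ that])
    show "\<epsilon> * norm y \<le> norm (G n l y)" if "n \<ge> N" "y \<in> Hs n" for n y
      using N[rule_format, OF that(1) _ that(2), of l] \<epsilon> by simp
  qed
  have "inj_on (op_app (op_shift (op_add T V) l)) D"
  proof (rule inj_onI)
    fix x y assume xy: "x \<in> D" "y \<in> D" "op_app (op_shift (op_add T V) l) x = op_app (op_shift (op_add T V) l) y"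
    then have "H x - l *\<^sub>C x = H y - l *\<^sub>C y" by (simp only: op_app_shift_H)
    moreover have "H (x - y) - l *\<^sub>C (x - y) = (H x - l *\<^sub>C x) - (H y - l *\<^sub>C y)"
      using xy(1,2) by (simp add: H_diff scaleC_diff_right)
    ultimately have "H (x - y) - l *\<^sub>C (x - y) = 0" by simp
    then have "\<epsilon> * norm (x - y) \<le> 0" using below[OF D_diff[OF xy(1,2)]] by simp
    then show "x = y" using \<epsilon> by (simp add: mult_le_0_iff)
  qed
  moreover have "op_app (op_shift (op_add T V) l) ` D = UNIV"
  proof -
    have "g \<in> op_app (op_shift (op_add T V) l) ` D" for g
    proof -
      from shift_H_surjective[OF l, of g] obtain x where x: "x \<in> D" "H x - l *\<^sub>C x = g" by blast
      then show ?thesis by (intro image_eqI[of _ _ x]) (simp_all only: op_app_shift_H)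
    qed
    then show ?thesis by blast
  qed
  moreover have "norm x \<le> (1 / \<epsilon>) * norm (op_app (op_shift (op_add T V) l) x)" if "x \<in> D" for x
    unfolding op_app_shift_H[OF that] using below[OF that] \<epsilon> by (simp add: pos_le_divide_eq mult.commute)
  ultimately show ?thesis unfolding resolvent_set_def bij_betw_def dom_op_add by blast
qed

lemma not_resolvent_if_approximate_eigenvalue:
  assumes "\<And>n. x n \<in> D" "\<And>n. norm (x n) = 1" "(\<lambda>n. H (x n) - l *\<^sub>C x n) \<longlonglongrightarrow> 0"
  shows "l \<in> spectrum (op_add T V)"
proof (rule ccontr)
  assume "l \<notin> spectrum (op_add T V)"
  then obtain K where K: "\<forall>x\<in>D. norm x \<le> K * norm (op_app (op_shift (op_add T V) l) x)"
    unfolding spectrum_def resolvent_set_def dom_op_add by auto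
  have le: "1 \<le> K * norm (H (x n) - l *\<^sub>C x n)" for n
    using bspec[OF K assms(1)[of n]] assms(2)[of n] op_app_shift_H[OF assms(1)[of n], of l] by simp
  have "(\<lambda>n. K * norm (H (x n) - l *\<^sub>C x n)) \<longlonglongrightarrow> K * norm (0::'a)" by (intro tendsto_intros assms(3))
  then have "1 \<le> K * norm (0::'a)" by (rule LIMSEQ_le_const) (use le in blast)
  then show False by simp
qed

lemma eigen_in_spectrum:
  assumes "eigen l"
  shows "l \<in> spectrum (op_add T V)"
proof -
  obtain x where x: "x \<in> D" "norm x = 1" "H x = l *\<^sub>C x" using assms unfolding eigen_def by (elim exE conjE)
  show ?thesis by (rule not_resolvent_if_approximate_eigenvalue[of "\<lambda>_. x"]) (simp_all add: x)
qed

text \<open>Pairing with a vector of the dense set \<open>D\<close> moves \<open>B\<close> onto a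
  fixed vector \<open>z\<close>, against which \<open>y\<close> tends to zero.\<close>

lemma weakly_null_B_limit:
  assumes "weakly_null y" "(\<lambda>n. B (y n)) \<longlonglongrightarrow> h"
  shows "h = 0"
proof (rule eq_zero_if_orthogonal_dense[OF dense])
  fix v assume "v \<in> D"
  from adjoint_B[OF this] obtain z where "\<forall>x. cinner (B x) v = cinner x z" ..
  then have z: "cinner (B x) v = cinner x z" for x by simp
  have "(\<lambda>n. cinner (B (y n)) v) \<longlonglongrightarrow> cinner h v" by (intro tendsto_intros assms(2))
  moreover have "(\<lambda>n. cinner (B (y n)) v) \<longlonglongrightarrow> 0" unfolding z using assms(1) by (simp add: weakly_null_def)
  ultimately show "cinner h v = 0" by (rule LIMSEQ_unique)
qed

lemma weakly_null_subseq:
  assumes "weakly_null y" "strict_mono (r::nat \<Rightarrow> nat)"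
  shows "weakly_null (\<lambda>n. y (r n))"
  unfolding weakly_null_def
proof
  fix v
  have "(\<lambda>n. cinner (y n) v) \<longlonglongrightarrow> 0" using assms(1) by (simp add: weakly_null_def)
  from LIMSEQ_subseq_LIMSEQ[OF this assms(2)] show "(\<lambda>n. cinner (y (r n)) v) \<longlonglongrightarrow> 0" by (simp add: o_def)
qed

text \<open>Weyl's argument: a singular sequence of \<open>T\<close> is bounded in the graph norm,
  so \<open>B\<close> maps a subsequence to a norm convergent one, whose limit is zero by weak
  nullity. The subsequence therefore consists of approximate eigenvectors of
  \<open>H\<close>.\<close>

lemma ess2_subset_spectrum: "ess_spectrum2 T \<subseteq> spectrum (op_add T V)"
proof
  fix l assume "l \<in> ess_spectrum2 T"
  then obtain x :: "nat \<Rightarrow> 'a" where "range x \<subseteq> D \<and> (\<forall>k. norm (x k) = 1) \<and> weakly_null x \<and>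
    (\<lambda>k. norm (op_app (op_shift T l) (x k))) \<longlonglongrightarrow> 0"
    unfolding ess_spectrum2_def mem_Collect_eq ..
  then have x: "x n \<in> D" "norm (x n) = 1" "weakly_null x" "(\<lambda>k. norm (op_app (op_shift T l) (x k))) \<longlonglongrightarrow> 0" for n
    by auto
  then have "(\<lambda>k. norm (A (x k) - l *\<^sub>C x k)) \<longlonglongrightarrow> 0" by simp
  then have lim: "(\<lambda>k. A (x k) - l *\<^sub>C x k) \<longlonglongrightarrow> 0" by (rule tendsto_norm_zero_cancel)
  obtain b where "0 < b \<and> (\<forall>n. norm (A (x n) - l *\<^sub>C x n) \<le> b)"
    using convergent_imp_Bseq[OF convergentI[OF lim]] unfolding Bseq_def ..
  then have b: "norm (A (x n) - l *\<^sub>C x n) \<le> b" for n by simp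
  have "norm (A (x n)) \<le> b + cmod l" for n
  proof -
    have "norm ((A (x n) - l *\<^sub>C x n) + l *\<^sub>C x n) \<le> b + cmod l * 1"
      by (rule order_trans[OF norm_triangle_ineq add_mono[OF b]]) (simp add: x(2))
    then show ?thesis by simp
  qed
  with x(1) have "\<exists>r::nat \<Rightarrow> nat. strict_mono r \<and> convergent (\<lambda>n. B (x (r n)))"
    by (intro compact_B_sequence[of x 1 "b + cmod l"]) (simp_all add: x(2))
  then obtain r :: "nat \<Rightarrow> nat" where "strict_mono r \<and> convergent (\<lambda>n. B (x (r n)))" ..
  then have r: "strict_mono r" "convergent (\<lambda>n. B (x (r n)))" by simp_all
  from r(2) obtain h where h: "(\<lambda>n. B (x (r n))) \<longlonglongrightarrow> h" unfolding convergent_def ..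
  have "h = 0" by (rule weakly_null_B_limit[OF weakly_null_subseq[OF x(3) r(1)] h])
  have "(\<lambda>n. A (x (r n)) - l *\<^sub>C x (r n)) \<longlonglongrightarrow> 0" using LIMSEQ_subseq_LIMSEQ[OF lim r(1)] by (simp add: o_def)
  from tendsto_add[OF this h] have "(\<lambda>n. A (x (r n)) - l *\<^sub>C x (r n) + B (x (r n))) \<longlonglongrightarrow> 0" by (simp add: \<open>h = 0\<close>)
  moreover have "A (x (r n)) - l *\<^sub>C x (r n) + B (x (r n)) = H (x (r n)) - l *\<^sub>C x (r n)" for n by (simp add: H_def)
  ultimately have "(\<lambda>n. H (x (r n)) - l *\<^sub>C x (r n)) \<longlonglongrightarrow> 0" by simp
  then show "l \<in> spectrum (op_add T V)"
    by (rule not_resolvent_if_approximate_eigenvalue[of "\<lambda>n. x (r n)", rotated 2]) (simp_all add: x(1,2))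
qed

lemma spectrum_H: "spectrum (op_add T V) = nr_hull \<union> {l. eigen l}"
proof
  show "spectrum (op_add T V) \<subseteq> nr_hull \<union> {l. eigen l}"
    using in_resolvent_H by (auto simp: spectrum_def)
  have "nr_hull \<subseteq> ess_spectrum2 T"
    by (rule hull_subset_ess2) (use admissible in \<open>simp_all add: admissible_decomposition_def\<close>)
  then show "nr_hull \<union> {l. eigen l} \<subseteq> spectrum (op_add T V)"
    using ess2_subset_spectrum eigen_in_spectrum by blast
qed

text \<open>Stability on a disc excludes eigenvalues of \<open>H\<close> and of its large
  compressions there at the same time; closedness of the spectrum follows.\<close>

lemma no_eigen_near:
  assumes l: "l \<notin> nr_hull" "\<not> eigen l"
  shows "\<exists>\<epsilon>>0. \<exists>N. \<forall>z. dist l z < \<epsilon> \<longrightarrow> z \<notin> nr_hull \<and> \<not> eigen z \<and> (\<forall>n\<ge>N. chp n z \<noteq> 0)"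
proof -
  from stable_point[OF l] obtain \<epsilon> where e: "0 < \<epsilon> \<and> (\<exists>N. \<forall>n\<ge>N. \<forall>z. dist l z < \<epsilon> \<longrightarrow>
    (\<forall>x\<in>Hs n. \<epsilon> * norm x \<le> norm (G n z x)))" ..
  then obtain N where N: "\<forall>n\<ge>N. \<forall>z. dist l z < \<epsilon> \<longrightarrow> (\<forall>x\<in>Hs n. \<epsilon> * norm x \<le> norm (G n z x))" by (elim conjE exE)
  have \<epsilon>: "\<epsilon> > 0" using e by (rule conjunct1)
  from coercive[OF l(1)] obtain c where c: "c > 0 \<and> (\<forall>z. dist l z \<le> c \<longrightarrow> z \<notin> nr_hull \<and>
    (\<forall>x\<in>D. c * (norm x)\<^sup>2 \<le> cmod (cinner (A x - z *\<^sub>C x) x)))" ..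
  show ?thesis
  proof (intro exI[of _ "min \<epsilon> c"] exI[of _ N] conjI allI impI)
    show "min \<epsilon> c > 0" using \<epsilon> c by simp
    fix z assume z: "dist l z < min \<epsilon> c"
    then show "z \<notin> nr_hull" using c by simp
    have st: "\<epsilon> * norm x \<le> norm (G n z x)" if "n \<ge> N" "x \<in> Hs n" for n x
      using N[rule_format, OF that(1) _ that(2), of z] z by simp
    show "\<not> eigen z"
    proof
      assume "eigen z"
      then obtain x where x: "x \<in> D" "norm x = 1" "H x = z *\<^sub>C x" unfolding eigen_def by (elim exE conjE)
      have "\<epsilon> * norm x \<le> norm (H x - z *\<^sub>C x)" by (rule bounded_below_if_stable[OF st x(1)])
      then show False using \<epsilon> x(2,3) by simp
    qed
    fix n assume n: "N \<le> n"
    show "chp n z \<noteq> 0"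
    proof
      assume "chp n z = 0"
      then obtain x where "x \<in> Hs n" "norm x = 1" "G n z x = 0" by (rule chp_root)
      then show False using st[OF n, of x] \<epsilon> by simp
    qed
  qed
qed

lemma closed_spectrum_H: "closed (spectrum (op_add T V))"
  unfolding closed_def spectrum_H open_dist
proof (intro ballI)
  fix l assume "l \<in> - (nr_hull \<union> {l. eigen l})"
  then have l: "l \<notin> nr_hull" "\<not> eigen l" by simp_all
  from no_eigen_near[OF l] obtain \<epsilon> where e: "0 < \<epsilon> \<and> (\<exists>N. \<forall>z. dist l z < \<epsilon> \<longrightarrow> z \<notin> nr_hull \<and> \<not> eigen z \<and> (\<forall>n\<ge>N. chp n z \<noteq> 0))" ..
  then obtain N where N: "\<forall>z. dist l z < \<epsilon> \<longrightarrow> z \<notin> nr_hull \<and> \<not> eigen z \<and> (\<forall>n\<ge>N. chp n z \<noteq> 0)" by (elim conjE exE)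
  show "\<exists>e>0. \<forall>y. dist y l < e \<longrightarrow> y \<in> - (nr_hull \<union> {l. eigen l})"
    using e N by (intro exI[of _ \<epsilon>]) (simp add: dist_commute)
qed

section \<open>Isolation of the eigenvalues outside the hull\<close>

lemma H_span_eigenvectors:
  assumes x: "\<And>j::nat. x j \<in> D" "\<And>j. H (x j) = e j *\<^sub>C x j"
    and v: "v \<in> complex_vector.span (x ` {..<n})"
  shows "v \<in> D" "H v \<in> complex_vector.span (x ` {..<n})"
    and "H v - e n *\<^sub>C v \<in> complex_vector.span (x ` {..<n})"
proof -
  have "v \<in> D \<and> H v \<in> complex_vector.span (x ` {..<n})"
    using v
  proof (induction rule: complex_vector.span_induct_alt)
    case base
    show ?case by (simp add: D_0 H_0 complex_vector.span_zero)
  next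
    case (step c u w)
    then obtain j where j: "u = x j" "j < n" by blast
    have "x j \<in> complex_vector.span (x ` {..<n})" using j(2) by (intro complex_vector.span_base imageI) simp
    then have "u \<in> D" "H u \<in> complex_vector.span (x ` {..<n})"
      unfolding j(1) x(2) using x(1) by (simp_all add: complex_vector.span_scale)
    then show ?case using step.IH
      by (auto simp: H_add H_scaleC D_add D_scaleC intro!: complex_vector.span_add complex_vector.span_scale)
  qed
  then show *: "v \<in> D" "H v \<in> complex_vector.span (x ` {..<n})" by simp_all
  show "H v - e n *\<^sub>C v \<in> complex_vector.span (x ` {..<n})"
    by (intro complex_vector.span_diff complex_vector.span_scale * v)
qed

text \<open>Linear independence, in a form suited to induction: \<open>v\<close> need not be one of
  the given eigenvectors, and its eigenvalue \<open>m\<close> only has to differ from those of the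
  vectors spanning it.\<close>

lemma eigenvectors_independent:
  assumes x: "\<And>j::nat. x j \<in> D" "\<And>j. H (x j) = e j *\<^sub>C x j" "\<And>j. norm (x j) = 1" and e: "inj e"
    and v: "v \<in> complex_vector.span (x ` {..<n})" "H v = m *\<^sub>C v" "\<And>j. j < n \<Longrightarrow> e j \<noteq> m"
  shows "v = 0"
  using v
proof (induction n arbitrary: v m)
  case 0
  then show ?case by simp
next
  case (Suc n)
  let ?M = "complex_vector.span (x ` {..<n})"
  have "x ` {..<Suc n} = insert (x n) (x ` {..<n})" by (auto simp: less_Suc_eq)
  then obtain a where a: "v - a *\<^sub>C x n \<in> ?M"
    using Suc.prems(1) by (auto simp: complex_vector.span_insert)
  define w where "w = v - a *\<^sub>C x n"
  have wM: "w \<in> ?M" using a by (simp add: w_def)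
  have wD: "w \<in> D" by (rule H_span_eigenvectors(1)[OF x(1,2) wM])
  have v: "v = a *\<^sub>C x n + w" by (simp add: w_def)
  have "H v - m *\<^sub>C v = (a * (e n - m)) *\<^sub>C x n + (H w - m *\<^sub>C w)"
    unfolding v by (simp add: H_add[OF D_scaleC[OF x(1)] wD] H_scaleC[OF x(1)] x(2) scaleC_add_right scaleC_scaleC
        scaleC_diff_left right_diff_distrib mult.commute[of m])
  then have "(a * (e n - m)) *\<^sub>C x n + (H w - m *\<^sub>C w) = 0" using Suc.prems(2) by simp
  then have eq: "(a * (e n - m)) *\<^sub>C x n = - (H w - m *\<^sub>C w)" by (simp only: eq_neg_iff_add_eq_0)
  have "- (H w - m *\<^sub>C w) \<in> ?M"
    by (intro complex_vector.span_neg complex_vector.span_diff complex_vector.span_scale wM H_span_eigenvectors(2)[OF x(1,2) wM])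
  then have mem: "(a * (e n - m)) *\<^sub>C x n \<in> ?M" by (simp only: eq)
  have "a = 0"
  proof (rule ccontr)
    assume "a \<noteq> 0"
    then have nz: "a * (e n - m) \<noteq> 0" using Suc.prems(3)[of n] by simp
    have "inverse (a * (e n - m)) *\<^sub>C (a * (e n - m)) *\<^sub>C x n \<in> ?M" by (rule complex_vector.span_scale[OF mem])
    then have "x n \<in> ?M" by (simp only: scaleC_scaleC left_inverse[OF nz] scaleC_one)
    then have "x n = 0"
    proof (rule Suc.IH)
      show "H (x n) = e n *\<^sub>C x n" by (rule x(2))
      show "e j \<noteq> e n" if "j < n" for j using that e by (auto dest: injD)
    qed
    then show False using x(3)[of n] by simp
  qed
  then have "v \<in> ?M" using wM v by simp
  then show ?case by (rule Suc.IH[OF _ Suc.prems(2)]) (use Suc.prems(3) in simp)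
qed

text \<open>The vector \<open>y\<close> is the normalized component of \<open>x n\<close> orthogonal
  to the earlier eigenvectors. Since \<open>H - e n\<close> annihilates \<open>x n\<close> and
  preserves the span of the earlier ones, it maps \<open>y\<close> into that span, which is
  orthogonal to \<open>y\<close>.\<close>

lemma eigenvalue_flag:
  assumes x: "\<And>j::nat. x j \<in> D" "\<And>j. H (x j) = e j *\<^sub>C x j" "\<And>j. norm (x j) = 1" and e: "inj e"
  shows "\<exists>y. y \<in> complex_vector.span (x ` {..<Suc n}) \<and> norm y = 1 \<and>
    (\<forall>v\<in>complex_vector.span (x ` {..<n}). cinner y v = 0) \<and>
    cinner (H y - e n *\<^sub>C y) y = 0"
proof -
  let ?M = "complex_vector.span (x ` {..<n})"
  have ins: "x ` {..<Suc n} = insert (x n) (x ` {..<n})" by (auto simp: less_Suc_eq)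
  have nM: "x n \<notin> ?M"
  proof
    assume "x n \<in> ?M"
    then have "x n = 0"
    proof (rule eigenvectors_independent[OF x e])
      show "H (x n) = e n *\<^sub>C x n" by (rule x(2))
      show "e j \<noteq> e n" if "j < n" for j using that e by (auto dest: injD)
    qed
    then show False using x(3)[of n] by simp
  qed
  have "finite (x ` {..<n})" by simp
  then obtain g k where g: "orthonormal_on g {..<k::nat}" "complex_vector.span (g ` {..<k}) = ?M"
    by (rule finite_span_orthonormal_basis)
  define p where "p = oproj g {..<k} (x n)"
  have pM: "p \<in> ?M" using oproj_in_span[of "{..<k}" g "x n"] g by (simp add: p_def)
  define u where "u = x n - p"
  have u0: "u \<noteq> 0" using nM pM by (auto simp: u_def)
  have orth: "cinner u v = 0" if "v \<in> ?M" for v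
    unfolding u_def p_def by (rule cinner_diff_oproj) (use g that in simp_all)
  have pD: "p \<in> D" by (rule H_span_eigenvectors(1)[OF x(1,2) pM])
  have uD: "u \<in> D" unfolding u_def by (rule D_diff[OF x(1) pD])
  have Hu: "H u - e n *\<^sub>C u = - (H p - e n *\<^sub>C p)"
    unfolding u_def by (simp add: H_diff[OF x(1) pD] x(2) scaleC_diff_right)
  have HuM: "H u - e n *\<^sub>C u \<in> ?M"
    unfolding Hu by (rule complex_vector.span_neg[OF H_span_eigenvectors(3)[OF x(1,2) pM]])
  define y where "y = complex_of_real (1 / norm u) *\<^sub>C u"
  have "y \<in> complex_vector.span (x ` {..<Suc n})"
    unfolding y_def u_def ins
    by (intro complex_vector.span_scale complex_vector.span_diff)
       (auto intro: complex_vector.span_base subsetD[OF complex_vector.span_mono pM])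
  moreover have "norm y = 1" unfolding y_def by (rule normalize_in[OF u0])
  moreover have "\<forall>v\<in>?M. cinner y v = 0" by (simp add: y_def cinner_scaleC_left orth)
  moreover have "cinner (H y - e n *\<^sub>C y) y = 0"
  proof -
    have "H y - e n *\<^sub>C y = complex_of_real (1 / norm u) *\<^sub>C (H u - e n *\<^sub>C u)"
      unfolding y_def H_scaleC[OF uD] by (simp add: scaleC_diff_right scaleC_scaleC mult.commute)
    moreover have "cinner (H u - e n *\<^sub>C u) u = 0"
      using orth[OF HuM] by (simp only: cinner_eq_zero_commute[of u])
    ultimately show ?thesis by (simp only: y_def cinner_scaleC_left cinner_scaleC_right) simp
  qed
  ultimately show ?thesis by (intro exI[of _ y] conjI)
qed

text \<open>Eigenvalues cannot accumulate at a point \<open>l\<close> outside the hull: orthonormalising the eigenvectors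
  gives a weakly null sequence \<open>y\<close> with \<open>cinner ((H - e n) (y n)) (y n) = 0\<close>; since \<open>B (y n)\<close> tends to \<open>0\<close>
  along a subsequence, this contradicts the coercivity of \<open>T - l\<close>.\<close>

lemma eigen_isolated:
  assumes l: "l \<notin> nr_hull"
  shows "\<exists>\<epsilon>>0. \<forall>z. dist l z < \<epsilon> \<longrightarrow> eigen z \<longrightarrow> z = l"
proof (rule ccontr)
  assume no: "\<not> ?thesis"
  have "l islimpt {z. eigen z}"
    unfolding islimpt_approachable
  proof (intro allI impI)
    fix \<epsilon> :: real assume "\<epsilon> > 0"
    with no have "\<not> (\<forall>z. dist l z < \<epsilon> \<longrightarrow> eigen z \<longrightarrow> z = l)" by blast
    then show "\<exists>x'\<in>{z. eigen z}. x' \<noteq> l \<and> dist x' l < \<epsilon>" by (auto simp: dist_commute)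
  qed
  then obtain e where e: "\<forall>n::nat. e n \<in> {z. eigen z} - {l}" "inj e" "e \<longlonglongrightarrow> l"
    by (rule islimpt_distinct_sequence)
  have "\<forall>n. \<exists>x. x \<in> D \<and> norm x = 1 \<and> H x = e n *\<^sub>C x" using e(1) by (simp add: eigen_def)
  from choice[OF this] obtain x where "\<forall>n. x n \<in> D \<and> norm (x n) = 1 \<and> H (x n) = e n *\<^sub>C x n" ..
  then have x: "x n \<in> D" "H (x n) = e n *\<^sub>C x n" "norm (x n) = 1" for n by simp_all
  let ?M = "\<lambda>n. complex_vector.span (x ` {..<n})"
  have "\<forall>n. \<exists>y. y \<in> ?M (Suc n) \<and> norm y = 1 \<and> (\<forall>v\<in>?M n. cinner y v = 0) \<and> cinner (H y - e n *\<^sub>C y) y = 0"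
    by (rule allI) (rule eigenvalue_flag[OF x e(2)])
  from choice[OF this] obtain y where "\<forall>n. y n \<in> ?M (Suc n) \<and> norm (y n) = 1 \<and>
    (\<forall>v\<in>?M n. cinner (y n) v = 0) \<and> cinner (H (y n) - e n *\<^sub>C y n) (y n) = 0" ..
  then have y: "y n \<in> ?M (Suc n)" "norm (y n) = 1" "v \<in> ?M n \<Longrightarrow> cinner (y n) v = 0"
    "cinner (H (y n) - e n *\<^sub>C y n) (y n) = 0" for n v by simp_all
  have yD: "y n \<in> D" for n by (rule H_span_eigenvectors(1)[OF x(1,2) y(1)])
  have lt: "cinner (y n) (y m) = 0" if "m < n" for m n
  proof (rule y(3))
    have "?M (Suc m) \<subseteq> ?M n" using that by (intro complex_vector.span_mono image_mono) auto
    then show "y m \<in> ?M n" using y(1)[of m] by (rule subsetD)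
  qed
  have "orthonormal_on y UNIV"
    unfolding orthonormal_on_def
  proof (intro ballI)
    fix m n :: nat
    consider "m < n" | "n < m" | "m = n" by linarith
    then show "cinner (y m) (y n) = (if m = n then 1 else 0)"
    proof cases
      case 1 then show ?thesis using lt[OF 1] by (simp add: cinner_eq_zero_commute[of "y m"])
    next
      case 2 then show ?thesis using lt[OF 2] by simp
    next
      case 3 then show ?thesis by (simp add: cinner_self y(2))
    qed
  qed
  then have wn: "weakly_null y" by (rule orthonormal_weakly_null)
  have id: "cinner (A (y n) - e n *\<^sub>C y n) (y n) = - cinner (B (y n)) (y n)" for n
  proof -
    have "cinner (H (y n) - e n *\<^sub>C y n) (y n) = cinner (A (y n) - e n *\<^sub>C y n) (y n) + cinner (B (y n)) (y n)"
      by (simp add: H_def cinner_add_left cinner_diff_left)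
    then show ?thesis using y(4)[of n] by (simp add: eq_neg_iff_add_eq_0)
  qed
  have nB: "norm (B (y n)) \<le> K" for n using norm_B[of "y n"] y(2)[of n] by simp
  obtain b where "0 < b \<and> (\<forall>n. norm (e n) \<le> b)"
    using convergent_imp_Bseq[OF convergentI[OF e(3)]] unfolding Bseq_def ..
  then have b: "0 < b" "norm (e n) \<le> b" for n by simp_all
  \<comment> \<open>The identity for \<open>y n\<close> controls the form only and gives no bound on
    \<open>A (y n)\<close>; hence the recourse to \<open>form_compact\<close>.\<close>
  have "cmod (cinner (A (y n)) (y n)) \<le> K + b" for n
  proof -
    have "cinner (A (y n)) (y n) = cinner (A (y n) - e n *\<^sub>C y n) (y n) + e n"
      by (simp add: cinner_diff_left cinner_scaleC_left cinner_self y(2))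
    also have "cmod \<dots> \<le> cmod (cinner (B (y n)) (y n)) + cmod (e n)"
      unfolding id by (metis norm_triangle_ineq norm_minus_cancel)
    also have "\<dots> \<le> K + b"
    proof (rule add_mono[OF _ b(2)])
      show "cmod (cinner (B (y n)) (y n)) \<le> K"
        using order_trans[OF cinner_bound[of "B (y n)" "y n"]] nB[of n] y(2)[of n] by simp
    qed
    finally show ?thesis .
  qed
  moreover have "norm (y n) \<le> max 1 (K + b)" for n by (simp add: y(2))
  ultimately have "\<exists>r::nat \<Rightarrow> nat. strict_mono r \<and> convergent (\<lambda>n. B (y (r n)))"
    by (intro form_compact[of y "max 1 (K + b)"] yD) (simp_all add: le_max_iff_disj)
  then obtain r :: "nat \<Rightarrow> nat" where "strict_mono r \<and> convergent (\<lambda>n. B (y (r n)))" ..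
  then have r: "strict_mono r" "convergent (\<lambda>n. B (y (r n)))" by simp_all
  from r(2) obtain h where h: "(\<lambda>n. B (y (r n))) \<longlonglongrightarrow> h" unfolding convergent_def ..
  have "h = 0" by (rule weakly_null_B_limit[OF weakly_null_subseq[OF wn r(1)] h])
  then have hn: "(\<lambda>n. norm (B (y (r n)))) \<longlonglongrightarrow> 0" using tendsto_norm[OF h] by simp
  from coercive[OF l] obtain c where c: "c > 0 \<and> (\<forall>z. dist l z \<le> c \<longrightarrow> z \<notin> nr_hull \<and>
    (\<forall>x\<in>D. c * (norm x)\<^sup>2 \<le> cmod (cinner (A x - z *\<^sub>C x) x)))" ..
  have er: "(\<lambda>n. e (r n)) \<longlonglongrightarrow> l" using LIMSEQ_subseq_LIMSEQ[OF e(3) r(1)] by (simp add: o_def)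
  have "\<forall>\<^sub>F n in sequentially. norm (B (y (r n))) < c" by (rule order_tendstoD(2)[OF hn]) (use c in simp)
  moreover have "\<forall>\<^sub>F n in sequentially. dist (e (r n)) l < c" by (rule tendstoD[OF er]) (use c in simp)
  ultimately have "\<forall>\<^sub>F n in sequentially. False"
  proof eventually_elim
    case (elim n)
    have "dist l (e (r n)) \<le> c" using elim(2) by (simp add: dist_commute)
    with c have "\<forall>x\<in>D. c * (norm x)\<^sup>2 \<le> cmod (cinner (A x - e (r n) *\<^sub>C x) x)" by blast
    from bspec[OF this yD[of "r n"]] have "c \<le> cmod (cinner (A (y (r n)) - e (r n) *\<^sub>C y (r n)) (y (r n)))"
      by (simp add: y(2))
    also have "\<dots> = cmod (cinner (B (y (r n))) (y (r n)))" by (simp add: id)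
    also have "\<dots> \<le> norm (B (y (r n))) * norm (y (r n))" by (rule cinner_bound)
    finally show False using elim(1) by (simp add: y(2))
  qed
  then show False by simp
qed

text \<open>If every constant and every starting index failed, the offending shifts would accumulate
  at some \<open>l\<close> in \<open>C\<close>, but \<open>stable_point\<close> covers a whole disc
  around \<open>l\<close>.\<close>

lemma stable_on_compact:
  assumes C: "compact C" "\<And>z. z \<in> C \<Longrightarrow> z \<notin> nr_hull \<and> \<not> eigen z"
  shows "\<exists>c>0. \<exists>N. \<forall>n\<ge>N. \<forall>z\<in>C. \<forall>x\<in>Hs n. c * norm x \<le> norm (G n z x)"
proof (rule ccontr)
  assume no: "\<not> ?thesis"
  have "\<forall>j. \<exists>z. z \<in> C \<and> (\<exists>n\<ge>j. \<exists>x\<in>Hs n. norm (G n z x) < 1 / real (Suc j) * norm x)"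
  proof
    fix j
    have "1 / real (Suc j) > 0" by simp
    with no have "\<not> (\<forall>n\<ge>j. \<forall>z\<in>C. \<forall>x\<in>Hs n. 1 / real (Suc j) * norm x \<le> norm (G n z x))" by blast
    then show "\<exists>z. z \<in> C \<and> (\<exists>n\<ge>j. \<exists>x\<in>Hs n. norm (G n z x) < 1 / real (Suc j) * norm x)"
      unfolding not_le[symmetric] by blast
  qed
  from choice[OF this] obtain z where
    z: "\<forall>j. z j \<in> C \<and> (\<exists>n\<ge>j. \<exists>x\<in>Hs n. norm (G n (z j) x) < 1 / real (Suc j) * norm x)" ..
  then have "\<forall>j. z j \<in> C" by simp
  with C(1) obtain l r where lr: "l \<in> C" "strict_mono (r::nat \<Rightarrow> nat)" "(z \<circ> r) \<longlonglongrightarrow> l"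
    unfolding compact_def by blast
  have l: "l \<notin> nr_hull" "\<not> eigen l" using C(2)[OF lr(1)] by simp_all
  from stable_point[OF l] obtain \<epsilon> where e: "0 < \<epsilon> \<and> (\<exists>N. \<forall>n\<ge>N. \<forall>z. dist l z < \<epsilon> \<longrightarrow>
    (\<forall>x\<in>Hs n. \<epsilon> * norm x \<le> norm (G n z x)))" ..
  then obtain N where N: "\<forall>n\<ge>N. \<forall>z. dist l z < \<epsilon> \<longrightarrow> (\<forall>x\<in>Hs n. \<epsilon> * norm x \<le> norm (G n z x))" by (elim conjE exE)
  have \<epsilon>: "\<epsilon> > 0" using e by (rule conjunct1)
  have "\<forall>\<^sub>F j in sequentially. dist ((z \<circ> r) j) l < \<epsilon>" by (rule tendstoD[OF lr(3) \<epsilon>])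
  moreover have "\<forall>\<^sub>F j in sequentially. 1 / real (Suc j) < \<epsilon>"
    by (rule order_tendstoD(2)[OF _ \<epsilon>]) (use LIMSEQ_inverse_real_of_nat in \<open>simp add: inverse_eq_divide\<close>)
  moreover have "\<forall>\<^sub>F j in sequentially. N \<le> j" by (rule eventually_ge_at_top)
  ultimately have "\<forall>\<^sub>F j in sequentially. False"
  proof eventually_elim
    case (elim j)
    obtain n x where nx: "n \<ge> r j" "x \<in> Hs n" "norm (G n (z (r j)) x) < 1 / real (Suc (r j)) * norm x"
      using z by blast
    have rj: "j \<le> r j" by (rule seq_suble[OF lr(2)])
    have "\<epsilon> * norm x \<le> norm (G n (z (r j)) x)"
      using N nx(1,2) rj elim(1,3) by (simp add: dist_commute)
    also have "\<dots> \<le> 1 / real (Suc (r j)) * norm x" using nx(3) by simp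
    also have "\<dots> \<le> 1 / real (Suc j) * norm x" using rj by (intro mult_right_mono) (simp_all add: frac_le)
    finally have le: "\<epsilon> * norm x \<le> 1 / real (Suc j) * norm x" .
    have "x \<noteq> 0"
    proof
      assume "x = 0"
      with nx(3) have "norm (G n (z (r j)) x) < 0" by simp
      then show False by simp
    qed
    then have "norm x > 0" by simp
    with le have "\<epsilon> \<le> 1 / real (Suc j)" by (rule mult_right_le_imp_le)
    then show False using elim(2) by simp
  qed
  then show False by simp
qed

text \<open>On a small circle around \<open>l\<close>, which avoids the hull and all other
  eigenvalues, the compressions are stable with a common constant \<open>c\<close>. At the centre an
  approximation \<open>y j\<close> of a true eigenvector violates this constant in all later spaces,
  so \<open>chp_root_in_ball\<close> yields a Galerkin eigenvalue inside.\<close>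

lemma eigen_approximated:
  assumes l: "l \<notin> nr_hull" "eigen l" and \<eta>: "\<eta> > 0"
  shows "\<forall>\<^sub>F n in sequentially. \<exists>z. dist l z \<le> \<eta> \<and> chp n z = 0"
proof -
  from eigen_isolated[OF l(1)] obtain \<epsilon> where e: "\<epsilon> > 0 \<and> (\<forall>z. dist l z < \<epsilon> \<longrightarrow> eigen z \<longrightarrow> z = l)" ..
  from coercive[OF l(1)] obtain c0 where c0: "c0 > 0 \<and> (\<forall>z. dist l z \<le> c0 \<longrightarrow> z \<notin> nr_hull \<and>
    (\<forall>x\<in>D. c0 * (norm x)\<^sup>2 \<le> cmod (cinner (A x - z *\<^sub>C x) x)))" ..
  \<comment> \<open>The bound \<open>\<epsilon> / 2\<close> excludes other eigenvalues from the
    circle, and \<open>c0\<close> excludes the hull.\<close>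
  define \<rho> where "\<rho> = min \<eta> (min (\<epsilon> / 2) c0)"
  have \<rho>: "\<rho> > 0" "\<rho> \<le> \<eta>" "\<rho> < \<epsilon>" "\<rho> \<le> c0" using e c0 \<eta> by (auto simp: \<rho>_def min_def)
  have "\<exists>c>0. \<exists>N. \<forall>n\<ge>N. \<forall>z\<in>sphere l \<rho>. \<forall>x\<in>Hs n. c * norm x \<le> norm (G n z x)"
  proof (rule stable_on_compact)
    fix z assume "z \<in> sphere l \<rho>"
    then have z: "dist l z = \<rho>" by simp
    then have "z \<noteq> l" using \<rho>(1) by auto
    then show "z \<notin> nr_hull \<and> \<not> eigen z" using z \<rho>(3,4) e c0 by auto
  qed simp
  then obtain c where c1: "0 < c \<and> (\<exists>N. \<forall>n\<ge>N. \<forall>z\<in>sphere l \<rho>. \<forall>x\<in>Hs n. c * norm x \<le> norm (G n z x))" ..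
  then obtain N where N: "\<forall>n\<ge>N. \<forall>z\<in>sphere l \<rho>. \<forall>x\<in>Hs n. c * norm x \<le> norm (G n z x)" by (elim conjE exE)
  have c: "c > 0" using c1 by (rule conjunct1)
  obtain w where w: "w \<in> D" "norm w = 1" "H w = l *\<^sub>C w" using l(2) unfolding eigen_def by (elim exE conjE)
  obtain y m where y: "\<And>j. y j \<in> Hs (m j)" "y \<longlonglongrightarrow> w" "(\<lambda>j. H (y j)) \<longlonglongrightarrow> H w"
    using core_sequence[OF w(1)] by metis
  have "(\<lambda>j. norm (H (y j) - l *\<^sub>C y j) - c * norm (y j)) \<longlonglongrightarrow> norm (H w - l *\<^sub>C w) - c * norm w"
    by (intro tendsto_intros y(2,3))
  then have "(\<lambda>j. norm (H (y j) - l *\<^sub>C y j) - c * norm (y j)) \<longlonglongrightarrow> - c" using w by simp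
  then have "\<forall>\<^sub>F j in sequentially. norm (H (y j) - l *\<^sub>C y j) - c * norm (y j) < 0"
    by (rule order_tendstoD(2)) (use c in simp)
  then obtain j where j: "norm (H (y j) - l *\<^sub>C y j) < c * norm (y j)"
    by (auto simp: eventually_sequentially)
  define x where "x = complex_of_real (1 / norm (y j)) *\<^sub>C y j"
  have y0: "y j \<noteq> 0"
  proof
    assume "y j = 0"
    with j have "norm (H (y j) - l *\<^sub>C y j) < 0" by simp
    then show False by simp
  qed
  have "\<exists>z. dist l z \<le> \<eta> \<and> chp n z = 0" if n: "n \<ge> max N (m j)" for n
  proof -
    have yn: "y j \<in> Hs n" using Hs_mono[of "m j" n] y(1)[of j] n by (auto simp: subset_iff)
    have "\<exists>z. dist l z \<le> \<rho> \<and> chp n z = 0"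
    proof (rule chp_root_in_ball[OF \<rho>(1) c])
      show "c * norm x \<le> norm (G n z x)" if "dist l z = \<rho>" "x \<in> Hs n" for z x
        using N n that by simp
      show "x \<in> Hs n" unfolding x_def by (rule complex_vector.subspace_scale[OF Hs_subspace yn])
      show "norm x = 1" unfolding x_def by (rule normalize_in[OF y0])
      have "norm (G n l x) = norm (G n l (y j)) / norm (y j)"
        unfolding x_def G_scaleC[OF Hs_D[OF yn]] by (simp add: norm_divide)
      also have "\<dots> \<le> norm (H (y j) - l *\<^sub>C y j) / norm (y j)"
        by (intro divide_right_mono norm_G_le) simp
      also have "\<dots> < c" using j y0 by (simp add: pos_divide_less_eq)
      finally show "norm (G n l x) < c" .
    qed
    then show ?thesis using \<rho>(2) by (meson order_trans)
  qed
  then show ?thesis unfolding eventually_sequentially by blast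
qed

end

subsection \<open>Locating the roots of a characteristic polynomial on a grid\<close>

text \<open>The coordinates are quotients of integers, so that every grid point is expressible
  without reading any input.\<close>

definition grid :: "nat \<Rightarrow> int \<Rightarrow> complex set" where
  "grid N M = (\<lambda>(a, b). of_int a / of_nat N + \<i> * (of_int b / of_nat N)) ` ({-M..M} \<times> {-M..M})"

definition round_grid :: "nat \<Rightarrow> complex \<Rightarrow> complex" where
  "round_grid N z = of_int \<lfloor>real N * Re z\<rfloor> / of_nat N + \<i> * (of_int \<lfloor>real N * Im z\<rfloor> / of_nat N)"

lemma finite_grid: "finite (grid N M)"
  by (simp add: grid_def)

lemma expressible_grid:
  assumes "c \<in> grid N M"
  shows "expressible A (\<lambda>v. c)"
proof -
  obtain a b where c: "c = of_int a / of_nat N + \<i> * (of_int b / of_nat N)"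
    using assms unfolding grid_def by auto
  show ?thesis
    unfolding c
    by (intro expressible_add expressible_mult expressible_divide expressible_ii expressible_of_int expressible_of_nat)
qed

lemma floor_div_close:
  assumes "N > 0"
  shows "\<bar>real_of_int \<lfloor>real N * x\<rfloor> / real N - x\<bar> \<le> 1 / real N"
proof -
  have "real N * \<bar>real_of_int \<lfloor>real N * x\<rfloor> / real N - x\<bar> = \<bar>real_of_int \<lfloor>real N * x\<rfloor> - real N * x\<bar>"
    using assms by (simp add: abs_mult_pos' right_diff_distrib)
  also have "\<dots> \<le> 1" by linarith
  finally show ?thesis using assms by (simp add: pos_le_divide_eq mult.commute)
qed

lemma dist_round_grid:
  assumes "N > 0"
  shows "dist (round_grid N z) z \<le> 2 / real N"
proof -
  have re: "Re (round_grid N z) = real_of_int \<lfloor>real N * Re z\<rfloor> / real N"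
    and im: "Im (round_grid N z) = real_of_int \<lfloor>real N * Im z\<rfloor> / real N"
    unfolding round_grid_def by (simp_all add: Re_divide_of_nat Im_divide_of_nat)
  have "dist (round_grid N z) z \<le> \<bar>Re (round_grid N z - z)\<bar> + \<bar>Im (round_grid N z - z)\<bar>"
    unfolding dist_norm by (rule cmod_le)
  also have "\<dots> \<le> 1 / real N + 1 / real N"
    unfolding minus_complex.sel re im by (intro add_mono floor_div_close assms)
  finally show ?thesis by simp
qed

lemma round_grid_in_grid:
  assumes "real N * cmod z + 1 \<le> real_of_int M"
  shows "round_grid N z \<in> grid N M"
proof -
  have bound: "\<lfloor>real N * x\<rfloor> \<in> {-M..M}" if "\<bar>x\<bar> \<le> cmod z" for x
  proof -
    have "\<bar>real N * x\<bar> \<le> real N * cmod z" using that by (simp add: abs_mult mult_left_mono)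
    then have "real N * x \<le> real_of_int M - 1" "- (real_of_int M - 1) \<le> real N * x" using assms by linarith+
    then show ?thesis by (auto simp: le_floor_iff floor_le_iff)
  qed
  show ?thesis
    unfolding grid_def round_grid_def
    by (rule image_eqI[of _ _ "(\<lfloor>real N * Re z\<rfloor>, \<lfloor>real N * Im z\<rfloor>)"])
       (use bound[OF abs_Re_le_cmod] bound[OF abs_Im_le_cmod] in simp_all)
qed

text \<open>The summand dominates \<open>cmod (a i j)\<close> and, unlike it, is an arithmetic expression in the entry.\<close>

definition entry_sum :: "nat \<Rightarrow> (nat \<Rightarrow> nat \<Rightarrow> complex) \<Rightarrow> real" where
  "entry_sum d a = (\<Sum>i<d. \<Sum>j<d. 1 + (cmod (a i j))\<^sup>2)"

text \<open>The eigenvector equation is read in a row where the coefficient has maximal modulus, as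
  in Gershgorin's theorem.\<close>

lemma charpoly_root_bound:
  assumes "charpoly d a z = 0"
  shows "cmod z \<le> entry_sum d a"
proof (rule charpoly_root_eigenvector[OF assms])
  fix c assume c: "\<exists>i<d. c i \<noteq> 0" "\<And>i. i < d \<Longrightarrow> (\<Sum>j<d. a i j * c j) = z * c i"
  then have ne: "{..<d} \<noteq> {}" by auto
  define m where "m = Max ((\<lambda>i. cmod (c i)) ` {..<d})"
  have "m \<in> (\<lambda>i. cmod (c i)) ` {..<d}" unfolding m_def using ne by (intro Max_in) auto
  then obtain i where i: "i < d" "m = cmod (c i)" by auto
  have le: "cmod (c j) \<le> m" if "j < d" for j unfolding m_def using that by (intro Max_ge) auto
  obtain j where "j < d" "c j \<noteq> 0" using c(1) by blast
  then have m0: "m > 0" using le[of j] by (metis zero_less_norm_iff less_le_trans)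
  have "cmod z * m = cmod (\<Sum>j<d. a i j * c j)" unfolding c(2)[OF i(1)] i(2) by (simp add: norm_mult)
  also have "\<dots> \<le> (\<Sum>j<d. cmod (a i j) * m)"
    by (rule sum_norm_le) (simp add: norm_mult mult_left_mono le)
  also have "\<dots> = (\<Sum>j<d. cmod (a i j)) * m" by (simp add: sum_distrib_right)
  finally have "cmod z \<le> (\<Sum>j<d. cmod (a i j))" using m0 by (rule mult_right_le_imp_le)
  also have "\<dots> \<le> (\<Sum>j<d. 1 + (cmod (a i j))\<^sup>2)"
  proof (rule sum_mono)
    fix j
    have "2 * cmod (a i j) * 1 \<le> (cmod (a i j))\<^sup>2 + 1\<^sup>2" by (rule sum_squares_bound)
    then show "cmod (a i j) \<le> 1 + (cmod (a i j))\<^sup>2" using norm_ge_zero[of "a i j"] unfolding power_one mult_1_right by linarith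
  qed
  also have "\<dots> \<le> entry_sum d a"
    unfolding entry_sum_def using i(1)
    by (intro member_le_sum[of i "{..<d}" "\<lambda>i. \<Sum>j<d. 1 + (cmod (a i j))\<^sup>2"]) (auto intro!: sum_nonneg)
  finally show ?thesis .
qed

lemma norm_charpoly_factorization:
  obtains xs where "length xs = d" "\<And>z. cmod (charpoly d a z) = (\<Prod>x\<leftarrow>xs. dist z x)"
    "\<And>x. charpoly d a x = 0 \<longleftrightarrow> x \<in> set xs"
proof -
  obtain xs where xs: "length xs = d" "\<And>z. charpoly d a z = (\<Prod>x\<leftarrow>xs. z - x)"
    by (rule charpoly_factorization[of d a]) blast
  have "cmod (\<Prod>x\<leftarrow>ys. z - x) = (\<Prod>x\<leftarrow>ys. dist z x)" for ys z
    by (induction ys) (simp_all add: norm_mult dist_norm)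
  moreover have "(\<Prod>x\<leftarrow>ys. z - x) = 0 \<longleftrightarrow> z \<in> set ys" for ys and z :: complex
    by (induction ys) auto
  ultimately show ?thesis using that[of xs] xs by simp
qed

text \<open>A product of \<open>d\<close> distances that are all at least \<open>\<delta>\<close> is
  at least \<open>\<delta> ^ d\<close>.\<close>

lemma charpoly_small_near_root:
  assumes "cmod (charpoly d a z) < \<delta> ^ d" "\<delta> > 0"
  shows "\<exists>x. charpoly d a x = 0 \<and> dist z x < \<delta>"
proof (rule norm_charpoly_factorization[of d a])
  fix xs assume xs: "length xs = d" "\<And>z. cmod (charpoly d a z) = (\<Prod>x\<leftarrow>xs. dist z x)"
    "\<And>x. charpoly d a x = 0 \<longleftrightarrow> x \<in> set xs"
  have "\<delta> ^ length ys \<le> (\<Prod>x\<leftarrow>ys. dist z x)" if "\<forall>x\<in>set ys. \<delta> \<le> dist z x" for ys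
    using that
  proof (induction ys)
    case (Cons y ys)
    then show ?case using assms(2) by (auto intro!: mult_mono)
  qed simp
  then have "\<not> (\<forall>x\<in>set xs. \<delta> \<le> dist z x)" using assms(1) xs(1,2) by force
  then show ?thesis using xs(3) by (auto simp: not_le)
qed

text \<open>One factor of the polynomial is \<open>dist z x\<close>, and every other one is at most
  \<open>r + entry_sum d a\<close> because all roots are bounded by \<open>entry_sum d a\<close>. As
  this number is at least \<open>1\<close>, the exponent \<open>d\<close> may stand in for
  \<open>d - 1\<close>.\<close>

lemma charpoly_bound_near_root:
  assumes x: "charpoly d a x = 0" and z: "cmod z \<le> r" and r: "1 \<le> r + entry_sum d a"
  shows "cmod (charpoly d a z) \<le> dist z x * (r + entry_sum d a) ^ d"
proof (rule norm_charpoly_factorization[of d a])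
  fix xs assume xs: "length xs = d" "\<And>z. cmod (charpoly d a z) = (\<Prod>x\<leftarrow>xs. dist z x)"
    "\<And>x. charpoly d a x = 0 \<longleftrightarrow> x \<in> set xs"
  define b where "b = r + entry_sum d a"
  have b: "dist z y \<le> b" if "y \<in> set xs" for y
  proof -
    have "cmod y \<le> entry_sum d a" using charpoly_root_bound xs(3) that by blast
    then show ?thesis using z norm_triangle_ineq4[of z y] by (simp add: b_def dist_norm)
  qed
  have b1: "1 \<le> b" using r by (simp add: b_def)
  have prod_le: "0 \<le> (\<Prod>y\<leftarrow>ys. dist z y) \<and> (\<Prod>y\<leftarrow>ys. dist z y) \<le> b ^ length ys" if "set ys \<subseteq> set xs" for ys
    using that
  proof (induction ys)
    case (Cons y ys)
    then have "dist z y * (\<Prod>y\<leftarrow>ys. dist z y) \<le> b * b ^ length ys"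
      using b[of y] b1 by (intro mult_mono) auto
    then show ?case using Cons by simp
  qed simp
  have "x \<in> set xs" using x xs(3) by blast
  then obtain ys zs where split: "xs = ys @ x # zs" by (auto simp: in_set_conv_decomp)
  have ys: "0 \<le> (\<Prod>y\<leftarrow>ys. dist z y) \<and> (\<Prod>y\<leftarrow>ys. dist z y) \<le> b ^ length ys"
    and zs: "0 \<le> (\<Prod>y\<leftarrow>zs. dist z y) \<and> (\<Prod>y\<leftarrow>zs. dist z y) \<le> b ^ length zs"
    by (rule prod_le; simp add: split subset_iff)+
  have "(\<Prod>y\<leftarrow>xs. dist z y) = dist z x * ((\<Prod>y\<leftarrow>ys. dist z y) * (\<Prod>y\<leftarrow>zs. dist z y))"
    by (simp add: split)
  also have "\<dots> \<le> dist z x * (b ^ length ys * b ^ length zs)"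
    using ys zs b1 by (intro mult_left_mono mult_mono) simp_all
  also have "\<dots> \<le> dist z x * b ^ d"
  proof (rule mult_left_mono)
    have "b ^ length ys * b ^ length zs = b ^ (length ys + length zs)" by (simp add: power_add)
    also have "\<dots> \<le> b ^ d" using b1 xs(1) by (intro power_increasing) (simp_all add: split)
    finally show "b ^ length ys * b ^ length zs \<le> b ^ d" .
  qed simp
  finally show ?thesis by (simp only: xs(2) b_def)
qed

text \<open>The witness is \<open>x\<close> rounded to the grid. Rounding moves it by at most
  \<open>2 / N\<close>, hence the factor \<open>2\<close> in the hypothesis on \<open>N\<close>, and
  by at most \<open>2\<close>, hence \<open>n + 3\<close>. The grid extends to \<open>n + 2\<close>
  because rounding down may exceed the modulus \<open>n + 1\<close> by one mesh width.\<close>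

lemma charpoly_root_on_grid:
  fixes n N :: nat
  defines "\<delta> \<equiv> 1 / real (Suc n)"
  assumes x: "charpoly d a x = 0" "cmod x \<le> real n + 1"
    and N: "2 * (real n + 3 + entry_sum d a) ^ d < real N * \<delta> ^ d"
  shows "\<exists>z\<in>grid N (int (N * (n + 2))). cmod (charpoly d a z) < \<delta> ^ d \<and> dist z x < \<delta>"
proof -
  have \<delta>: "0 < \<delta>" "\<delta> \<le> 1" by (simp_all add: \<delta>_def)
  define b where "b = real n + 3 + entry_sum d a"
  have e0: "0 \<le> entry_sum d a" unfolding entry_sum_def by (intro sum_nonneg) simp
  have b1: "1 \<le> b" using e0 by (simp add: b_def)
  then have bd: "1 \<le> b ^ d" by (rule one_le_power)
  have N': "2 * b ^ d < real N * \<delta> ^ d" using N by (simp only: b_def)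
  have "N \<noteq> 0"
  proof
    assume "N = 0"
    then have "2 * b ^ d < 0" using N' by (simp only: of_nat_0 mult_zero_left)
    with bd show False by linarith
  qed
  then have N0: "N > 0" by simp
  \<comment> \<open>For \<open>d = 0\<close> the polynomial is the constant \<open>1\<close>,
    without roots; a positive degree is used for \<open>\<delta> ^ d \<le> \<delta>\<close>.\<close>
  have d0: "d \<noteq> 0"
  proof
    assume "d = 0"
    then show False using x(1) by (simp add: charpoly_def permutes_empty)
  qed
  define z where "z = round_grid N x"
  have dz: "dist z x \<le> 2 / real N" unfolding z_def by (rule dist_round_grid[OF N0])
  have small: "2 / real N * b ^ d < \<delta> ^ d" using N' N0 by (simp add: pos_divide_less_eq mult.commute)
  have "real N * cmod x + 1 \<le> real_of_int (int (N * (n + 2)))"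
  proof -
    have "real N * cmod x \<le> real N * (real n + 1)" using x(2) by (intro mult_left_mono) simp_all
    moreover have "1 \<le> real N" using N0 by simp
    ultimately have "real N * cmod x + 1 \<le> real N * (real n + 1) + real N" by linarith
    also have "\<dots> = real_of_int (int (N * (n + 2)))" by (simp add: algebra_simps)
    finally show ?thesis .
  qed
  then have "z \<in> grid N (int (N * (n + 2)))" unfolding z_def by (rule round_grid_in_grid)
  moreover have "cmod (charpoly d a z) < \<delta> ^ d"
  proof -
    have "2 / real N \<le> 2" using N0 by (simp add: field_simps)
    then have "cmod z \<le> real n + 3" using dz x(2) norm_triangle_ineq2[of z x] by (simp add: dist_norm)
    then have "cmod (charpoly d a z) \<le> dist z x * b ^ d"
      unfolding b_def by (rule charpoly_bound_near_root[OF x(1)]) (use b1 in \<open>simp add: b_def\<close>)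
    also have "\<dots> \<le> 2 / real N * b ^ d" using dz bd by (intro mult_right_mono) simp_all
    finally show ?thesis using small by simp
  qed
  moreover have "dist z x < \<delta>"
  proof -
    have "2 / real N * 1 \<le> 2 / real N * b ^ d" using bd by (intro mult_left_mono) simp_all
    also have "\<dots> < \<delta> ^ d" by (rule small)
    also have "\<delta> ^ d \<le> \<delta> ^ 1" using d0 \<delta> by (intro power_decreasing) simp_all
    finally show ?thesis using dz by simp
  qed
  ultimately show ?thesis by blast
qed

subsection \<open>The approximating algorithm\<close>

definition rayleigh :: "nat \<Rightarrow> (nat \<Rightarrow> nat \<Rightarrow> complex) \<Rightarrow> (nat \<Rightarrow> complex) \<Rightarrow> complex" where
  "rayleigh d a c = (\<Sum>j<d. \<Sum>i<d. c j * cnj (c i) * a i j) / (\<Sum>i<d. complex_of_real ((cmod (c i))\<^sup>2))"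

text \<open>Zero coefficient vectors are excluded because the quotient would be the junk value \<open>0/0 = 0\<close>.\<close>

definition samples :: "nat \<Rightarrow> nat \<Rightarrow> (nat \<Rightarrow> complex) set" where
  "samples d n = {c \<in> {..<d} \<rightarrow>\<^sub>E grid (Suc n) (int (Suc n * Suc n)). \<exists>i<d. c i \<noteq> 0}"

lemma finite_samples: "finite (samples d n)"
proof -
  have "finite ({..<d} \<rightarrow>\<^sub>E grid (Suc n) (int (Suc n * Suc n)))"
    by (intro finite_PiE finite_grid) simp
  then show ?thesis unfolding samples_def by simp
qed

text \<open>The characteristic polynomial is the product of the \<open>d n\<close> distances to the eigenvalues, so that a grid
  point satisfying the inequality is within \<open>1 / (n + 1)\<close> of an eigenvalue. Conversely, if the mesh
  \<open>1 / N\<close> is \<open>fine_enough\<close>, every eigenvalue of modulus at most \<open>n + 1\<close> is near such a grid point.\<close>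

definition approx_points ::
  "(nat \<Rightarrow> nat) \<Rightarrow> (nat \<Rightarrow> nat \<Rightarrow> nat \<Rightarrow> complex) \<Rightarrow> (nat \<Rightarrow> nat \<Rightarrow> nat \<Rightarrow> complex) \<Rightarrow> nat \<Rightarrow> nat \<Rightarrow> complex set" where
  "approx_points d a b n N = (\<Union>m\<le>n. rayleigh (d m) (a m) ` samples (d m) n) \<union>
     {z \<in> grid N (int (N * (n + 2))).
       cmod (charpoly (d n) (\<lambda>i j. a n i j + b n i j) z) < (1 / real (Suc n)) ^ d n}"

text \<open>The hypothesis of \<open>charpoly_root_on_grid\<close>, arranged as an inequality that
  an algorithm can test: the entries occur only through their squared moduli.\<close>

definition fine_enough :: "nat \<Rightarrow> (nat \<Rightarrow> nat \<Rightarrow> complex) \<Rightarrow> nat \<Rightarrow> nat \<Rightarrow> bool" where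
  "fine_enough d a n N \<longleftrightarrow> 2 * (real n + 3 + entry_sum d a) ^ d < real N * (1 / real (Suc n)) ^ d"

lemma fine_enough_exists: "\<exists>N. fine_enough d a n N"
proof -
  obtain N where "2 * (real n + 3 + entry_sum d a) ^ d / (1 / real (Suc n)) ^ d < real N"
    using reals_Archimedean2 by blast
  then have "fine_enough d a n N" unfolding fine_enough_def by (subst (asm) pos_divide_less_eq) simp_all
  then show ?thesis ..
qed

lemma expressible_signof: "expressible A (\<lambda>v. signof p)"
  using expressible_of_int[of A "sign p"] by simp

text \<open>Each inequality is encoded as positivity of the real part of an arithmetic expression.
  The data \<open>v\<close> are arbitrary here and need not come from an operator, so that the
  statement is purely algebraic.\<close>

lemma exists_approx_computation:
  fixes a b :: "nat \<Rightarrow> nat \<Rightarrow> nat \<Rightarrow> 'f" and d :: "nat \<Rightarrow> nat"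
  assumes A: "\<And>m i j. m \<le> n \<Longrightarrow> i < d m \<Longrightarrow> j < d m \<Longrightarrow> a m i j \<in> A \<and> b m i j \<in> A"
  shows "\<exists>p. \<forall>v. \<exists>F zs N. F \<subseteq> A \<and> computes v p F zs \<and>
    fine_enough (d n) (\<lambda>i j. v (a n i j) + v (b n i j)) n N \<and>
    set zs = approx_points d (\<lambda>m i j. v (a m i j)) (\<lambda>m i j. v (b m i j)) n N"
proof -
  define ent where "ent v i j = v (a n i j) + v (b n i j)" for v :: "'f \<Rightarrow> complex" and i j
  have ent: "expressible A (\<lambda>v. ent v i j)" if "i < d n" "j < d n" for i j
    unfolding ent_def using A[OF order_refl that] by (intro expressible_add expressible_input) simp_all
  define test where "test N v = of_nat N * (1 / of_nat (Suc n)) ^ d n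
      - (1 + 1) * (of_nat n + of_nat 3 + (\<Sum>i<d n. \<Sum>j<d n. 1 + complex_of_real ((cmod (ent v i j))\<^sup>2))) ^ d n" for N v
  have test: "expressible A (test N)" for N
    unfolding test_def
    by (intro expressible_diff expressible_mult expressible_add expressible_power expressible_divide expressible_sum
        expressible_1 expressible_of_nat expressible_norm_square ent) simp_all
  have test_real: "test N v = complex_of_real (real N * (1 / real (Suc n)) ^ d n - 2 * (real n + 3 + entry_sum (d n) (ent v)) ^ d n)" for N v
    by (simp add: test_def entry_sum_def)
  have test_iff: "Re (test N v) > 0 \<longleftrightarrow> fine_enough (d n) (ent v) n N" for N v
    unfolding test_real fine_enough_def by simp
  define Gr where "Gr N = grid N (int (N * (n + 2)))" for N
  \<comment> \<open>Both sides are squared, since the square of a modulus is arithmetic and the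
    modulus itself is not; hence the exponent \<open>2 * d n\<close>.\<close>
  define accept where "accept N z v = (1 / of_nat (Suc n)) ^ (2 * d n) - complex_of_real ((cmod (charpoly (d n) (ent v) z))\<^sup>2)"
    for N :: nat and z v
  have accept: "expressible A (accept N z)" if z: "z \<in> Gr N" for N z
  proof -
    have zc: "expressible A (\<lambda>v. if P then z else 0)" for P
      using expressible_grid[of z N _ A] z expressible_0[of A] unfolding Gr_def by (cases P) simp_all
    have "expressible A (\<lambda>v. charpoly (d n) (ent v) z)"
      unfolding charpoly_def
    proof (intro expressible_sum expressible_mult expressible_signof expressible_prod expressible_diff zc ent)
      fix p i assume "p \<in> {p. p permutes {0..<d n}}" "i \<in> {0..<d n}"
      then show "i < d n" "p i < d n" using permutes_in_image[of p "{0..<d n}" i] by simp_all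
    qed
    then show ?thesis unfolding accept_def
      by (intro expressible_diff expressible_power expressible_divide expressible_1 expressible_of_nat expressible_norm_square)
  qed
  have accept_iff: "Re (accept N z v) > 0 \<longleftrightarrow> cmod (charpoly (d n) (ent v) z) < (1 / real (Suc n)) ^ d n" for N z v
  proof -
    have "accept N z v = complex_of_real (((1 / real (Suc n)) ^ d n)\<^sup>2 - (cmod (charpoly (d n) (ent v) z))\<^sup>2)"
      by (simp add: accept_def power_mult[symmetric] mult.commute)
    then have "Re (accept N z v) > 0 \<longleftrightarrow> (cmod (charpoly (d n) (ent v) z))\<^sup>2 < ((1 / real (Suc n)) ^ d n)\<^sup>2" by simp
    also have "\<dots> \<longleftrightarrow> cmod (charpoly (d n) (ent v) z) < (1 / real (Suc n)) ^ d n"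
    proof
      assume "(cmod (charpoly (d n) (ent v) z))\<^sup>2 < ((1 / real (Suc n)) ^ d n)\<^sup>2"
      then show "cmod (charpoly (d n) (ent v) z) < (1 / real (Suc n)) ^ d n"
        by (rule power2_less_imp_less) simp
    next
      assume "cmod (charpoly (d n) (ent v) z) < (1 / real (Suc n)) ^ d n"
      then show "(cmod (charpoly (d n) (ent v) z))\<^sup>2 < ((1 / real (Suc n)) ^ d n)\<^sup>2"
        by (rule power_strict_mono) simp_all
    qed
    finally show ?thesis .
  qed
  define R where "R = (\<Union>m\<le>n. (\<lambda>c v. rayleigh (d m) (\<lambda>i j. v (a m i j)) c) ` samples (d m) n)"
  have R: "finite R" unfolding R_def by (intro finite_UN_I finite_imageI finite_samples) simp
  have R_expr: "expressible A g" if "g \<in> R" for g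
  proof -
    from that obtain m where m: "m \<in> {..n}" "g \<in> (\<lambda>c v. rayleigh (d m) (\<lambda>i j. v (a m i j)) c) ` samples (d m) n"
      unfolding R_def by (rule UN_E)
    from m(2) obtain c where c: "g = (\<lambda>v. rayleigh (d m) (\<lambda>i j. v (a m i j)) c)" "c \<in> samples (d m) n"
      by (rule imageE)
    note mc = m(1)[unfolded atMost_iff] c(2) c(1)
    have c: "expressible A (\<lambda>v. c i)" if "i < d m" for i
    proof (rule expressible_grid)
      show "c i \<in> grid (Suc n) (int (Suc n * Suc n))" using mc(2) that unfolding samples_def by auto
    qed
    have av: "expressible A (\<lambda>v. v (a m i j))" if "i < d m" "j < d m" for i j
      using A[OF mc(1) that] by (intro expressible_input) simp
    show ?thesis
      unfolding mc(3) rayleigh_def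
      by (intro expressible_divide expressible_sum expressible_mult expressible_cnj expressible_norm_square c av) simp_all
  qed
  have Gfin: "finite (Gr N)" for N unfolding Gr_def by (rule finite_grid)
  have Gexpr: "expressible A (\<lambda>v. c)" if "c \<in> Gr N" for N c using that unfolding Gr_def by (rule expressible_grid)
  show ?thesis
  proof (rule exists_search_computation[OF test Gfin Gexpr accept R R_expr])
    fix p assume p: "\<And>v m. Re (test m v) > 0 \<Longrightarrow> \<exists>F zs k. F \<subseteq> A \<and> computes v p F zs \<and> Re (test k v) > 0 \<and>
      set zs = (\<lambda>g. g v) ` R \<union> {c \<in> Gr k. Re (accept k c v) > 0}"
    show ?thesis
    proof (rule exI[of _ p], rule allI)
      fix v
      from fine_enough_exists obtain m where "fine_enough (d n) (ent v) n m" ..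
      then have "Re (test m v) > 0" by (simp only: test_iff)
      from p[OF this] obtain F zs N where Fz: "F \<subseteq> A" "computes v p F zs" "Re (test N v) > 0"
        "set zs = (\<lambda>g. g v) ` R \<union> {c \<in> Gr N. Re (accept N c v) > 0}" by (elim exE conjE)
      have "(\<lambda>g. g v) ` R = (\<Union>m\<le>n. rayleigh (d m) (\<lambda>i j. v (a m i j)) ` samples (d m) n)"
        unfolding R_def by (simp add: image_UN image_image)
      moreover have "{c \<in> Gr N. Re (accept N c v) > 0} = {z \<in> grid N (int (N * (n + 2))).
          cmod (charpoly (d n) (\<lambda>i j. v (a n i j) + v (b n i j)) z) < (1 / real (Suc n)) ^ d n}"
        unfolding accept_iff Gr_def ent_def ..
      ultimately have "set zs = approx_points d (\<lambda>m i j. v (a m i j)) (\<lambda>m i j. v (b m i j)) n N"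
        unfolding Fz(4) approx_points_def by (simp only:)
      moreover have "fine_enough (d n) (\<lambda>i j. v (a n i j) + v (b n i j)) n N"
        using Fz(3) unfolding test_iff ent_def .
      ultimately show "\<exists>F zs N. F \<subseteq> A \<and> computes v p F zs \<and>
        fine_enough (d n) (\<lambda>i j. v (a n i j) + v (b n i j)) n N \<and>
        set zs = approx_points d (\<lambda>m i j. v (a m i j)) (\<lambda>m i j. v (b m i j)) n N"
        using Fz(1,2) by (intro exI[of _ F] exI[of _ zs] exI[of _ N] conjI)
    qed
  qed
qed

context galerkin
begin

definition T_entry where "T_entry n i j = cinner (A (f n j)) (f n i)"
definition V_entry where "V_entry n i j = cinner (B (f n j)) (f n i)"

lemma entry_eq: "entry n = (\<lambda>i j. T_entry n i j + V_entry n i j)"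
  by (intro ext) (simp add: entry_def T_entry_def V_entry_def H_def cinner_add_left)

section \<open>Rayleigh quotients of the compressions fill the hull\<close>

lemma rayleigh_cvec:
  "rayleigh (d m) (T_entry m) c = cinner (A (cvec m c)) (cvec m c) / complex_of_real ((norm (cvec m c))\<^sup>2)"
proof -
  have "A (cvec m c) = (\<Sum>j<d m. c j *\<^sub>C A (f m j))"
    unfolding cvec_def
  proof (subst A_sum)
    show "c j *\<^sub>C f m j \<in> D" if "j \<in> {..<d m}" for j
      using that by (intro D_scaleC Hs_D[OF f_Hs]) simp
    show "(\<Sum>j<d m. A (c j *\<^sub>C f m j)) = (\<Sum>j<d m. c j *\<^sub>C A (f m j))"
      by (intro sum.cong refl A_scaleC Hs_D[OF f_Hs]) simp
  qed
  then have "cinner (A (cvec m c)) (cvec m c) = (\<Sum>j<d m. \<Sum>i<d m. c j * cnj (c i) * T_entry m i j)"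
    by (simp add: cvec_def cinner_sum_left cinner_sum_right cinner_scaleC_left cinner_scaleC_right T_entry_def
        sum_distrib_left mult_ac) (rule sum.swap)
  moreover have "(norm (cvec m c))\<^sup>2 = (\<Sum>i<d m. (cmod (c i))\<^sup>2)"
    unfolding cvec_def by (rule norm_orthonormal_sum) (simp_all add: basis)
  ultimately show ?thesis by (simp add: rayleigh_def)
qed

lemma cvec_nonzero: "i < d m \<Longrightarrow> c i \<noteq> 0 \<Longrightarrow> cvec m c \<noteq> 0"
  using cinner_cvec[of i m c] by auto

lemma rayleigh_hull: "i < d m \<Longrightarrow> c i \<noteq> 0 \<Longrightarrow> rayleigh (d m) (T_entry m) c \<in> nr_hull"
  unfolding rayleigh_cvec by (intro rayleigh_in_hull Hs_D[OF cvec_Hs] cvec_nonzero)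

text \<open>The Rayleigh quotient is continuous in the graph norm at nonzero vectors, so a unit
  vector of \<open>D\<close> may be replaced by a core approximant, which has finitely many
  coefficients.\<close>

lemma rayleigh_dense:
  assumes l: "l \<in> nr_hull" and \<epsilon>: "\<epsilon> > 0"
  shows "\<exists>m c. (\<exists>i<d m. c i \<noteq> 0) \<and> dist (rayleigh (d m) (T_entry m) c) l < \<epsilon>"
proof -
  obtain r where r: "l = complex_of_real r" "r \<in> closure num_range" using l unfolding nr_hull_def by blast
  obtain q where "q \<in> num_range" "dist q r < \<epsilon>" using r(2) \<epsilon> unfolding closure_approachable by blast
  then obtain x where x: "x \<in> D" "norm x = 1" "dist (Re (cinner (A x) x)) r < \<epsilon>" unfolding num_range_def by blast
  have "dist (cinner (A x) x) l < \<epsilon>"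
    unfolding r(1) using x(3) by (subst cinner_A_real[OF x(1)]) (simp only: dist_of_real)
  obtain y m where y: "\<And>j. y j \<in> Hs (m j)" "y \<longlonglongrightarrow> x" "(\<lambda>j. H (y j)) \<longlonglongrightarrow> H x"
    using core_sequence[OF x(1)] by metis
  \<comment> \<open>\<open>core_sequence\<close> speaks of \<open>H\<close>; convergence of
    \<open>A (y j)\<close> is recovered by subtracting the bounded part.\<close>
  have "(\<lambda>j. H (y j) - B (y j)) \<longlonglongrightarrow> H x - B x" by (intro tendsto_intros y(3) tendsto_B y(2))
  then have Ay: "(\<lambda>j. A (y j)) \<longlonglongrightarrow> A x" by (simp add: H_def)
  have "(\<lambda>j. cinner (A (y j)) (y j) / complex_of_real ((norm (y j))\<^sup>2)) \<longlonglongrightarrow> cinner (A x) x / complex_of_real ((norm x)\<^sup>2)"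
    by (intro tendsto_intros Ay y(2)) (simp add: x(2))
  then have "(\<lambda>j. cinner (A (y j)) (y j) / complex_of_real ((norm (y j))\<^sup>2)) \<longlonglongrightarrow> cinner (A x) x" by (simp add: x(2))
  then have "(\<lambda>j. dist (cinner (A (y j)) (y j) / complex_of_real ((norm (y j))\<^sup>2)) l) \<longlonglongrightarrow> dist (cinner (A x) x) l"
    by (intro tendsto_intros)
  then have "\<forall>\<^sub>F j in sequentially. dist (cinner (A (y j)) (y j) / complex_of_real ((norm (y j))\<^sup>2)) l < \<epsilon>"
    by (rule order_tendstoD(2)) fact
  moreover have "\<forall>\<^sub>F j in sequentially. norm (y j) > 0"
    by (rule order_tendstoD(1)[OF tendsto_norm[OF y(2)]]) (simp add: x(2))
  ultimately have "\<forall>\<^sub>F j in sequentially. dist (cinner (A (y j)) (y j) / complex_of_real ((norm (y j))\<^sup>2)) l < \<epsilon> \<and> norm (y j) > 0"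
    by (rule eventually_conj)
  then obtain j where j: "dist (cinner (A (y j)) (y j) / complex_of_real ((norm (y j))\<^sup>2)) l < \<epsilon>" "norm (y j) > 0"
    by (auto simp: eventually_sequentially)
  define c where "c i = cinner (y j) (f (m j) i)" for i
  have yc: "y j = cvec (m j) c" unfolding c_def by (rule cvec_coefficients[OF y(1)])
  have "\<exists>i<d (m j). c i \<noteq> 0"
  proof (rule ccontr)
    assume "\<not> ?thesis"
    then have "cvec (m j) c = 0" unfolding cvec_def by (intro sum.neutral) simp
    then show False using j(2) yc by simp
  qed
  moreover have "dist (rayleigh (d (m j)) (T_entry (m j)) c) l < \<epsilon>"
    using j(1) unfolding rayleigh_cvec yc[symmetric] .
  ultimately show ?thesis by blast
qed

text \<open>The coefficients are rounded to ever finer and larger grids while the space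
  \<open>Hs m\<close> stays fixed. This is why the quotients of all spaces with
  \<open>m \<le> n\<close> are collected at stage \<open>n\<close>.\<close>

lemma samples_dense:
  assumes l: "l \<in> nr_hull" and \<epsilon>: "\<epsilon> > 0"
  shows "\<forall>\<^sub>F n in sequentially. \<exists>m\<le>n. \<exists>c\<in>samples (d m) n. dist (rayleigh (d m) (T_entry m) c) l < \<epsilon>"
proof -
  obtain m c i where mc: "i < d m" "c i \<noteq> 0" "dist (rayleigh (d m) (T_entry m) c) l < \<epsilon>"
    using rayleigh_dense[OF l \<epsilon>] by blast
  define c' where "c' n = (\<lambda>j\<in>{..<d m}. round_grid (Suc n) (c j))" for n
  have lim: "(\<lambda>n. c' n j) \<longlonglongrightarrow> c j" if "j < d m" for j
  proof -
    have "(\<lambda>n. (c' n j - c j) / 2) \<longlonglongrightarrow> 0"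
    proof (rule tendsto_zero_if_le_inverse_Suc)
      show "norm ((c' n j - c j) / 2) \<le> 1 / real (Suc n)" for n
        using dist_round_grid[of "Suc n" "c j"] that by (simp add: c'_def dist_norm norm_divide)
    qed
    from tendsto_mult[OF this tendsto_const[of 2]] have "(\<lambda>n. (c' n j - c j) / 2 * 2) \<longlonglongrightarrow> 0" by (simp only: mult_zero_left)
    moreover have "(c' n j - c j) / 2 * 2 = c' n j - c j" for n by simp
    ultimately have "(\<lambda>n. c' n j - c j) \<longlonglongrightarrow> 0" by (simp only:)
    then show ?thesis by (rule LIM_zero_cancel)
  qed
  have den: "(\<Sum>j<d m. complex_of_real ((cmod (c j))\<^sup>2)) \<noteq> 0"
  proof
    assume "(\<Sum>j<d m. complex_of_real ((cmod (c j))\<^sup>2)) = 0"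
    then have "complex_of_real (\<Sum>j<d m. (cmod (c j))\<^sup>2) = 0" by simp
    then have "(\<Sum>j<d m. (cmod (c j))\<^sup>2) = 0" by (simp only: of_real_eq_0_iff)
    then have "\<forall>j\<in>{..<d m}. (cmod (c j))\<^sup>2 = 0" by (subst (asm) sum_nonneg_eq_0_iff) simp_all
    then show False using mc(1,2) by simp
  qed
  have "(\<lambda>n. rayleigh (d m) (T_entry m) (c' n)) \<longlonglongrightarrow> rayleigh (d m) (T_entry m) c"
    unfolding rayleigh_def by (intro tendsto_intros lim den) simp_all
  then have "(\<lambda>n. dist (rayleigh (d m) (T_entry m) (c' n)) l) \<longlonglongrightarrow> dist (rayleigh (d m) (T_entry m) c) l"
    by (intro tendsto_intros)
  then have ev1: "\<forall>\<^sub>F n in sequentially. dist (rayleigh (d m) (T_entry m) (c' n)) l < \<epsilon>"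
    by (rule order_tendstoD(2)) (rule mc(3))
  have "(\<lambda>n. norm (c' n i)) \<longlonglongrightarrow> norm (c i)" by (intro tendsto_norm lim mc(1))
  then have ev2: "\<forall>\<^sub>F n in sequentially. 0 < norm (c' n i)"
    by (rule order_tendstoD(1)) (use mc(2) in simp)
  obtain N :: nat where N: "(\<Sum>j<d m. cmod (c j)) + 1 < real N" using reals_Archimedean2 by blast
  have ev3: "\<forall>\<^sub>F n in sequentially. max m N \<le> n" by (rule eventually_ge_at_top)
  show ?thesis
    using ev1 ev2 ev3
  proof eventually_elim
    case (elim n)
    have "c' n \<in> {..<d m} \<rightarrow>\<^sub>E grid (Suc n) (int (Suc n * Suc n))"
    proof (rule PiE_I)
      fix j assume j: "j \<in> {..<d m}"
      have "cmod (c j) \<le> (\<Sum>j<d m. cmod (c j))" using j by (intro member_le_sum) simp_all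
      then have "cmod (c j) + 1 \<le> real (Suc n)" using N elim(3) by simp
      then have "real (Suc n) * (cmod (c j) + 1) \<le> real (Suc n) * real (Suc n)" by (intro mult_left_mono) simp_all
      moreover have "real (Suc n) * cmod (c j) + 1 \<le> real (Suc n) * (cmod (c j) + 1)" by (simp add: algebra_simps)
      moreover have "real_of_int (int (Suc n * Suc n)) = real (Suc n) * real (Suc n)" by (simp only: of_int_of_nat_eq of_nat_mult of_int_mult)
      ultimately have "real (Suc n) * cmod (c j) + 1 \<le> real_of_int (int (Suc n * Suc n))" by linarith
      then have "round_grid (Suc n) (c j) \<in> grid (Suc n) (int (Suc n * Suc n))" by (rule round_grid_in_grid)
      then show "c' n j \<in> grid (Suc n) (int (Suc n * Suc n))" using j by (simp add: c'_def)
    qed (simp add: c'_def)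
    then have "c' n \<in> samples (d m) n" unfolding samples_def using mc(1) elim(2) by auto
    then show ?case using elim(1,3) by (intro exI[of _ m] conjI bexI[of _ "c' n"]) simp_all
  qed
qed

section \<open>Convergence of the approximating sets\<close>

lemma chp_nonzero_off_spectrum:
  assumes "compact C" "C \<inter> spectrum (op_add T V) = {}"
  shows "\<exists>N. \<forall>n\<ge>N. \<forall>z\<in>C. chp n z \<noteq> 0"
proof -
  have "z \<notin> nr_hull \<and> \<not> eigen z" if "z \<in> C" for z using that assms(2) unfolding spectrum_H by auto
  from stable_on_compact[OF assms(1) this] obtain c where c1: "0 < c \<and>
    (\<exists>N. \<forall>n\<ge>N. \<forall>z\<in>C. \<forall>x\<in>Hs n. c * norm x \<le> norm (G n z x))" ..
  then obtain N where N: "\<forall>n\<ge>N. \<forall>z\<in>C. \<forall>x\<in>Hs n. c * norm x \<le> norm (G n z x)" by (elim conjE exE)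
  have "chp n z \<noteq> 0" if nz: "n \<ge> N" "z \<in> C" for n z
  proof
    assume "chp n z = 0"
    then obtain x where "x \<in> Hs n" "norm x = 1" "G n z x = 0" by (rule chp_root)
    then show False using N nz c1 by force
  qed
  then show ?thesis by blast
qed

text \<open>Points of the hull are reached by sampled Rayleigh quotients, the remaining eigenvalues
  by Galerkin eigenvalues rounded to the grid. Conversely, a sampled quotient lies in the hull, and
  an accepted grid point is close to a Galerkin eigenvalue, which on bounded sets is eventually
  close to the spectrum. Any mesh passing the test will do, so \<open>N\<close> is
  arbitrary.\<close>

lemma approx_points_converge:
  assumes N: "\<And>n. fine_enough (d n) (\<lambda>i j. T_entry n i j + V_entry n i j) n (N n)"
    and S: "spectrum (op_add T V) \<noteq> {}"
  shows "limitin (mtopology_of closed_subsets_metric) (\<lambda>n. approx_points d T_entry V_entry n (N n))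
    (spectrum (op_add T V)) sequentially"
proof (rule attouch_wets_convergence[OF closed_spectrum_H S])
  let ?P = "\<lambda>n. approx_points d T_entry V_entry n (N n)"
  have P: "?P n = (\<Union>m\<le>n. rayleigh (d m) (T_entry m) ` samples (d m) n) \<union>
     {z \<in> grid (N n) (int (N n * (n + 2))). cmod (chp n z) < (1 / real (Suc n)) ^ d n}" for n
    unfolding approx_points_def chp_def entry_eq ..
  have "finite (?P n)" for n
    unfolding P by (intro finite_UnI finite_UN_I finite_imageI finite_samples) (simp_all add: finite_grid)
  then show "closed (?P n)" for n by (rule finite_imp_closed)
  have inv: "\<forall>\<^sub>F n in sequentially. 1 / real (Suc n) < \<epsilon>" if "\<epsilon> > 0" for \<epsilon>
    by (rule order_tendstoD(2)[OF _ that]) (use LIMSEQ_inverse_real_of_nat in \<open>simp add: inverse_eq_divide\<close>)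
  show "\<forall>\<^sub>F n in sequentially. \<exists>z\<in>?P n. dist z l < \<epsilon>" if l: "l \<in> spectrum (op_add T V)" and \<epsilon>: "\<epsilon> > 0" for l \<epsilon>
  proof (cases "l \<in> nr_hull")
    case True
    from samples_dense[OF this \<epsilon>] show ?thesis
    proof eventually_elim
      case (elim n)
      then obtain m c where "m \<le> n" "c \<in> samples (d m) n" "dist (rayleigh (d m) (T_entry m) c) l < \<epsilon>" by blast
      then show ?case unfolding P by (intro bexI[of _ "rayleigh (d m) (T_entry m) c"]) auto
    qed
  next
    case False
    then have el: "eigen l" using l unfolding spectrum_H by blast
    have e2: "\<epsilon> / 2 > 0" using \<epsilon> by simp
    \<comment> \<open>One half of \<open>\<epsilon>\<close> is spent on the Galerkin eigenvalue and
      one on the rounding. The bound \<open>M\<close> ensures that the Galerkin eigenvalue has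
      modulus at most \<open>n + 1\<close>, where the grid is guaranteed to find it.\<close>
    obtain M :: nat where M: "cmod l + \<epsilon> < real M" using reals_Archimedean2 by blast
    have "\<forall>\<^sub>F n in sequentially. M \<le> n" by (rule eventually_ge_at_top)
    with eigen_approximated[OF False el e2] inv[OF e2] show ?thesis
    proof eventually_elim
      case (elim n)
      then obtain x where x: "dist l x \<le> \<epsilon> / 2" "chp n x = 0" by blast
      have "cmod x \<le> cmod l + dist l x" using norm_triangle_sub[of x l] by (simp add: dist_norm norm_minus_commute)
      then have xn: "cmod x \<le> real n + 1" using x(1) M elim(3) \<epsilon> by linarith
      have fine: "2 * (real n + 3 + entry_sum (d n) (entry n)) ^ d n < real (N n) * (1 / real (Suc n)) ^ d n"
        using N[of n] unfolding fine_enough_def entry_eq[symmetric] .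
      obtain z where z: "z \<in> grid (N n) (int (N n * (n + 2)))" "cmod (chp n z) < (1 / real (Suc n)) ^ d n"
        "dist z x < 1 / real (Suc n)"
        using charpoly_root_on_grid[OF x(2)[unfolded chp_def] xn fine] unfolding chp_def by blast
      have "dist z l < \<epsilon>" using dist_triangle[of z l x] z(3) x(1) elim(2) by (simp add: dist_commute)
      then show ?case using z(1,2) unfolding P by (intro bexI[of _ z]) auto
    qed
  qed
  show "\<forall>\<^sub>F n in sequentially. \<forall>z\<in>?P n. norm z \<le> r \<longrightarrow> (\<exists>l\<in>spectrum (op_add T V). dist z l < \<epsilon>)"
    if \<epsilon>: "\<epsilon> > 0" for r \<epsilon>
  proof -
    \<comment> \<open>The region to be cleared of Galerkin eigenvalues. The radius exceeds
      \<open>r\<close> because the eigenvalue \<open>x\<close> belonging to an accepted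
      \<open>z\<close> may lie slightly farther out.\<close>
    define C where "C = cball 0 (r + \<epsilon>) \<inter> {z. \<epsilon> / 2 \<le> infdist z (spectrum (op_add T V))}"
    have "closed {z. \<epsilon> / 2 \<le> infdist z (spectrum (op_add T V))}" by (intro closed_Collect_le continuous_intros)
    then have "compact C" unfolding C_def by (rule compact_Int_closed[OF compact_cball])
    moreover have "C \<inter> spectrum (op_add T V) = {}" unfolding C_def using \<epsilon> by auto
    ultimately obtain M where M: "\<forall>n\<ge>M. \<forall>z\<in>C. chp n z \<noteq> 0" using chp_nonzero_off_spectrum by blast
    have "\<epsilon> / 2 > 0" using \<epsilon> by simp
    from inv[OF this] eventually_ge_at_top[of M] show ?thesis
    proof eventually_elim
      case (elim n)
      show ?case
      proof (intro ballI impI)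
        fix z assume z: "z \<in> ?P n" "norm z \<le> r"
        then consider m c where "m \<le> n" "c \<in> samples (d m) n" "z = rayleigh (d m) (T_entry m) c"
          | "cmod (chp n z) < (1 / real (Suc n)) ^ d n" unfolding P by auto
        then show "\<exists>l\<in>spectrum (op_add T V). dist z l < \<epsilon>"
        proof cases
          case 1
          then have "z \<in> nr_hull" unfolding samples_def using rayleigh_hull by auto
          then show ?thesis using \<epsilon> unfolding spectrum_H by (intro bexI[of _ z]) simp_all
        next
          case 2
          have "\<exists>x. charpoly (d n) (entry n) x = 0 \<and> dist z x < 1 / real (Suc n)"
            using 2 unfolding chp_def by (rule charpoly_small_near_root) simp
          then obtain x where x: "chp n x = 0" "dist z x < \<epsilon> / 2" using elim(1) unfolding chp_def by force
          have "x \<notin> C" using M elim(2) x(1) by blast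
          moreover have "norm x \<le> r + \<epsilon>"
            using z(2) x(2) \<epsilon> norm_triangle_sub[of x z] by (simp add: dist_norm norm_minus_commute)
          ultimately have lt: "infdist x (spectrum (op_add T V)) < \<epsilon> / 2" unfolding C_def by simp
          obtain l where l: "l \<in> spectrum (op_add T V)" "infdist x (spectrum (op_add T V)) = dist x l"
            using infdist_attains_inf[OF closed_spectrum_H S] by blast
          have "dist z l < \<epsilon>" using dist_triangle[of z l x] x(2) lt l(2) by simp
          then show ?thesis using l(1) by (intro bexI[of _ l])
        qed
      qed
    qed
  qed
qed

text \<open>The convergence criterion requires a nonempty limit set; here one Rayleigh quotient of
  \<open>T\<close> provides a point.\<close>

lemma spectrum_nonempty:
  assumes "(x0::'a) \<noteq> 0"
  shows "spectrum (op_add T V) \<noteq> {}"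
proof -
  have "\<exists>x\<in>D. x \<noteq> 0"
  proof (rule ccontr)
    assume "\<not> ?thesis"
    then have "D \<subseteq> {0}" by blast
    then have "closure D \<subseteq> {0}" by (rule closure_minimal) simp
    then show False using dense assms by blast
  qed
  then obtain x where "x \<in> D" "x \<noteq> 0" by blast
  then have "nr_hull \<noteq> {}" using rayleigh_in_hull by blast
  then show ?thesis unfolding spectrum_H by blast
qed

end

subsection \<open>An operator with infinite spectrum\<close>

lemma op_adjoint_symmetric:
  fixes F :: "'a::complex_hilbert \<Rightarrow> 'a"
  assumes "\<And>x y. cinner (F x) y = cinner x (F y)"
  shows "op_adjoint (\<lambda>x. Some (F x)) = (\<lambda>x. Some (F x))"
proof
  fix y
  let ?T = "\<lambda>x. Some (F x)"
  have ex: "\<forall>x\<in>dom ?T. cinner (op_app ?T x) y = cinner x (F y)" using assms by simp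
  have "(THE z. \<forall>x\<in>dom ?T. cinner (op_app ?T x) y = cinner x z) = F y"
  proof (rule the_equality)
    fix z assume "\<forall>x\<in>dom ?T. cinner (op_app ?T x) y = cinner x z"
    then have "cinner (z - F y) z = cinner (z - F y) (F y)" using assms by (simp add: dom_def)
    then have "cinner (z - F y) (z - F y) = 0" by (simp add: cinner_diff_right[of "z - F y"])
    then show "z = F y" by (simp add: cinner_self)
  qed (rule ex)
  then show "op_adjoint ?T y = Some (F y)" using ex unfolding op_adjoint_def by auto
qed

abbreviation zero_op :: "'a::complex_hilbert unbounded_op" where
  "zero_op \<equiv> (\<lambda>x. Some 0)"

lemma dom_zero_op: "dom zero_op = UNIV"
  by (simp add: dom_def)

lemma selfadjoint_zero_op: "selfadjoint_op (zero_op :: 'a::complex_hilbert unbounded_op)"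
proof -
  have "op_adjoint zero_op = (zero_op :: 'a unbounded_op)" by (rule op_adjoint_symmetric) simp
  moreover have "linear_op (zero_op :: 'a unbounded_op)"
    unfolding linear_op_def dom_zero_op by (simp add: complex_vector.subspace_UNIV)
  ultimately show ?thesis unfolding selfadjoint_op_def dom_zero_op by simp
qed

text \<open>In infinite dimension the zero operator is not semi-Fredholm: its kernel is the whole
  space and its range is trivial. Every other shift is a bijective multiple of the identity.\<close>

lemma zero_op_spectra:
  assumes inf: "\<not> finite_dim (UNIV :: 'a::complex_hilbert set)"
  shows "spectrum (zero_op :: 'a unbounded_op) = {0}" "ess_spectrum5 (zero_op :: 'a unbounded_op) = {0}"
    "ess_spectrum2 (zero_op :: 'a unbounded_op) \<subseteq> {0}"
proof -
  let ?Z = "zero_op :: 'a unbounded_op"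
  interpret selfadjoint ?Z by (rule selfadjoint.intro[OF selfadjoint_zero_op])
  have app: "op_app (op_shift ?Z z) x = - (z *\<^sub>C x)" for z and x :: 'a
    by (simp add: op_shift_def)
  have res: "z \<in> resolvent_set ?Z" if "z \<noteq> 0" for z
  proof -
    have "bij_betw (op_app (op_shift ?Z z)) UNIV UNIV"
    proof (rule bij_betw_byWitness[of _ "\<lambda>y. - (inverse z *\<^sub>C y)"])
    qed (use that in \<open>simp_all add: app scaleC_scaleC scaleC_one\<close>)
    moreover have "norm x \<le> inverse (cmod z) * norm (op_app (op_shift ?Z z) x)" for x :: 'a
      using that by (simp add: app norm_scaleC flip: norm_inverse mult.assoc norm_mult)
    ultimately show ?thesis unfolding resolvent_set_def dom_zero_op by blast
  qed
  have nsf: "\<not> semi_fredholm (op_shift ?Z 0)"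
  proof
    assume "semi_fredholm (op_shift ?Z 0)"
    then consider "finite_dim (op_kernel (op_shift ?Z 0))" | "finite_codim (ran (op_shift ?Z 0))"
      unfolding semi_fredholm_def by blast
    then show False
    proof cases
      case 1
      have "op_kernel (op_shift ?Z 0) = UNIV" unfolding op_kernel_def op_shift_def by simp
      then show False using 1 inf by simp
    next
      case 2
      have "ran (op_shift ?Z 0) = {0}" unfolding ran_def op_shift_def by auto
      then obtain S where "finite S" "complex_vector.span ({0} \<union> S) = (UNIV :: 'a set)"
        using 2 unfolding finite_codim_def by auto
      then show False using inf unfolding finite_dim_def by (metis finite.emptyI finite.insertI finite_UnI subset_refl)
    qed
  qed
  have D5: "Delta5 ?Z = - {0}"
  proof
    show "Delta5 ?Z \<subseteq> - {0}" using nsf Delta5_subset_semi_fredholm[of 0 ?Z] by auto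
    have "resolvent_set ?Z \<subseteq> Delta5 ?Z" by (rule resolvent_subset_Delta5[OF semi_fredholm_if_resolvent])
    then show "- {0} \<subseteq> Delta5 ?Z" using res by blast
  qed
  then show "ess_spectrum5 ?Z = {0}" by (simp add: ess_spectrum5_def)
  have "0 \<notin> resolvent_set ?Z" using semi_fredholm_if_resolvent nsf by blast
  then show "spectrum ?Z = {0}" using res unfolding spectrum_def by blast
  show "ess_spectrum2 ?Z \<subseteq> {0}"
  proof
    fix z assume "z \<in> ess_spectrum2 ?Z"
    then obtain x :: "nat \<Rightarrow> 'a" where x: "\<forall>k. norm (x k) = 1" "(\<lambda>k. norm (op_app (op_shift ?Z z) (x k))) \<longlonglongrightarrow> 0"
      unfolding ess_spectrum2_def by blast
    then have "(\<lambda>k::nat. cmod z) \<longlonglongrightarrow> 0" by (simp add: app)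
    then show "z \<in> {0}" by (simp add: LIMSEQ_const_iff)
  qed
qed

text \<open>Makes the hypothesis on strong convergence of the projections usable, in order to see
  that the union of the spaces is dense.\<close>

lemma orth_proj_eq_oproj:
  assumes "finite I" "orthonormal_on f I" "complex_vector.span (f ` I) = S"
  shows "orth_proj S x = oproj f I x"
  unfolding orth_proj_def
proof (rule the_equality)
  show "oproj f I x \<in> S \<and> (\<forall>y\<in>S. cinner (x - oproj f I x) y = 0)"
    using oproj_in_span[OF assms(1,2)] cinner_diff_oproj[OF assms(1,2)] assms(3) by blast
  fix p assume p: "p \<in> S \<and> (\<forall>y\<in>S. cinner (x - p) y = 0)"
  have "oproj f I x - p \<in> S"
    using oproj_in_span[OF assms(1,2)] p unfolding assms(3)[symmetric] by (intro complex_vector.span_diff) simp_all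
  then have "cinner (x - p) (oproj f I x - p) = 0" "cinner (x - oproj f I x) (oproj f I x - p) = 0"
    using p cinner_diff_oproj[OF assms(1,2)] assms(3) by blast+
  then have "cinner ((x - p) - (x - oproj f I x)) (oproj f I x - p) = 0"
    by (simp only: cinner_diff_left[of "x - p"] diff_self)
  then have "cinner (oproj f I x - p) (oproj f I x - p) = 0" by simp
  then show "p = oproj f I x" by (simp add: cinner_self)
qed

section \<open>A compact diagonal operator with the eigenvalues \<open>(1/2) ^ n\<close>\<close>

context
  fixes u :: "nat \<Rightarrow> 'a::complex_hilbert"
  assumes u: "orthonormal_on u UNIV"
begin

definition diag_term where "diag_term n x = ((1/2) ^ n * cinner x (u n)) *\<^sub>C u n"
definition diag where "diag x = (\<Sum>n. diag_term n x)"

lemma norm_diag_term: "norm (diag_term n x) \<le> (1/2) ^ n * norm x"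
proof -
  have nu: "norm (u n) = 1" by (rule orthonormal_on_norm[OF u]) simp
  have "cmod (cinner x (u n)) \<le> norm x" using cinner_bound[of x "u n"] nu by simp
  then show ?thesis by (simp add: diag_term_def nu norm_mult norm_power norm_divide mult_left_mono divide_right_mono)
qed

lemma summable_scaled_geometric: "summable (\<lambda>n. (1/2::real) ^ (n + N) * c)"
  unfolding power_add by (intro summable_mult2 summable_geometric) simp

lemma summable_diag_norm: "summable (\<lambda>n. norm (diag_term (n + N) x))"
  by (rule summable_comparison_test'[OF summable_scaled_geometric[of N "norm x"], of 0]) (use norm_diag_term in simp)

lemma summable_diag: "summable (\<lambda>n. diag_term n x)"
  using summable_norm_cancel[OF summable_diag_norm[of 0 x]] by simp

text \<open>The truncation error is uniform on bounded sets, as is required for compactness of a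
  limit of finite rank operators.\<close>

lemma norm_diag_tail: "norm (diag x - (\<Sum>n<N. diag_term n x)) \<le> 2 * (1/2) ^ N * norm x"
proof -
  have "diag x - (\<Sum>n<N. diag_term n x) = (\<Sum>n. diag_term (n + N) x)"
    unfolding diag_def using suminf_split_initial_segment[OF summable_diag, of x N] by simp
  also have "norm \<dots> \<le> (\<Sum>n. norm (diag_term (n + N) x))" by (rule summable_norm[OF summable_diag_norm])
  also have "\<dots> \<le> (\<Sum>n. (1/2) ^ (n + N) * norm x)"
    by (rule suminf_le[OF norm_diag_term summable_diag_norm summable_scaled_geometric])
  also have "\<dots> = 2 * (1/2) ^ N * norm x"
  proof -
    have "(\<lambda>n. (1/2::real) ^ n) sums (1 / (1 - 1/2))" by (rule geometric_sums) simp
    then have "(\<lambda>n. (1/2::real) ^ n * ((1/2) ^ N * norm x)) sums (2 * ((1/2) ^ N * norm x))"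
      by (intro sums_mult2) simp
    then show ?thesis by (simp add: sums_iff power_add mult.assoc)
  qed
  finally show ?thesis .
qed

lemma norm_diag: "norm (diag x) \<le> 2 * norm x"
  using norm_diag_tail[of x 0] by simp

lemma diag_add: "diag (x + y) = diag x + diag y"
  unfolding diag_def suminf_add[OF summable_diag summable_diag]
  by (simp add: diag_term_def cinner_add_left distrib_left scaleC_add_left)

lemma diag_scaleC: "diag (c *\<^sub>C x) = c *\<^sub>C diag x"
proof -
  have "bounded_linear (\<lambda>y::'a. c *\<^sub>C y)"
    by (rule bounded_bilinear.bounded_linear_right[OF bounded_bilinear_scaleC])
  from bounded_linear.suminf[OF this summable_diag[of x]]
  have "c *\<^sub>C diag x = (\<Sum>n. c *\<^sub>C diag_term n x)" unfolding diag_def .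
  moreover have "c *\<^sub>C diag_term n x = diag_term n (c *\<^sub>C x)" for n
    by (simp add: diag_term_def cinner_scaleC_left scaleC_scaleC mult.left_commute)
  ultimately show ?thesis by (simp add: diag_def)
qed

lemma diag_symmetric: "cinner (diag x) y = cinner x (diag y)"
proof -
  have "bounded_linear (\<lambda>z. cinner z y)"
    by (rule bounded_bilinear.bounded_linear_left[OF bounded_bilinear_cinner])
  from bounded_linear.suminf[OF this summable_diag[of x]]
  have 1: "cinner (diag x) y = (\<Sum>n. cinner (diag_term n x) y)" unfolding diag_def .
  have "bounded_linear (\<lambda>z. cinner x z)"
    by (rule bounded_bilinear.bounded_linear_right[OF bounded_bilinear_cinner])
  from bounded_linear.suminf[OF this summable_diag[of y]]
  have 2: "cinner x (diag y) = (\<Sum>n. cinner x (diag_term n y))" unfolding diag_def .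
  have "cinner (diag_term n x) y = cinner x (diag_term n y)" for n
    using cinner_commute[of y "u n"]
    by (simp add: diag_term_def cinner_scaleC_left cinner_scaleC_right)
  then show ?thesis unfolding 1 2 by simp
qed

lemma diag_basis: "diag (u n) = complex_of_real ((1/2) ^ n) *\<^sub>C u n"
proof -
  have "diag_term m (u n) = (if m = n then complex_of_real ((1/2) ^ n) *\<^sub>C u n else 0)" for m
    using u by (simp add: diag_term_def orthonormal_on_def)
  then have "(\<lambda>m. diag_term m (u n)) sums (complex_of_real ((1/2) ^ n) *\<^sub>C u n)"
    using sums_single[of n "\<lambda>_. complex_of_real ((1/2) ^ n) *\<^sub>C u n"] by (simp only:)
  then show ?thesis unfolding diag_def by (rule sums_unique[symmetric])
qed

text \<open>The truncated series depend on finitely many bounded coordinates, so they have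
  convergent subsequences, and they approximate \<open>diag\<close> uniformly along the bounded
  sequence.\<close>

lemma diag_compact:
  assumes x: "\<And>k. norm (x k) \<le> b"
  obtains r :: "nat \<Rightarrow> nat" where "strict_mono r" "convergent (\<lambda>k. diag (x (r k)))"
proof (rule convergent_subseq_if_approximable[of "\<lambda>k. diag (x k)"])
  fix \<epsilon> :: real assume \<epsilon>: "\<epsilon> > 0"
  have b0: "0 \<le> b" using order_trans[OF norm_ge_zero x] .
  \<comment> \<open>The summand \<open>1\<close> in the denominator covers the case
    \<open>b = 0\<close>.\<close>
  obtain N where N: "(1/2::real) ^ N < \<epsilon> / (2 * b + 1)"
    using real_arch_pow_inv[of "\<epsilon> / (2 * b + 1)" "1/2"] \<epsilon> b0 by auto
  have Nb: "2 * (1/2) ^ N * b \<le> \<epsilon>"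
  proof -
    have "(1/2) ^ N * (2 * b) \<le> (1/2) ^ N * (2 * b + 1)" by (intro mult_left_mono) simp_all
    also have "\<dots> \<le> \<epsilon>" using N b0 by (simp add: pos_less_divide_eq)
    finally show ?thesis by (simp add: mult_ac)
  qed
  define w where "w k = (\<Sum>n<N. diag_term n (x k))" for k
  have close: "dist (diag (x k)) (w k) \<le> \<epsilon>" for k
  proof -
    have "norm (diag (x k) - w k) \<le> 2 * (1/2) ^ N * norm (x k)" unfolding w_def by (rule norm_diag_tail)
    also have "\<dots> \<le> 2 * (1/2) ^ N * b" using x by (intro mult_left_mono) simp_all
    finally show ?thesis using Nb by (simp add: dist_norm)
  qed
  have "subseq_compact w"
    unfolding subseq_compact_def
  proof (rule allI, rule impI)
    fix s :: "nat \<Rightarrow> nat"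
    obtain r where r: "strict_mono (r::nat \<Rightarrow> nat)" "\<And>i. i \<in> {..<N} \<Longrightarrow> convergent (\<lambda>k. cinner (x (s (r k))) (u i))"
    proof (rule bounded_coordinates_convergent_subseq[where c = "\<lambda>k i. cinner (x (s k)) (u i)" and I = "{..<N}" and B = b])
      show "cmod (cinner (x (s k)) (u i)) \<le> b" for k i
        using order_trans[OF cinner_bound[of "x (s k)" "u i"]] x[of "s k"] orthonormal_on_norm[OF u, of i] by simp
    qed auto
    define l where "l i = lim (\<lambda>k. cinner (x (s (r k))) (u i))" for i
    have l: "(\<lambda>k. cinner (x (s (r k))) (u i)) \<longlonglongrightarrow> l i" if "i \<in> {..<N}" for i
      using r(2)[OF that] unfolding l_def convergent_LIMSEQ_iff .
    have "(\<lambda>k. w (s (r k))) \<longlonglongrightarrow> (\<Sum>n<N. ((1/2) ^ n * l n) *\<^sub>C u n)"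
      unfolding w_def diag_term_def by (intro tendsto_intros l)
    then show "\<exists>r::nat \<Rightarrow> nat. strict_mono r \<and> convergent (\<lambda>k. w (s (r k)))"
      using r(1) convergentI by (intro exI[of _ r] conjI)
  qed
  with close show "\<exists>w. (\<forall>k. dist (diag (x k)) (w k) \<le> \<epsilon>) \<and> subseq_compact w"
    by (intro exI[of _ w] conjI allI)
qed (rule that)

text \<open>Relative to the zero operator, relative compactness is compactness, a core is a dense
  subspace, and the extended essential spectrum has at most one point, which makes it
  convex.\<close>

lemma diag_admissible:
  assumes inf: "\<not> finite_dim (UNIV :: 'a set)"
    and Hs: "complex_vector.subspace (\<Union>n. Hs n :: 'a set)" "closure (\<Union>n. Hs n) = UNIV"
  shows "admissible_decomposition Hs zero_op (\<lambda>x. Some (diag x))"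
proof -
  let ?V = "\<lambda>x. Some (diag x)"
  have adj: "op_adjoint ?V = ?V" by (rule op_adjoint_symmetric) (rule diag_symmetric)
  have "linear_op ?V"
    unfolding linear_op_def by (simp add: dom_def diag_add diag_scaleC complex_vector.subspace_UNIV)
  moreover have "dom ?V = UNIV" by (simp add: dom_def)
  moreover have "\<forall>x. norm (op_app ?V x) \<le> 2 * norm x" using norm_diag by simp
  ultimately have bdd: "bounded_op ?V" unfolding bounded_op_def by blast
  have comp: "relatively_compact zero_op ?V"
    unfolding relatively_compact_def
  proof (rule conjI, simp add: dom_def, rule allI, rule impI)
    fix x :: "nat \<Rightarrow> 'a"
    assume "range x \<subseteq> dom zero_op \<and> bounded (range x) \<and> bounded (range (\<lambda>k. op_app zero_op (x k)))"
    then have "bounded (range x)" by (elim conjE)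
    then obtain b where "\<And>k. norm (x k) \<le> b" unfolding bounded_iff by blast
    then obtain r :: "nat \<Rightarrow> nat" where "strict_mono r" "convergent (\<lambda>k. diag (x (r k)))"
      by (rule diag_compact)
    then show "\<exists>r. strict_mono r \<and> convergent (\<lambda>k. op_app ?V (x (r k)))"
      by (intro exI[of _ r] conjI) simp_all
  qed
  have core: "core_of (\<Union>n. Hs n) zero_op"
  proof -
    have 1: "Map.graph (zero_op |` (\<Union>n. Hs n)) = (\<Union>n. Hs n) \<times> {0::'a}"
      unfolding Map.graph_def by (auto simp: restrict_map_def split: if_splits)
    have 2: "Map.graph zero_op = (UNIV :: 'a set) \<times> {0::'a}"
      unfolding Map.graph_def by auto
    show ?thesis unfolding core_of_def 1 2 closure_Times using Hs by (simp add: dom_zero_op)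
  qed
  have ba: "bounded_above_op (zero_op :: 'a unbounded_op)" and bb: "bounded_below_op (zero_op :: 'a unbounded_op)"
    unfolding bounded_above_op_def bounded_below_op_def by (intro exI[of _ 0]; simp)+
  have "ext_ess_spectrum (zero_op :: 'a unbounded_op) \<subseteq> {ereal 0}"
    unfolding ext_ess_spectrum_def using ba bb zero_op_spectra(3)[OF inf] by auto
  then have "ereal_convex (ext_ess_spectrum (zero_op :: 'a unbounded_op))"
    unfolding ereal_convex_def by (metis order_antisym singletonD subsetD)
  then show ?thesis
    unfolding admissible_decomposition_def adj semibounded_op_def
    using selfadjoint_zero_op ba core zero_op_spectra(1,2)[OF inf] bdd comp by simp
qed

lemma diag_spectrum_infinite: "infinite (spectrum (op_add zero_op (\<lambda>x. Some (diag x))))"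
proof -
  let ?H = "op_add zero_op (\<lambda>x. Some (diag x))"
  have H: "?H = (\<lambda>x. Some (diag x))" by (auto simp: op_add_def dom_def)
  have "complex_of_real ((1/2) ^ n) \<in> spectrum ?H" for n
  proof (rule ccontr)
    let ?l = "complex_of_real ((1/2) ^ n)"
    assume "?l \<notin> spectrum ?H"
    then have "inj_on (op_app (op_shift ?H ?l)) (dom ?H)"
      unfolding spectrum_def resolvent_set_def by (simp add: bij_betw_def)
    then have inj: "inj (\<lambda>x. diag x - ?l *\<^sub>C x)" unfolding H by (simp add: dom_def op_shift_def)
    have "diag (u n) - ?l *\<^sub>C u n = 0" unfolding diag_basis by simp
    moreover have "diag 0 = 0" using diag_scaleC[of 0 0] by simp
    then have "diag 0 - ?l *\<^sub>C 0 = 0" by simp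
    ultimately have "diag (u n) - ?l *\<^sub>C u n = diag 0 - ?l *\<^sub>C 0" by (simp only:)
    from injD[OF inj this] have "u n = 0" .
    then show False using orthonormal_on_norm[OF u, of n] by simp
  qed
  then have "range (\<lambda>n. complex_of_real ((1/2) ^ n)) \<subseteq> spectrum ?H" by blast
  moreover have "inj (\<lambda>n. complex_of_real ((1/2) ^ n))"
    by (rule injI) (simp only: of_real_eq_iff, subst (asm) power_inject_exp', simp_all)
  then have "infinite (range (\<lambda>n. complex_of_real ((1/2) ^ n)))" using range_inj_infinite by blast
  ultimately show ?thesis using finite_subset by blast
qed

end

section \<open>Existence of a tower of height one and impossibility of height zero\<close>

theorem theorem3p1:
  fixes Hs :: "nat \<Rightarrow> 'a::complex_hilbert set"
    and k :: "nat \<Rightarrow> nat"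
    and e :: "nat \<Rightarrow> nat \<Rightarrow> 'a"
    and s_T s_V :: "'a unbounded_op \<Rightarrow> 'a unbounded_op"
  assumes "separable_type TYPE('a)"
    and "\<not> finite_dim (UNIV :: 'a set)"
    and "\<And>n. complex_vector.subspace (Hs n)"
    and "\<And>n. finite_dim (Hs n)"
    and "\<And>n. Hs n \<subseteq> Hs (Suc n)"
    and "\<And>x. (\<lambda>n. orth_proj (Hs n) x) \<longlonglongrightarrow> x"
    and "\<And>n. orthonormal_basis (e n) (k n) (Hs n)"
    and "\<And>H. H \<in> Omega2 Hs \<Longrightarrow>
           admissible_decomposition Hs (s_T H) (s_V H) \<and> H = op_add (s_T H) (s_V H)"
  shows "SCI_spectrum (Omega2 Hs) (Lambda2 k e s_T s_V) = 1"
proof -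
  \<comment> \<open>The given bases are indexed from \<open>1\<close>, the matrices from
    \<open>0\<close>.\<close>
  define f where "f n j = e n (Suc j)" for n j
  have f_image: "f n ` {..<k n} = e n ` {1..k n}" for n
  proof -
    have "Suc ` {..<k n} = {1..k n}" by (simp add: lessThan_atLeast0 image_Suc_atLeastLessThan atLeastLessThanSuc_atLeastAtMost)
    then show ?thesis unfolding f_def[abs_def] by (simp only: image_image[symmetric, of "e n" Suc])
  qed
  have basis: "orthonormal_on (f n) {..<k n}" "complex_vector.span (f n ` {..<k n}) = Hs n" for n
    using assms(7)[of n] unfolding f_image unfolding orthonormal_basis_def orthonormal_on_def f_def by auto
  have galerkin: "galerkin (s_T H) (s_V H) Hs f k" if H: "H \<in> Omega2 Hs" for H
  proof (intro galerkin.intro selfadjoint.intro galerkin_axioms.intro)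
    show adm: "admissible_decomposition Hs (s_T H) (s_V H)" using assms(8)[OF H] by blast
    show "selfadjoint_op (s_T H)" using adm by (simp add: admissible_decomposition_def)
  qed (use assms(5) basis in simp_all)
  \<comment> \<open>Infinite dimension provides this sequence. It serves twice: for a nonzero vector
    in the convergence proof and for the diagonal operator in the lower bound.\<close>
  obtain u :: "nat \<Rightarrow> 'a" where u: "orthonormal_on u UNIV"
  proof (rule subspace_orthonormal_dichotomy[OF complex_vector.subspace_UNIV])
    fix g and n :: nat assume "complex_vector.span (g ` {..<n}) = (UNIV :: 'a set)"
    then have "finite_dim (UNIV :: 'a set)" unfolding finite_dim_def by (intro exI[of _ "g ` {..<n}"]) simp
    then show thesis using assms(2) by blast
  next
    fix g :: "nat \<Rightarrow> 'a" assume "orthonormal_on g UNIV"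
    then show thesis by (rule that)
  qed
  \<comment> \<open>The indices are interchanged because the rows and columns of
    \<open>T_entry\<close> stand in the opposite order to the arguments of
    \<open>matrix_entry\<close>.\<close>
  define aT where "aT m i j = matrix_entry e (Suc j) (Suc i) m \<circ> s_T" for m i j
  define aV where "aV m i j = matrix_entry e (Suc j) (Suc i) m \<circ> s_V" for m i j
  \<comment> \<open>The evaluations available at stage \<open>n\<close> do not depend on the
    operator, so the requirement that the set of evaluations be the same for indistinguishable
    inputs holds trivially.\<close>
  define L where "L n = (\<Union>m\<le>n. (\<lambda>(i, j). aT m i j) ` ({..<k m} \<times> {..<k m}) \<union> (\<lambda>(i, j). aV m i j) ` ({..<k m} \<times> {..<k m}))" for n
  have L_fin: "finite (L n)" for n unfolding L_def by (intro finite_UN_I finite_UnI finite_imageI finite_cartesian_product) simp_all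
  have L_sub: "L n \<subseteq> Lambda2 k e s_T s_V" for n
  proof
    fix g assume "g \<in> L n"
    then obtain m i j where mij: "i < k m" "j < k m" "g = aT m i j \<or> g = aV m i j" unfolding L_def by auto
    then have "Suc j \<in> {1..k m}" "Suc i \<in> {1..k m}" by simp_all
    then show "g \<in> Lambda2 k e s_T s_V" using mij(3) unfolding Lambda2_def aT_def aV_def by blast
  qed
  have "\<exists>p. \<forall>v. \<exists>F zs N. F \<subseteq> L n \<and> computes v p F zs \<and>
      fine_enough (k n) (\<lambda>i j. v (aT n i j) + v (aV n i j)) n N \<and>
      set zs = approx_points k (\<lambda>m i j. v (aT m i j)) (\<lambda>m i j. v (aV m i j)) n N" for n
  proof (rule exists_approx_computation)
    fix m i j assume "m \<le> n" "i < k m" "j < k m"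
    then show "aT m i j \<in> L n \<and> aV m i j \<in> L n" unfolding L_def by auto
  qed
  then have "\<forall>n. \<exists>p. \<forall>v. \<exists>F zs N. F \<subseteq> L n \<and> computes v p F zs \<and>
      fine_enough (k n) (\<lambda>i j. v (aT n i j) + v (aV n i j)) n N \<and>
      set zs = approx_points k (\<lambda>m i j. v (aT m i j)) (\<lambda>m i j. v (aV m i j)) n N" ..
  from choice[OF this] obtain p where p: "\<forall>n v. \<exists>F zs N. F \<subseteq> L n \<and> computes v (p n) F zs \<and>
      fine_enough (k n) (\<lambda>i j. v (aT n i j) + v (aV n i j)) n N \<and>
      set zs = approx_points k (\<lambda>m i j. v (aT m i j)) (\<lambda>m i j. v (aV m i j)) n N" ..
  \<comment> \<open>\<open>computes\<close> is a relation; by determinism the list of outputs is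
    unique, so the description picks the actual result.\<close>
  define out where "out n H = (THE zs. \<exists>F. computes (\<lambda>g. g H) (p n) F zs)" for n and H :: "'a unbounded_op"
  have out: "out n H = zs" if "computes (\<lambda>g. g H) (p n) F zs" for n H F zs
    unfolding out_def
  proof (rule the_equality)
    show "\<exists>F. computes (\<lambda>g. g H) (p n) F zs" using that by (rule exI)
    fix zs' assume "\<exists>F. computes (\<lambda>g. g H) (p n) F zs'"
    then obtain F' where "computes (\<lambda>g. g H) (p n) F' zs'" ..
    then show "zs' = zs" using that by (rule computes_deterministic)
  qed
  have run: "\<exists>F N. F \<subseteq> L n \<and> computes (\<lambda>g. g H) (p n) F (out n H) \<and>
      fine_enough (k n) (\<lambda>i j. aT n i j H + aV n i j H) n N \<and>
      set (out n H) = approx_points k (\<lambda>m i j. aT m i j H) (\<lambda>m i j. aV m i j H) n N" for n H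
  proof -
    obtain F zs N where FzN: "F \<subseteq> L n" "computes (\<lambda>g. g H) (p n) F zs"
      "fine_enough (k n) (\<lambda>i j. aT n i j H + aV n i j H) n N"
      "set zs = approx_points k (\<lambda>m i j. aT m i j H) (\<lambda>m i j. aV m i j H) n N"
      using p[rule_format, of n "\<lambda>g. g H"] by (elim exE conjE)
    have "out n H = zs" by (rule out[OF FzN(2)])
    then show ?thesis using FzN by (intro exI[of _ F] exI[of _ N] conjI) simp_all
  qed
  define \<Gamma> where "\<Gamma> ns H = set (out (hd ns) H)" for ns and H :: "'a unbounded_op"
  have algorithm: "arithmetic_algorithm set (Omega2 Hs) (Lambda2 k e s_T s_V) closed_subsets_metric (\<Gamma> ns)" for ns
  proof -
    define n where "n = hd ns"
    have msp: "mspace closed_subsets_metric = {A. closed A}"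
      unfolding closed_subsets_metric_def using Metric_space.mspace_metric[OF Metric_space_attouch_wets] .
    have cong: "out n S = out n H" if "\<forall>g\<in>L n. g H = g S" for S H
    proof -
      obtain F where F: "F \<subseteq> L n" "computes (\<lambda>g. g H) (p n) F (out n H)" using run[of n H] by (elim exE conjE)
      have "computes (\<lambda>g. g S) (p n) F (out n H)"
        by (rule computes_cong[OF F(2)]) (use F(1) that in blast)
      then show ?thesis by (rule out)
    qed
    show ?thesis
      unfolding arithmetic_algorithm_def msp
    proof (intro conjI)
      show "\<Gamma> ns ` Omega2 Hs \<subseteq> {A. closed A}" unfolding \<Gamma>_def by (auto intro: finite_imp_closed)
      show "\<exists>\<Lambda>\<Gamma>. (\<forall>H\<in>Omega2 Hs. finite (\<Lambda>\<Gamma> H) \<and> \<Lambda>\<Gamma> H \<subseteq> Lambda2 k e s_T s_V \<and>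
           (\<forall>S\<in>Omega2 Hs. (\<forall>g\<in>\<Lambda>\<Gamma> H. g H = g S) \<longrightarrow> \<Gamma> ns S = \<Gamma> ns H \<and> \<Lambda>\<Gamma> S = \<Lambda>\<Gamma> H)) \<and>
        (\<exists>p. \<forall>H\<in>Omega2 Hs. \<exists>F zs. computes (\<lambda>g. g H) p F zs \<and> F \<subseteq> \<Lambda>\<Gamma> H \<and> \<Gamma> ns H = set zs)"
      proof (rule exI[of _ "\<lambda>_. L n"], intro conjI ballI impI)
        show "finite (L n)" by (rule L_fin)
        show "L n \<subseteq> Lambda2 k e s_T s_V" by (rule L_sub)
        show "\<Gamma> ns S = \<Gamma> ns H" if "\<forall>g\<in>L n. g H = g S" for S H
          unfolding \<Gamma>_def n_def[symmetric] cong[OF that] ..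
        show "\<exists>p. \<forall>H\<in>Omega2 Hs. \<exists>F zs. computes (\<lambda>g. g H) p F zs \<and> F \<subseteq> L n \<and> \<Gamma> ns H = set zs"
        proof (rule exI[of _ "p n"], rule ballI)
          fix H
          obtain F where "F \<subseteq> L n" "computes (\<lambda>g. g H) (p n) F (out n H)" using run[of n H] by (elim exE conjE)
          then show "\<exists>F zs. computes (\<lambda>g. g H) (p n) F zs \<and> F \<subseteq> L n \<and> \<Gamma> ns H = set zs"
            unfolding \<Gamma>_def n_def[symmetric] by (intro exI[of _ F] exI[of _ "out n H"] conjI) simp_all
        qed
      qed simp
    qed
  qed
  have converge: "limitin (mtopology_of closed_subsets_metric) (\<lambda>n. \<Gamma> [n] H) (spectrum H) sequentially"
    if H: "H \<in> Omega2 Hs" for H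
  proof -
    interpret galerkin "s_T H" "s_V H" Hs f k by (rule galerkin[OF H])
    have HH: "op_add (s_T H) (s_V H) = H" using assms(8)[OF H] by simp
    have aT: "aT m i j H = T_entry m i j" and aV: "aV m i j H = V_entry m i j" for m i j
      unfolding aT_def aV_def T_entry_def V_entry_def B_def matrix_entry_def f_def by simp_all
    have "\<forall>n. \<exists>N. fine_enough (k n) (\<lambda>i j. T_entry n i j + V_entry n i j) n N \<and>
      \<Gamma> [n] H = approx_points k T_entry V_entry n N"
    proof
      fix n
      show "\<exists>N. fine_enough (k n) (\<lambda>i j. T_entry n i j + V_entry n i j) n N \<and>
        \<Gamma> [n] H = approx_points k T_entry V_entry n N"
        using run[of n H] unfolding \<Gamma>_def aT aV list.sel by blast
    qed
    from choice[OF this] obtain N where N: "\<forall>n. fine_enough (k n) (\<lambda>i j. T_entry n i j + V_entry n i j) n (N n) \<and>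
      \<Gamma> [n] H = approx_points k T_entry V_entry n (N n)" ..
    have "norm (u 0) = 1" by (rule orthonormal_on_norm[OF u]) simp
    then have "u 0 \<noteq> 0" by auto
    then have "spectrum (op_add (s_T H) (s_V H)) \<noteq> {}" by (rule spectrum_nonempty)
    with N have "limitin (mtopology_of closed_subsets_metric) (\<lambda>n. approx_points k T_entry V_entry n (N n))
      (spectrum (op_add (s_T H) (s_V H))) sequentially" by (intro approx_points_converge) simp_all
    then show ?thesis using N by (simp add: HH)
  qed
  have height1: "tower_of_algorithms set (Omega2 Hs) (Lambda2 k e s_T s_V) spectrum closed_subsets_metric 1 \<Gamma>"
    unfolding tower_of_algorithms_def
  proof (intro conjI allI impI ballI algorithm)
    fix H assume H: "H \<in> Omega2 Hs"
    show "iterated_limit closed_subsets_metric 1 (\<lambda>ns. \<Gamma> ns H) (spectrum H)"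
      unfolding One_nat_def iterated_limit.simps using converge[OF H] by (intro exI[of _ "\<lambda>_. spectrum H"]) simp
  qed
  \<comment> \<open>A tower of height \<open>0\<close> is a single algorithm whose output, a finite
    set, is the spectrum itself; the diagonal operator refutes this.\<close>
  have height0: "\<not> tower_of_algorithms set (Omega2 Hs) (Lambda2 k e s_T s_V) spectrum closed_subsets_metric 0 \<Delta>" for \<Delta>
  proof
    assume tower: "tower_of_algorithms set (Omega2 Hs) (Lambda2 k e s_T s_V) spectrum closed_subsets_metric 0 \<Delta>"
    let ?H = "op_add zero_op (\<lambda>x. Some (diag u x))"
    have mono: "Hs m \<subseteq> Hs n" if "m \<le> n" for m n by (rule lift_Suc_mono_le[of Hs, OF assms(5) that])
    have sub: "complex_vector.subspace (\<Union>n. Hs n)"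
    proof (rule complex_vector.subspaceI)
      show "0 \<in> (\<Union>n. Hs n)" using complex_vector.subspace_0[OF assms(3)] by blast
      show "c *\<^sub>C x \<in> (\<Union>n. Hs n)" if "x \<in> (\<Union>n. Hs n)" for c x
        using that complex_vector.subspace_scale[OF assms(3)] by blast
      show "x + y \<in> (\<Union>n. Hs n)" if xy: "x \<in> (\<Union>n. Hs n)" "y \<in> (\<Union>n. Hs n)" for x y
      proof -
        obtain m n where "x \<in> Hs m" "y \<in> Hs n" using xy by blast
        then have "x \<in> Hs (max m n)" "y \<in> Hs (max m n)" using mono[of m "max m n"] mono[of n "max m n"] by auto
        then have "x + y \<in> Hs (max m n)" by (rule complex_vector.subspace_add[OF assms(3)])
        then show ?thesis by blast
      qed
    qed
    \<comment> \<open>Strong convergence of the projections makes the union of the spaces dense,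
      which for the zero operator is the core property.\<close>
    have "x \<in> closure (\<Union>n. Hs n)" for x
    proof -
      have "orth_proj (Hs n) x \<in> Hs n" for n
        using oproj_in_span[OF _ basis(1), of n x] unfolding orth_proj_eq_oproj[OF finite_lessThan basis(1) basis(2)] basis(2) by simp
      then have "\<forall>n. orth_proj (Hs n) x \<in> (\<Union>n. Hs n)" by (intro allI UN_I[OF UNIV_I])
      then show ?thesis unfolding closure_sequential using assms(6)[of x] by (intro exI[of _ "\<lambda>n. orth_proj (Hs n) x"] conjI)
    qed
    then have "closure (\<Union>n. Hs n) = UNIV" by (intro equalityI subset_UNIV subsetI)
    then have "admissible_decomposition Hs zero_op (\<lambda>x. Some (diag u x))"
      by (rule diag_admissible[OF u assms(2) sub])
    then have H: "?H \<in> Omega2 Hs"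
      unfolding Omega2_def by (intro CollectI exI[of _ zero_op] exI[of _ "\<lambda>x. Some (diag u x)"] conjI refl)
    have "arithmetic_algorithm set (Omega2 Hs) (Lambda2 k e s_T s_V) closed_subsets_metric (\<Delta> [])"
      using tower unfolding tower_of_algorithms_def by simp
    then obtain p where p: "\<forall>T\<in>Omega2 Hs. \<exists>F zs. computes (\<lambda>f. f T) p F zs \<and> \<Delta> [] T = set zs"
      unfolding arithmetic_algorithm_def by (elim conjE exE) (rule that, rule ballI, drule bspec, assumption, elim exE conjE, intro exI conjI)
    from bspec[OF p H] have "finite (\<Delta> [] ?H)" by (elim exE conjE) simp
    moreover have "\<Delta> [] ?H = spectrum ?H" using tower H unfolding tower_of_algorithms_def by simp
    ultimately have "finite (spectrum ?H)" by simp
    then show False using diag_spectrum_infinite[OF u] by blast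
  qed
  let ?S = "{enat h | h. \<exists>\<Gamma>. tower_of_algorithms set (Omega2 Hs) (Lambda2 k e s_T s_V) spectrum closed_subsets_metric h \<Gamma>}"
  have "enat 1 \<in> ?S" using height1 by blast
  then have le: "Inf ?S \<le> enat 1" by (rule Inf_lower)
  have "enat 1 \<le> Inf ?S"
  proof (rule Inf_greatest)
    fix x assume "x \<in> ?S"
    then obtain h \<Delta> where h: "x = enat h"
      "tower_of_algorithms set (Omega2 Hs) (Lambda2 k e s_T s_V) spectrum closed_subsets_metric h \<Delta>" by blast
    have "h \<noteq> 0"
    proof
      assume "h = 0"
      with h(2) height0 show False by blast
    qed
    then show "enat 1 \<le> x" by (simp add: h(1))
  qed
  with le have "Inf ?S = enat 1" by (rule order_antisym)
  then show ?thesis unfolding SCI_def by (simp add: one_enat_def)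
qed

end
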